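(* Let $n\ge 1$, let $\Omega\subset\mathbb{R}^n$ be a bounded domain with boundary of class $C^2$ and let $\tau>0$. Let $g:[0,\infty)\to[0,\infty)$ be a $C^1$ function with $g(0)>0$ and $1-\int_0^\infty g(s)\,ds=l>0$, and suppose there is a constant $\zeta>0$ with $g'(t)\le-\zeta g(t)$ for all $t>0$. Let $t_0>0$ and $g_0=\int_0^{t_0}g(s)\,ds$. Then there exist positive constants $C_1,C_7,\delta_2,\varepsilon_1,\varepsilon_2,\sigma,\xi$, independent of $\mu$ and of the data $u_0,u_1,f_0$ below, satisfying $$\delta_2<\min\Big\{\frac{g_0}{4},\frac{l g_0}{16C_1}\Big\},\qquad \varepsilon_2<\frac{\delta_2}{2C_7},\qquad \varepsilon_2\frac{g_0}{8C_1}<\varepsilon_1<\varepsilon_2\frac{g_0-2\delta_2}{2C_1},\qquad 2k_2e^{\sigma\tau}<\xi<2k_1,$$ where $k_1=\varepsilon_2(g_0-\delta_2)-\varepsilon_1C_1$ and $k_2=\varepsilon_1C_1+\varepsilon_2\delta_2$, such that, with the positive constant $$a:=\min\{2k_1-\xi,\ \xi e^{-\sigma\tau}-2k_2\},$$ the following holds. If $\mu\in\mathbb{R}$ satisfies $|\mu|<a$, and $u$ is the solution of $$\begin{cases}u_{tt}(x,t)-\Delta u(x,t)+\int_0^t g(t-s)\Delta u(x,s)\,ds+\mu u_t(x,t-\tau)=0,& x\in\Omega,\ t>0,\\ u(x,t)=0,& x\in\partial\Omega,\ t\ge0,\\ u(x,0)=u_0(x),\quad u_t(x,0)=u_1(x),&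 x\in\Omega,\\ u_t(x,t-\tau)=f_0(x,t-\tau),& x\in\Omega,\ 0<t<\tau,\end{cases}$$ with $u_0\in H_0^1(\Omega)$, $u_1\in L^2(\Omega)$, $f_0\in L^2(-\tau,0;L^2(\Omega))$, then there exist positive constants $K$ and $\lambda$ such that $$E(t)\le K e^{-\lambda\zeta(t-t_0)}\qquad\text{for all } t\ge t_0,$$ where $E(t)$ is the energy defined in the context with these values of $\xi$ and $\sigma$.
   Context: $\|\cdot\|_2$ and $(\cdot,\cdot)$ denote the norm and inner product of $L^2(\Omega)$ (also for vector-valued functions). For a kernel $\phi$ and a function $\psi$ of $(x,t)$, $$(\phi\circ\psi)(t)=\int_0^t\phi(t-s)\int_\Omega|\psi(x,t)-\psi(x,s)|^2\,dx\,ds.$$ The energy of the problem is $$E(t)=\frac12\Big(\|u_t(t)\|_2^2+\Big(1-\int_0^tg(s)\,ds\Big)\|\nabla u(t)\|_2^2+(g\circ\nabla u)(t)\Big)+\frac{\xi}{2}\int_{t-\tau}^t\int_\Omega e^{\sigma(s-t)}u_t^2(x,s)\,dx\,ds,$$ where $\xi,\sigma>0$ are constants, and for $s\in(-\tau,0)$ one reads $u_t(x,s)=f_0(x,s)$. Solution means the (unique) function $u$ on $\Omega\times(0,\infty)$ which for every $T>0$ is a weak solution on $(0,T)$, i.e. $u\in L^2(0,T;H_0^1(\Omega))$, $u_t\in L^2(0,T;L^2(\Omega))$, and $$-\int_0^T(u_t,v_t)\,dt+\int_0^T(\nabla u(t),\nabla v(t))\,dt-\int_0^T\int_0^t g(t-s)(\nabla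 u(s),\nabla v(t))\,ds\,dt+\mu\int_0^T(u_t(t-\tau),v(t))\,dt-(u_1,v(\cdot,0))=0$$ for every $v\in L^2(0,T;H_0^1(\Omega))$ with $v_t\in L^2(0,T;L^2(\Omega))$ and $v(\cdot,T)=0$, together with $u(\cdot,0)=u_0$, $u_t(\cdot,0)=u_1$, where for $0<t<\tau$ the expression $u_t(t-\tau)$ stands for $f_0(\cdot,t-\tau)$. $E(t)$ is evaluated using the representative with $u\in C([0,\infty);H_0^1(\Omega))$ and $u_t\in C([0,\infty);L^2(\Omega))$. *)

theory Defs
  imports "HOL-Analysis.Analysis"
begin

subsection \<open>Smooth functions and domains with boundary of class C2\<close>

primrec Ck :: "nat \<Rightarrow> ('a::euclidean_space \<Rightarrow> real) \<Rightarrow> bool" where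
  "Ck 0 f \<longleftrightarrow> continuous_on UNIV f"
| "Ck (Suc k) f \<longleftrightarrow> (\<forall>x. f differentiable (at x)) \<and>
     (\<forall>i\<in>Basis. Ck k (\<lambda>x. frechet_derivative f (at x) i))"

definition test_functions :: "'a::euclidean_space set \<Rightarrow> ('a \<Rightarrow> real) set" where
  "test_functions \<Omega> = {\<phi>. (\<forall>k. Ck k \<phi>) \<and> (\<exists>K. compact K \<and> K \<subseteq> \<Omega> \<and> (\<forall>x. x \<notin> K \<longrightarrow> \<phi> x = 0))}"

text \<open>Near each boundary point, \<open>\<Omega>\<close> is the region above the graph of a C2 function \<open>\<gamma>\<close> over the
  hyperplane orthogonal to some unit vector \<open>e\<close>. The argument of \<open>\<gamma>\<close> is the projection of the point
  onto that hyperplane, so only the values of \<open>\<gamma>\<close> there matter.\<close>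

definition C2_boundary :: "'a::euclidean_space set \<Rightarrow> bool" where
  "C2_boundary \<Omega> \<longleftrightarrow> (\<forall>p\<in>frontier \<Omega>. \<exists>r>0. \<exists>e \<gamma>. norm e = 1 \<and> Ck 2 \<gamma> \<and>
     \<Omega> \<inter> ball p r = {x \<in> ball p r. \<gamma> (x - (x \<bullet> e) *\<^sub>R e) < x \<bullet> e})"

subsection \<open>Lebesgue and Sobolev spaces\<close>

text \<open>Elements of the function spaces below are represented by functions on the whole type, of which
  only the restriction to \<open>\<Omega>\<close> (up to null sets) is relevant; the norms are thus seminorms.\<close>

definition L2 :: "'a::euclidean_space set \<Rightarrow> ('a \<Rightarrow> 'b::euclidean_space) set" where
  "L2 \<Omega> = {f. f \<in> borel_measurable (lebesgue_on \<Omega>) \<and>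
     integrable (lebesgue_on \<Omega>) (\<lambda>x. (norm (f x))\<^sup>2)}"

definition L2_inner ::
  "'a::euclidean_space set \<Rightarrow> ('a \<Rightarrow> 'b::euclidean_space) \<Rightarrow> ('a \<Rightarrow> 'b) \<Rightarrow> real" where
  "L2_inner \<Omega> f h = (LINT x|lebesgue_on \<Omega>. f x \<bullet> h x)"

definition L2_norm :: "'a::euclidean_space set \<Rightarrow> ('a \<Rightarrow> 'b::euclidean_space) \<Rightarrow> real" where
  "L2_norm \<Omega> f = sqrt (LINT x|lebesgue_on \<Omega>. (norm (f x))\<^sup>2)"

definition has_weak_gradient ::
  "'a::euclidean_space set \<Rightarrow> ('a \<Rightarrow> real) \<Rightarrow> ('a \<Rightarrow> 'a) \<Rightarrow> bool" where
  "has_weak_gradient \<Omega> w G \<longleftrightarrow> (\<forall>\<phi>\<in>test_functions \<Omega>. \<forall>i\<in>Basis.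
     (LINT x|lebesgue_on \<Omega>. w x * frechet_derivative \<phi> (at x) i)
       = - (LINT x|lebesgue_on \<Omega>. (G x \<bullet> i) * \<phi> x))"

definition H1 :: "'a::euclidean_space set \<Rightarrow> ('a \<Rightarrow> real) set" where
  "H1 \<Omega> = {w \<in> L2 \<Omega>. \<exists>G\<in>L2 \<Omega>. has_weak_gradient \<Omega> w G}"

text \<open>The weak gradient is unique up to null sets; all uses below are insensitive to the choice.\<close>

definition grad :: "'a::euclidean_space set \<Rightarrow> ('a \<Rightarrow> real) \<Rightarrow> 'a \<Rightarrow> 'a" where
  "grad \<Omega> w = (SOME G. G \<in> L2 \<Omega> \<and> has_weak_gradient \<Omega> w G)"

definition H1_norm :: "'a::euclidean_space set \<Rightarrow> ('a \<Rightarrow> real) \<Rightarrow> real" where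
  "H1_norm \<Omega> w = sqrt ((L2_norm \<Omega> w)\<^sup>2 + (L2_norm \<Omega> (grad \<Omega> w))\<^sup>2)"

definition H1_0 :: "'a::euclidean_space set \<Rightarrow> ('a \<Rightarrow> real) set" where
  "H1_0 \<Omega> = {w \<in> H1 \<Omega>. \<forall>e>0. \<exists>\<phi>\<in>test_functions \<Omega>. H1_norm \<Omega> (\<lambda>x. w x - \<phi> x) < e}"

subsection \<open>Functions of time with values in a function space\<close>

text \<open>Here \<open>X\<close> is a space of functions of the space variable and \<open>N\<close> its norm. The space
  \<open>L2_time I X N\<close> is the Bochner space of square integrable functions from the interval \<open>I\<close> to \<open>X\<close>;
  strong measurability means a.e. approximability by simple functions.\<close>

definition strongly_measurable ::
  "real set \<Rightarrow> ('a \<Rightarrow> real) set \<Rightarrow> (('a \<Rightarrow> real) \<Rightarrow> real) \<Rightarrow> (real \<Rightarrow> 'a \<Rightarrow> real) \<Rightarrow> bool" where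
  "strongly_measurable I X N f \<longleftrightarrow> (\<exists>s :: nat \<Rightarrow> real \<Rightarrow> 'a \<Rightarrow> real.
     (\<forall>k. simple_function (lebesgue_on I) (s k) \<and> s k ` I \<subseteq> X) \<and>
     (AE t in lebesgue_on I. (\<lambda>k. N (\<lambda>x. s k t x - f t x)) \<longlonglongrightarrow> 0))"

definition L2_time ::
  "real set \<Rightarrow> ('a \<Rightarrow> real) set \<Rightarrow> (('a \<Rightarrow> real) \<Rightarrow> real) \<Rightarrow> (real \<Rightarrow> 'a \<Rightarrow> real) set" where
  "L2_time I X N = {f. (AE t in lebesgue_on I. f t \<in> X) \<and> strongly_measurable I X N f \<and>
     integrable (lebesgue_on I) (\<lambda>t. (N (f t))\<^sup>2)}"

definition C_time ::
  "real set \<Rightarrow> ('a \<Rightarrow> real) set \<Rightarrow> (('a \<Rightarrow> real) \<Rightarrow> real) \<Rightarrow> (real \<Rightarrow> 'a \<Rightarrow> real) set" where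
  "C_time I X N = {f. (\<forall>t\<in>I. f t \<in> X) \<and>
     (\<forall>t\<in>I. ((\<lambda>s. N (\<lambda>x. f s x - f t x)) \<longlongrightarrow> 0) (at t within I))}"

text \<open>Weak derivative in time on \<open>(0,T)\<close>. The defining identity between integrals with values in
  \<open>L2 \<Omega>\<close> is expressed by taking the inner product with each element \<open>w\<close> of that space.\<close>

definition has_weak_time_derivative ::
  "'a::euclidean_space set \<Rightarrow> real \<Rightarrow> (real \<Rightarrow> 'a \<Rightarrow> real) \<Rightarrow> (real \<Rightarrow> 'a \<Rightarrow> real) \<Rightarrow> bool" where
  "has_weak_time_derivative \<Omega> T v v' \<longleftrightarrow> (\<forall>\<phi>\<in>test_functions {0<..<T}. \<forall>w\<in>L2 \<Omega>.
     (LINT t|lebesgue_on {0..T}. deriv \<phi> t * L2_inner \<Omega> (v t) w)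
       = - (LINT t|lebesgue_on {0..T}. \<phi> t * L2_inner \<Omega> (v' t) w))"

subsection \<open>The viscoelastic wave equation with delay\<close>

text \<open>In what follows \<open>ut\<close> is the time derivative of \<open>u\<close>; it is extended to negative times by the
  history \<open>f0\<close>.\<close>

definition with_history ::
  "(real \<Rightarrow> 'a \<Rightarrow> real) \<Rightarrow> (real \<Rightarrow> 'a \<Rightarrow> real) \<Rightarrow> real \<Rightarrow> 'a \<Rightarrow> real" where
  "with_history f0 ut s = (if s < 0 then f0 s else ut s)"

text \<open>A function \<open>v\<close> in \<open>L2(0,T; H1_0)\<close> with \<open>v'\<close> in \<open>L2(0,T; L2)\<close> has a unique representative that
  is continuous into \<open>L2\<close> on \<open>[0,T]\<close>; the values \<open>v(0)\<close> and \<open>v(T)\<close> are those of this representative.\<close>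

definition admissible_test ::
  "'a::euclidean_space set \<Rightarrow> real \<Rightarrow> (real \<Rightarrow> 'a \<Rightarrow> real) \<Rightarrow> (real \<Rightarrow> 'a \<Rightarrow> real) \<Rightarrow> bool" where
  "admissible_test \<Omega> T v v' \<longleftrightarrow>
     v \<in> L2_time {0<..<T} (H1_0 \<Omega>) (H1_norm \<Omega>) \<and>
     v' \<in> L2_time {0<..<T} (L2 \<Omega>) (L2_norm \<Omega>) \<and>
     has_weak_time_derivative \<Omega> T v v' \<and>
     v \<in> C_time {0..T} (L2 \<Omega>) (L2_norm \<Omega>) \<and>
     (AE x in lebesgue_on \<Omega>. v T x = 0)"

definition weak_solution ::
  "'a::euclidean_space set \<Rightarrow> (real \<Rightarrow> real) \<Rightarrow> real \<Rightarrow> real \<Rightarrow> real \<Rightarrow>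
   ('a \<Rightarrow> real) \<Rightarrow> (real \<Rightarrow> 'a \<Rightarrow> real) \<Rightarrow> (real \<Rightarrow> 'a \<Rightarrow> real) \<Rightarrow> (real \<Rightarrow> 'a \<Rightarrow> real) \<Rightarrow> bool" where
  "weak_solution \<Omega> g \<mu> \<tau> T u1 f0 u ut \<longleftrightarrow>
     u \<in> L2_time {0<..<T} (H1_0 \<Omega>) (H1_norm \<Omega>) \<and>
     ut \<in> L2_time {0<..<T} (L2 \<Omega>) (L2_norm \<Omega>) \<and>
     has_weak_time_derivative \<Omega> T u ut \<and>
     (\<forall>v vt. admissible_test \<Omega> T v vt \<longrightarrow>
        - (LINT t|lebesgue_on {0..T}. L2_inner \<Omega> (ut t) (vt t))
        + (LINT t|lebesgue_on {0..T}. L2_inner \<Omega> (grad \<Omega> (u t)) (grad \<Omega> (v t)))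
        - (LINT t|lebesgue_on {0..T}. LINT s|lebesgue_on {0..t}.
             g (t - s) * L2_inner \<Omega> (grad \<Omega> (u s)) (grad \<Omega> (v t)))
        + \<mu> * (LINT t|lebesgue_on {0..T}. L2_inner \<Omega> (with_history f0 ut (t - \<tau>)) (v t))
        - L2_inner \<Omega> u1 (v 0) = 0)"

text \<open>\<open>u\<close> and \<open>ut\<close> are required to be the representatives continuous in time, so that they can be
  evaluated at every time, in particular at time 0.\<close>

definition is_solution ::
  "'a::euclidean_space set \<Rightarrow> (real \<Rightarrow> real) \<Rightarrow> real \<Rightarrow> real \<Rightarrow>
   ('a \<Rightarrow> real) \<Rightarrow> ('a \<Rightarrow> real) \<Rightarrow> (real \<Rightarrow> 'a \<Rightarrow> real) \<Rightarrow>
   (real \<Rightarrow> 'a \<Rightarrow> real) \<Rightarrow> (real \<Rightarrow> 'a \<Rightarrow> real) \<Rightarrow> bool" where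
  "is_solution \<Omega> g \<mu> \<tau> u0 u1 f0 u ut \<longleftrightarrow>
     (\<forall>T>0. weak_solution \<Omega> g \<mu> \<tau> T u1 f0 u ut) \<and>
     u \<in> C_time {0..} (H1_0 \<Omega>) (H1_norm \<Omega>) \<and>
     ut \<in> C_time {0..} (L2 \<Omega>) (L2_norm \<Omega>) \<and>
     (AE x in lebesgue_on \<Omega>. u 0 x = u0 x) \<and>
     (AE x in lebesgue_on \<Omega>. ut 0 x = u1 x)"

text \<open>The quantity written \<open>(k \<circ> \<psi>)(t)\<close> in the literature on viscoelastic problems.\<close>

definition memory_term ::
  "'a::euclidean_space set \<Rightarrow> (real \<Rightarrow> real) \<Rightarrow> (real \<Rightarrow> 'a \<Rightarrow> 'b::euclidean_space) \<Rightarrow> real \<Rightarrow> real" where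
  "memory_term \<Omega> k \<psi> t = (LINT s|lebesgue_on {0..t}.
     k (t - s) * (LINT x|lebesgue_on \<Omega>. (norm (\<psi> t x - \<psi> s x))\<^sup>2))"

definition energy ::
  "'a::euclidean_space set \<Rightarrow> (real \<Rightarrow> real) \<Rightarrow> real \<Rightarrow> real \<Rightarrow> real \<Rightarrow>
   (real \<Rightarrow> 'a \<Rightarrow> real) \<Rightarrow> (real \<Rightarrow> 'a \<Rightarrow> real) \<Rightarrow> (real \<Rightarrow> 'a \<Rightarrow> real) \<Rightarrow> real \<Rightarrow> real" where
  "energy \<Omega> g \<tau> \<xi> \<sigma> f0 u ut t =
     1/2 * ((L2_norm \<Omega> (ut t))\<^sup>2
            + (1 - (LINT s|lebesgue_on {0..t}. g s)) * (L2_norm \<Omega> (grad \<Omega> (u t)))\<^sup>2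
            + memory_term \<Omega> g (\<lambda>s. grad \<Omega> (u s)) t)
     + \<xi>/2 * (LINT s|lebesgue_on {t-\<tau>..t}. LINT x|lebesgue_on \<Omega>.
                exp (\<sigma> * (s - t)) * (with_history f0 ut s x)\<^sup>2)"

end

theory Submission
  imports Defs
begin

text \<open>
  Along a weak solution the scalar kernels \<open>p(t,r) = (u\<^sub>t(t), u\<^sub>t(r))\<close>, \<open>a(t,r) = (\<nabla>u(t), \<nabla>u(r))\<close>
  and \<open>q(t,r) = (u\<^sub>t(t), u(r))\<close> are continuous, and for \<open>t > \<tau>\<close> (where the delayed velocity is
  continuous too) \<open>q\<close> satisfies \<open>\<partial>\<^sub>r q = p\<close> and, by testing the equation with \<open>\<phi>(t) u(r)\<close>,
  \<open>\<partial>\<^sub>t q = - a + \<integral> g(t-s) a(s,r) ds - \<mu> (u\<^sub>t(t-\<tau>), u(r))\<close>. Everything the energy method needs,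
  the energy identity included, is read off these kernels on the diagonal, so neither higher
  regularity of \<open>u\<close> nor Bochner integrals are involved.

  The Lyapunov functional is \<open>E + \<epsilon>1 (u, u\<^sub>t) - \<epsilon>2 (u\<^sub>t, \<integral> g(t-s) (u(t) - u(s)) ds)\<close>. Its derivative
  contains \<open>u\<^sub>t(t)\<close> and \<open>u\<^sub>t(t-\<tau>)\<close> with the coefficients \<open>(\<bar>\<mu>\<bar> + \<xi>)/2 - k1\<close> and
  \<open>(\<bar>\<mu>\<bar> - \<xi> e\<^bsup>-\<sigma>\<tau>\<^esup>)/2 + k2\<close>, which are negative for \<open>\<bar>\<mu>\<bar> < a\<close>; the exponential weight in the history
  term and \<open>g' \<le> - \<zeta> g\<close> supply the rest of the energy. This gives decay from some time
  \<open>T1 > max t0 \<tau>\<close> on; before \<open>T1\<close> the energy is merely bounded, which the constant \<open>K\<close> absorbs.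
\<close>

subsection \<open>Kernels on the diagonal\<close>

text \<open>The energy identity is delicate because each term of the equation is differentiable in
  one of the two time variables only. The memory kernel \<open>m(t,r)\<close> has a derivative in
  \<open>t\<close>, since \<open>g\<close> is C1, while in \<open>r\<close> only continuity of the
  gradient is available; the delay kernel \<open>n(t,r)\<close> has one in \<open>r\<close>, since u
  has the derivative \<open>u_t\<close>, while in \<open>t\<close> it is merely continuous. The
  difference quotients are arranged so that only increments in the good variable occur. Each
  condition on the constants closes one gap. The upper bound for \<open>\<epsilon>1\<close> is
  equivalent to \<open>k2 < k1\<close>, which leaves room for \<open>\<xi>\<close> once
  \<open>\<sigma>\<close> is small. Its lower bound, together with
  \<open>\<delta>2 < l * g0 / (16 * C1)\<close>, yields
  \<open>\<epsilon>2 * \<delta>2 < \<epsilon>1 * l / 2\<close>, so that the gradient is damped. The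
  estimates of the delay terms assume \<open>\<bar>\<mu>\<bar> \<le> 1\<close>; to keep the
  constants independent of \<mu> they are chosen with \<open>2 * k1 \<le> 1\<close>, which forces
  \<open>a < 1\<close>.\<close>

lemma has_real_derivative_diagonal:
  fixes f fy :: "real \<Rightarrow> real \<Rightarrow> real"
  assumes fx: "((\<lambda>x. f x t) has_real_derivative fx) (at t)"
    and fy: "\<And>x y. a < x \<Longrightarrow> a < y \<Longrightarrow> (f x has_real_derivative fy x y) (at y)"
    and cont: "continuous_on ({a<..} \<times> {a<..}) (\<lambda>(x,y). fy x y)"
    and t: "a < t"
  shows "((\<lambda>t. f t t) has_real_derivative fx + fy t t) (at t)"
proof -
  have op: "open ({a<..} \<times> {a<..} :: (real\<times>real) set)"
    by (intro open_Times open_greaterThan)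
  \<comment> \<open>Frechet differentiability at \<open>(t,t)\<close> follows from one partial
    derivative at that single point and continuity of the other one; hence the asymmetric hypotheses
    on \<open>fx\<close> and \<open>fy\<close>.\<close>
  have "((\<lambda>(x, y). f x y) has_derivative (\<lambda>(tx, ty). (*) fx tx + blinfun_mult_right (fy t t) ty))
     (at (t, t) within {a<..} \<times> {a<..})"
  proof (rule has_derivative_partialsI[where fy="\<lambda>x y. blinfun_mult_right (fy x y)"])
    show "((\<lambda>x. f x t) has_derivative (*) fx) (at t within {a<..})"
      using fx by (auto simp: has_field_derivative_def intro: has_derivative_at_withinI)
    show "((\<lambda>y. f x y) has_derivative blinfun_apply (blinfun_mult_right (fy x y))) (at y within {a<..})"
      if "x \<in> {a<..}" "y \<in> {a<..}" for x y
      using fy[of x y] that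
      by (auto simp: has_field_derivative_def mult_commute_abs intro!: has_derivative_at_withinI)
    have "continuous_on ({a<..} \<times> {a<..}) (\<lambda>(x,y). blinfun_mult_right (fy x y))"
      using cont by (auto intro!: continuous_intros simp: split_beta)
    then show "continuous (at (t, t) within {a<..} \<times> {a<..}) (\<lambda>(x, y). blinfun_mult_right (fy x y))"
      using t by (auto simp: continuous_on_eq_continuous_within)
  qed (use t in auto)
  then have D: "((\<lambda>(x, y). f x y) has_derivative (\<lambda>(tx, ty). fx * tx + fy t t * ty)) (at (t, t))"
    using at_within_open[OF _ op, of "(t,t)"] t by auto
  have "((\<lambda>t. (t,t)) has_derivative (\<lambda>h. (h,h))) (at t)"
    by (auto intro!: derivative_eq_intros)
  from has_derivative_compose[OF this, of "\<lambda>(x, y). f x y" "\<lambda>(tx, ty). fx * tx + fy t t * ty"] D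
  have "((\<lambda>x. f x x) has_derivative (\<lambda>x. fx * x + fy t t * x)) (at t)"
    by simp
  moreover have "(\<lambda>x. fx * x + fy t t * x) = (*) (fx + fy t t)"
    by (auto simp: distrib_right)
  ultimately show ?thesis
    by (simp add: has_field_derivative_def)
qed

text \<open>Rescaling the variable by \<open>b x\<close> moves the integral to the fixed interval
  \<open>{0..1}\<close>, where continuity in a parameter is standard; for \<open>b x = 0\<close>
  both sides vanish.\<close>

lemma continuous_on_integral_upper:
  fixes f :: "'a::topological_space \<Rightarrow> real \<Rightarrow> real"
  assumes cf: "continuous_on (A \<times> {0..}) (\<lambda>(x,s). f x s)"
    and cb: "continuous_on A b" and b: "\<And>x. x \<in> A \<Longrightarrow> 0 \<le> b x"
  shows "continuous_on A (\<lambda>x. integral {0..b x} (f x))"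
proof -
  have eq: "integral {0..b x} (f x) = integral (cbox 0 1) (\<lambda>s. b x * f x (b x * s))" if x: "x \<in> A" for x
  proof (cases "b x = 0")
    case False
    then have b0: "b x > 0" using b[OF x] by simp
    have "continuous_on {0..b x} (f x)"
      by (rule continuous_on_compose2[OF cf, of "{0..b x}" "\<lambda>s. (x,s)", simplified])
         (use x in \<open>auto intro!: continuous_intros\<close>)
    then have "(f x has_integral integral {0..b x} (f x)) {0..b x}"
      by (intro integrable_integral integrable_continuous_real)
    from has_integral_stretch_real[OF this, of "b x"] b0
    have "((\<lambda>s. f x (b x * s)) has_integral (1 / b x) * integral {0..b x} (f x)) ((\<lambda>s. s / b x) ` {0..b x})"
      by simp
    also have "(\<lambda>s. s / b x) ` {0..b x} = {0..1}"
      using b0 by (simp add: image_divide_atLeastAtMost)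
    finally have "integral {0..1} (\<lambda>s. f x (b x * s)) = (1 / b x) * integral {0..b x} (f x)"
      by (rule integral_unique)
    then show ?thesis using b0 by simp
  qed simp
  have "continuous_on A (\<lambda>x. integral (cbox 0 1) (\<lambda>s. b x * f x (b x * s)))"
  proof (rule integral_continuous_on_param, unfold cbox_interval)
    have 1: "continuous_on (A \<times> {0..1}) (\<lambda>P. b (fst P))"
      by (rule continuous_on_compose2[OF cb]) (auto intro!: continuous_intros)
    have "continuous_on (A \<times> {0..1}) (\<lambda>P. case (fst P, b (fst P) * snd P) of (x,s) \<Rightarrow> f x s)"
      by (rule continuous_on_compose2[OF cf]) (use b in \<open>auto intro!: continuous_intros 1\<close>)
    then show "continuous_on (A \<times> {0..1}) (\<lambda>(x, s). b x * f x (b x * s))"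
      using 1 by (auto intro!: continuous_intros simp: split_beta)
  qed
  then show ?thesis using eq by (simp cong: continuous_on_cong)
qed

text \<open>The two occurrences of \<open>t\<close> are separated: in
  \<open>integral {0..y} (f x)\<close> the x-derivative is differentiation under the integral, the
  y-derivative is the fundamental theorem, and the diagonal rule adds them.\<close>

lemma has_real_derivative_memory:
  fixes f f' :: "real \<Rightarrow> real \<Rightarrow> real"
  assumes f': "\<And>t s. a < t \<Longrightarrow> 0 \<le> s \<Longrightarrow> ((\<lambda>t. f t s) has_real_derivative f' t s) (at t)"
    and cf: "continuous_on ({a<..} \<times> {0..}) (\<lambda>(t,s). f t s)"
    and cf': "continuous_on ({a<..} \<times> {0..}) (\<lambda>(t,s). f' t s)"
    and t: "a < t" "0 \<le> a"
  shows "((\<lambda>t. integral {0..t} (f t)) has_real_derivative f t t + integral {0..t} (f' t)) (at t)"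
proof -
  have c1: "continuous_on {0..b} (f x)" if "a < x" for x b
    by (rule continuous_on_compose2[OF cf, of "{0..b}" "\<lambda>s. (x,s)", simplified])
       (use that in \<open>auto intro!: continuous_intros\<close>)
  have "((\<lambda>x. integral (cbox 0 t) (f x)) has_real_derivative integral (cbox 0 t) (f' t)) (at t within {a<..})"
  proof (rule leibniz_rule_field_derivative)
    show "((\<lambda>x. f x s) has_real_derivative f' x s) (at x within {a<..})" 
      if "x \<in> {a<..}" "s \<in> cbox 0 t" for x s
      using f'[of x s] that by (auto intro: has_field_derivative_at_within)
    show "f x integrable_on cbox 0 t" if "x \<in> {a<..}" for x
      using c1[of x t] that by (auto intro: integrable_continuous_real)
    show "continuous_on ({a<..} \<times> cbox 0 t) (\<lambda>(x, t). f' x t)"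
      by (rule continuous_on_subset[OF cf']) auto
  qed (use t in auto)
  then have "((\<lambda>x. integral {0..t} (f x)) has_real_derivative integral {0..t} (f' t)) (at t)"
    using t by (simp add: at_within_open[of t "{a<..}"])
  then have "((\<lambda>t. integral {0..t} (f t)) has_real_derivative integral {0..t} (f' t) + f t t) (at t)"
  proof (rule has_real_derivative_diagonal[where f="\<lambda>x y. integral {0..y} (f x)" and fy=f and a=a], goal_cases)
    case (1 x y)
    \<comment> \<open>Integrating up to \<open>y+1\<close> makes \<open>y\<close> an interior point,
      so the derivative within the interval is two-sided.\<close>
    have "((\<lambda>y. integral {0..y} (f x)) has_real_derivative f x y) (at y within {0..y+1})"
      by (rule integral_has_real_derivative) (use 1 t c1 in auto)
    moreover have "at y within {0..y+1} = at y"
      using 1 t by (intro at_within_interior) (auto simp: interior_atLeastAtMost_real)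
    ultimately show ?case by simp
  next
    case 2
    show ?case by (rule continuous_on_subset[OF cf]) (use t in auto)
  qed (use t in auto)
  then show ?thesis by (simp add: add.commute)
qed

lemma difference_quotient_at_right:
  fixes f :: "real \<Rightarrow> real"
  assumes "(f has_real_derivative d) (at t)"
  shows "((\<lambda>h. (f (t+h) - f t) / h) \<longlongrightarrow> d) (at_right 0)"
  using assms filterlim_at_split unfolding DERIV_def by blast

lemma integral_upper_has_real_derivative:
  fixes f :: "real \<Rightarrow> real"
  assumes "continuous_on {a<..} f" "a < c" "c < z"
  shows "((\<lambda>y. integral {c..y} f) has_real_derivative f z) (at z)"
proof -
  have "((\<lambda>y. integral {c..y} f) has_real_derivative f z) (at z within {c..z+1})"
    by (rule integral_has_real_derivative) (use assms in \<open>auto intro: continuous_on_subset\<close>)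
  moreover have "at z within {c..z+1} = at z"
    using assms by (intro at_within_interior) (auto simp: interior_atLeastAtMost_real)
  ultimately show ?thesis by simp
qed

lemma integral_diff_upper:
  fixes f :: "real \<Rightarrow> real"
  assumes "continuous_on {a<..} f" "a < c" "c \<le> x" "x \<le> z"
  shows "integral {x..z} f = integral {c..z} f - integral {c..x} f"
proof -
  have "f integrable_on {c..z}"
    by (intro integrable_continuous_real continuous_on_subset[OF assms(1)]) (use assms in auto)
  from Henstock_Kurzweil_Integration.integral_combine[OF assms(3,4) this] show ?thesis
    by simp
qed

lemma integral_mean_tendsto:
  fixes f :: "real \<Rightarrow> real"
  assumes "continuous_on {a<..} f" "a < t"
  shows "((\<lambda>h. integral {t..t+h} f / h) \<longlongrightarrow> f t) (at_right 0)"
proof -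
  \<comment> \<open>A base point strictly between \<open>a\<close> and \<open>t\<close> stays inside
    the domain of continuity and to the left of \<open>t\<close>.\<close>
  define c where "c = (a + t) / 2"
  have c: "a < c" "c < t" using assms by (auto simp: c_def)
  have "((\<lambda>h. (integral {c..t+h} f - integral {c..t} f) / h) \<longlongrightarrow> f t) (at_right 0)"
    by (rule difference_quotient_at_right[OF integral_upper_has_real_derivative[OF assms(1) c]])
  moreover have "\<forall>\<^sub>F h in at_right 0. (integral {c..t+h} f - integral {c..t} f) / h = integral {t..t+h} f / h"
    using eventually_at_right_less
  proof (rule eventually_mono)
    show "(integral {c..t+h} f - integral {c..t} f) / h = integral {t..t+h} f / h" if "0 < h" for h
      using integral_diff_upper[OF assms(1) c(1), of t "t+h"] c that by simp
  qed
  ultimately show ?thesis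
    by (rule Lim_transform_eventually)
qed

text \<open>The formal computation pairs the equation with \<open>u\<^sub>t\<close>, which is not an admissible test function.
  With \<open>q(t,r) = (u\<^sub>t(t), u(r))\<close> it is replaced by the antisymmetric difference quotient
  \<open>(q(t,t+h) - q(t+h,t))/h\<close>: by the symmetry of \<open>p\<close> and \<open>a\<close> they drop out of its derivative, while
  its limit contains both of them.\<close>

lemma has_real_derivative_energy_kernel:
  fixes p q a m n dm dn :: "real \<Rightarrow> real \<Rightarrow> real"
  assumes q2: "\<And>t r. T < t \<Longrightarrow> T < r \<Longrightarrow> (q t has_real_derivative p t r) (at r)"
    and q1: "\<And>t r. T < t \<Longrightarrow> T < r \<Longrightarrow>
               ((\<lambda>t. q t r) has_real_derivative - a t r + m t r + n t r) (at t)"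
    and dm: "\<And>t r. T < t \<Longrightarrow> T < r \<Longrightarrow> ((\<lambda>t. m t r) has_real_derivative dm t r) (at t)"
    and dn: "\<And>t r. T < t \<Longrightarrow> T < r \<Longrightarrow> (n t has_real_derivative dn t r) (at r)"
    and p_sym: "\<And>t r. p t r = p r t" and a_sym: "\<And>t r. a t r = a r t"
    and cp: "continuous_on ({T<..} \<times> {T<..}) (\<lambda>(t,r). p t r)"
    and ca: "continuous_on ({T<..} \<times> {T<..}) (\<lambda>(t,r). a t r)"
    and cm: "continuous_on ({T<..} \<times> {T<..}) (\<lambda>(t,r). m t r)"
    and cn: "continuous_on ({T<..} \<times> {T<..}) (\<lambda>(t,r). n t r)"
    and cm1: "continuous_on ({T<..} \<times> {T<..}) (\<lambda>(t,r). dm t r)"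
    and cn2: "continuous_on ({T<..} \<times> {T<..}) (\<lambda>(t,r). dn t r)"
    and t: "T < t"
  shows "((\<lambda>t. p t t + a t t - 2 * m t t) has_real_derivative 2 * (dn t t - dm t t)) (at t)"
proof -
  define y where "y = (\<lambda>t. p t t + a t t - 2 * m t t)"
  define R where "R = (\<lambda>t. 2 * (dn t t - dm t t))"
  \<comment> \<open>The antisymmetric quotient alone tends to \<open>p + a - m - n\<close> on the
    diagonal. Subtracting the mean of \<open>m - n\<close> turns this limit into
    \<open>p + a - 2 * m\<close> and completes the numerator of \<open>dS\<close> to increments of
    \<open>m\<close> in its first and of \<open>n\<close> in its second variable.\<close>
  define D where "D = (\<lambda>x. m x x - n x x)"
  define S where "S = (\<lambda>h t. (q t (t+h) - q (t+h) t) / h - integral {t..t+h} D / h)"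
  define dS where "dS = (\<lambda>h t. ((m t (t+h) + n t (t+h)) - (m (t+h) t + n (t+h) t)) / h - (D (t+h) - D t) / h)"
  have diag: "continuous_on {T<..} (\<lambda>t. k t t)" if "continuous_on ({T<..} \<times> {T<..}) (\<lambda>(t,r). k t r)" for k :: "real \<Rightarrow> real \<Rightarrow> real"
    by (rule continuous_on_compose2[OF that, of "{T<..}" "\<lambda>s. (s,s)", simplified])
       (auto intro!: continuous_intros)
  have cR: "continuous_on {T<..} R" unfolding R_def
    by (intro continuous_intros diag cm1 cn2)
  have cD: "continuous_on {T<..} D" unfolding D_def
    by (intro continuous_intros diag cm cn)
  have cF: "continuous_on ({T<..} \<times> {T<..}) (\<lambda>(t,r). - a t r + m t r + n t r)"
    using ca cm cn by (auto intro!: continuous_intros simp: split_beta)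
  have S_deriv: "(S h has_real_derivative dS h x) (at x)" if h: "0 < h" and x: "T < x" for h x
  proof -
    have c2: "continuous_on {T<..} (\<lambda>u. k u (u+h))" "continuous_on {T<..} (\<lambda>u. k (u+h) u)"
      if "continuous_on ({T<..} \<times> {T<..}) (\<lambda>(t,r). k t r)" for k :: "real \<Rightarrow> real \<Rightarrow> real"
      by (rule continuous_on_compose2[OF that, of "{T<..}" "\<lambda>s. (s,s+h)", simplified]
               continuous_on_compose2[OF that, of "{T<..}" "\<lambda>s. (s+h,s)", simplified];
          use h in \<open>auto intro!: continuous_intros\<close>)+
    have "((\<lambda>t. q t (t+h)) has_real_derivative (- a x (x+h) + m x (x+h) + n x (x+h)) + p x (x+h)) (at x)"
    proof (rule has_real_derivative_diagonal[where f="\<lambda>u v. q u (v+h)" and fy="\<lambda>u v. p u (v+h)" and a=T])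
      show "continuous_on ({T<..} \<times> {T<..}) (\<lambda>(u, v). p u (v + h))"
        using continuous_on_compose2[OF cp, of "{T<..} \<times> {T<..}" "\<lambda>(u,v). (u,v+h)"] h
        by (fastforce intro!: continuous_intros simp: split_beta)
      show "((\<lambda>v. q u (v + h)) has_real_derivative p u (v + h)) (at v)" if "T < u" "T < v" for u v
        using q2[of u "v+h"] that h by (simp add: DERIV_shift)
    qed (use q1[of x "x+h"] h x in auto)
    moreover have "((\<lambda>t. q (t+h) t) has_real_derivative (- a (x+h) x + m (x+h) x + n (x+h) x) + p (x+h) x) (at x)"
    proof (rule has_real_derivative_diagonal[where f="\<lambda>u v. q (u+h) v" and fy="\<lambda>u v. p (u+h) v" and a=T])
      show "continuous_on ({T<..} \<times> {T<..}) (\<lambda>(u, v). p (u+h) v)"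
        using continuous_on_compose2[OF cp, of "{T<..} \<times> {T<..}" "\<lambda>(u,v). (u+h,v)"] h
        by (fastforce intro!: continuous_intros simp: split_beta)
      show "((\<lambda>u. q (u + h) x) has_real_derivative - a (x+h) x + m (x+h) x + n (x+h) x) (at x)"
        using q1[of "x+h" x] x h by (simp add: DERIV_shift)
    qed (use q2[of "_+h"] h x in auto)
    moreover have "((\<lambda>t. integral {t..t+h} D) has_real_derivative D (x+h) - D x) (at x)"
    proof -
      define c where "c = (T + x) / 2"
      have c: "T < c" "c < x" using x by (auto simp: c_def)
      have "((\<lambda>t. integral {c..t+h} D - integral {c..t} D) has_real_derivative D (x+h) - D x) (at x)"
        using integral_upper_has_real_derivative[OF cD c(1), of "x+h"] integral_upper_has_real_derivative[OF cD c] c h by (auto intro!: derivative_intros simp: DERIV_shift)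
      then show ?thesis
      proof (rule has_field_derivative_transform_within_open[of _ _ _ "{c<..}"])
        show "integral {c..t+h} D - integral {c..t} D = integral {t..t+h} D" if "t \<in> {c<..}" for t
          using integral_diff_upper[OF cD c(1), of t "t+h"] that h by simp
      qed (use c in auto)
    qed
    ultimately show ?thesis unfolding S_def dS_def using h
      by (auto intro!: derivative_eq_intros simp: p_sym[of "x+h" x] a_sym[of "x+h" x] diff_divide_distrib add_divide_distrib)
  qed
  have S_lim: "((\<lambda>h. S h x) \<longlongrightarrow> y x) (at_right 0)" if "T < x" for x
  proof -
    have 1: "((\<lambda>h. (q x (x+h) - q x x) / h) \<longlongrightarrow> p x x) (at_right 0)"
      using q2 that by (intro difference_quotient_at_right) auto
    have 2: "((\<lambda>h. (q (x+h) x - q x x) / h) \<longlongrightarrow> - a x x + m x x + n x x) (at_right 0)"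
      using q1 that by (intro difference_quotient_at_right[of "\<lambda>t. q t x"]) auto
    have "((\<lambda>h. (q x (x+h) - q x x) / h - (q (x+h) x - q x x) / h - integral {x..x+h} D / h) \<longlongrightarrow>
       p x x - (- a x x + m x x + n x x) - D x) (at_right 0)"
      by (intro tendsto_intros 1 2 integral_mean_tendsto[OF cD that])
    then show ?thesis
      by (rule tendsto_eq_rhs[OF Lim_transform_eventually])
        (auto simp: S_def y_def D_def diff_divide_distrib)
  qed
  \<comment> \<open>Each \<open>S h\<close> is differentiable, but their limit \<open>y\<close> is
    not yet known to be. The identity is therefore proved in integrated form, using that
    \<open>dS h\<close> is uniformly close to \<open>R\<close> on \<open>{x..z}\<close>, and
    differentiated at the end.\<close>
  have main: "y z - y x = integral {x..z} R" if xz: "T < x" "x < z" for x z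
  proof -
    have bound: "\<bar>y z - y x - integral {x..z} R\<bar> \<le> e * (z - x)" if e: "0 < e" for e
    proof -
      \<comment> \<open>The square extends to \<open>z+1\<close> because the kernels are evaluated
        at \<open>w+h\<close> with \<open>h < 1\<close>. The tolerance \<open>e/4\<close> is shared
        by four mean value terms.\<close>
      let ?K = "{x..z+1} \<times> {x..z+1}"
      have uc: "\<exists>d>0. \<forall>u v u' v'. (u,v) \<in> ?K \<longrightarrow> (u',v') \<in> ?K \<longrightarrow> \<bar>u - u'\<bar> < d \<longrightarrow> \<bar>v - v'\<bar> < d \<longrightarrow> \<bar>k u v - k u' v'\<bar> < e/4"
        if "continuous_on ({T<..} \<times> {T<..}) (\<lambda>(t,r). k t r)" for k :: "real \<Rightarrow> real \<Rightarrow> real"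
      proof -
        have "continuous_on ?K (\<lambda>(t,r). k t r)"
          by (rule continuous_on_subset[OF that]) (use xz in auto)
        then have "uniformly_continuous_on ?K (\<lambda>(t,r). k t r)"
          by (rule compact_uniformly_continuous) (auto intro: compact_Times)
        then obtain d where d: "d > 0" "\<And>P P'. P \<in> ?K \<Longrightarrow> P' \<in> ?K \<Longrightarrow> dist P' P < d \<Longrightarrow> dist (case P' of (t,r) \<Rightarrow> k t r) (case P of (t,r) \<Rightarrow> k t r) < e/4"
          unfolding uniformly_continuous_on_def using e by (metis zero_less_divide_iff zero_less_numeral)
        show ?thesis
        proof (intro exI[of _ "d/2"] conjI allI impI)
          fix u v u' v' assume *: "(u,v) \<in> ?K" "(u',v') \<in> ?K" "\<bar>u - u'\<bar> < d/2" "\<bar>v - v'\<bar> < d/2"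
          have "dist (u,v) (u',v') \<le> dist u u' + dist v v'"
            by (simp add: dist_Pair_Pair sqrt_sum_squares_le_sum)
          also have "\<dots> < d" using * by (simp add: dist_real_def)
          finally show "\<bar>k u v - k u' v'\<bar> < e/4"
            using d(2)[of "(u',v')" "(u,v)"] * by (simp add: dist_real_def)
        qed (use d in auto)
      qed
      obtain d1 where d1: "d1 > 0" "\<And>u v u' v'. (u,v) \<in> ?K \<Longrightarrow> (u',v') \<in> ?K \<Longrightarrow> \<bar>u - u'\<bar> < d1 \<Longrightarrow> \<bar>v - v'\<bar> < d1 \<Longrightarrow> \<bar>dm u v - dm u' v'\<bar> < e/4"
        using uc[OF cm1] by metis
      obtain d2 where d2: "d2 > 0" "\<And>u v u' v'. (u,v) \<in> ?K \<Longrightarrow> (u',v') \<in> ?K \<Longrightarrow> \<bar>u - u'\<bar> < d2 \<Longrightarrow> \<bar>v - v'\<bar> < d2 \<Longrightarrow> \<bar>dn u v - dn u' v'\<bar> < e/4"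
        using uc[OF cn2] by metis
      have est: "\<bar>dS h w - R w\<bar> \<le> e" if h: "0 < h" "h < 1" "h < d1" "h < d2" and w: "x \<le> w" "w \<le> z" for h w
      proof -
        have mvm: "\<exists>c. w < c \<and> c < w + h \<and> m (w+h) r - m w r = h * dm c r" if "T < r" for r
          using MVT2[of w "w+h" "\<lambda>t. m t r" "\<lambda>t. dm t r"] dm that w h xz by auto
        have mvn: "\<exists>c. w < c \<and> c < w + h \<and> n r (w+h) - n r w = h * dn r c" if "T < r" for r
          using MVT2[of w "w+h" "\<lambda>t. n r t" "\<lambda>t. dn r t"] dn that w h xz by auto
        obtain c1 where c1: "w < c1" "c1 < w + h" "m (w+h) (w+h) - m w (w+h) = h * dm c1 (w+h)"
          using mvm[of "w+h"] w h xz by auto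
        obtain c2 where c2: "w < c2" "c2 < w + h" "m (w+h) w - m w w = h * dm c2 w"
          using mvm[of "w"] w h xz by auto
        obtain c3 where c3: "w < c3" "c3 < w + h" "n (w+h) (w+h) - n (w+h) w = h * dn (w+h) c3"
          using mvn[of "w+h"] w h xz by auto
        obtain c4 where c4: "w < c4" "c4 < w + h" "n w (w+h) - n w w = h * dn w c4"
          using mvn[of "w"] w h xz by auto
        have "((m w (w+h) + n w (w+h)) - (m (w+h) w + n (w+h) w)) - (D (w+h) - D w)
          = h * (dn (w+h) c3 + dn w c4 - dm c1 (w+h) - dm c2 w)"
          using c1(3) c2(3) c3(3) c4(3) by (simp add: D_def algebra_simps)
        then have "dS h w = dn (w+h) c3 + dn w c4 - dm c1 (w+h) - dm c2 w"
          using h by (simp add: dS_def flip: diff_divide_distrib)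
        then have "dS h w - R w = (dn (w+h) c3 - dn w w) + (dn w c4 - dn w w) - (dm c1 (w+h) - dm w w) - (dm c2 w - dm w w)"
          by (simp add: R_def)
        moreover have "\<bar>dm c1 (w+h) - dm w w\<bar> < e/4" "\<bar>dm c2 w - dm w w\<bar> < e/4"
          by (rule d1(2); use c1 c2 w h in auto)+
        moreover have "\<bar>dn (w+h) c3 - dn w w\<bar> < e/4" "\<bar>dn w c4 - dn w w\<bar> < e/4"
          by (rule d2(2); use c3 c4 w h in auto)+
        ultimately show ?thesis by linarith
      qed
      have IR: "((\<lambda>v. integral {x..v} R) has_real_derivative R w) (at w within {x..z})" if "w \<in> {x..z}" for w
        by (rule integral_has_real_derivative) (use that xz in \<open>auto intro: continuous_on_subset[OF cR]\<close>)
      have bd: "\<bar>S h z - S h x - integral {x..z} R\<bar> \<le> e * (z - x)"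
        if h: "0 < h" "h < 1" "h < d1" "h < d2" for h
      proof -
        \<comment> \<open>Mean value inequality for \<open>S h\<close> minus the primitive of
          \<open>R\<close>, whose derivative is at most \<open>e\<close> in size.\<close>
        have "norm ((S h z - integral {x..z} R) - (S h x - integral {x..x} R)) \<le> e * norm (z - x)"
        proof (rule field_differentiable_bound[of "{x..z}" _ "\<lambda>w. dS h w - R w"])
          show "((\<lambda>w. S h w - integral {x..w} R) has_field_derivative dS h w - R w) (at w within {x..z})"
            if "w \<in> {x..z}" for w
            using that xz h by (intro derivative_intros IR has_field_derivative_at_within[OF S_deriv]) auto
        qed (use est[OF h] xz in auto)
        then show ?thesis using xz by simp
      qed
      have "((\<lambda>h. \<bar>S h z - S h x - integral {x..z} R\<bar>) \<longlongrightarrow> \<bar>y z - y x - integral {x..z} R\<bar>) (at_right 0)"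
        using xz by (intro tendsto_intros S_lim) auto
      moreover have "\<forall>\<^sub>F h in at_right 0. \<bar>S h z - S h x - integral {x..z} R\<bar> \<le> e * (z - x)"
        using d1(1) d2(1) bd by (auto simp: eventually_at_right_field intro!: exI[of _ "min 1 (min d1 d2)"])
      ultimately show ?thesis
        by (rule tendsto_upperbound) simp
    qed
    show ?thesis
    proof (rule ccontr)
      assume "y z - y x \<noteq> integral {x..z} R"
      then have pos: "0 < \<bar>y z - y x - integral {x..z} R\<bar>" by simp
      \<comment> \<open>The tolerance is half the alleged gap, divided by the length of the
        interval.\<close>
      then have "\<bar>y z - y x - integral {x..z} R\<bar> \<le> \<bar>y z - y x - integral {x..z} R\<bar> / (2 * (z - x)) * (z - x)"
        using xz by (intro bound) auto
      also have "\<dots> = \<bar>y z - y x - integral {x..z} R\<bar> / 2"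
        using xz by (simp add: divide_simps)
      finally show False using pos by simp
    qed
  qed
  define c where "c = (T + t) / 2"
  have c: "T < c" "c < t" using t by (auto simp: c_def)
  have "((\<lambda>v. y c + integral {c..v} R) has_real_derivative R t) (at t)"
    using integral_upper_has_real_derivative[OF cR c] by (auto intro!: derivative_eq_intros)
  then have "(y has_real_derivative R t) (at t)"
  proof (rule has_field_derivative_transform_within_open[of _ _ _ "{c<..}"])
    show "y c + integral {c..v} R = y v" if "v \<in> {c<..}" for v
      using main[of c v] that c by simp
  qed (use c in auto)
  then show ?thesis by (simp add: y_def R_def)
qed

subsection \<open>Energy decay for an abstract evolution in inner product spaces\<close>

lemma integral_reverse:
  fixes k :: "real \<Rightarrow> real"
  shows "integral {0..t} (\<lambda>s. k (t - s)) = integral {0..t} k"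
proof -
  have "integral {0..t} (\<lambda>s. k (t - s)) = integral {-t..0} (\<lambda>s. k (t + s))"
    using Henstock_Kurzweil_Integration.integral_reflect_real[where a="-t" and b=0 and f="\<lambda>s. k (t + s)"] by simp
  also have "\<dots> = integral {0..t} k"
    using integral_shift_real_ivl[where a=0 and b=t and c=t and f=k] by (simp add: add.commute)
  finally show ?thesis .
qed

text \<open>The weight \<delta> decides which of the two squares receives the small coefficient; the
  absorption arguments below are instances.\<close>

lemma young_inner:
  fixes x y :: "'a::real_inner"
  assumes "0 < \<delta>"
  shows "\<bar>x \<bullet> y\<bar> \<le> \<delta> * (norm x)\<^sup>2 + (norm y)\<^sup>2 / (4 * \<delta>)"
proof -
  have "0 \<le> (2 * \<delta> * norm x - norm y)\<^sup>2" by simp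
  then have "4 * \<delta> * (norm x * norm y) \<le> 4 * \<delta> * (\<delta> * (norm x)\<^sup>2 + (norm y)\<^sup>2 / (4 * \<delta>))"
    using assms by (simp add: power2_eq_square algebra_simps)
  then have "norm x * norm y \<le> \<delta> * (norm x)\<^sup>2 + (norm y)\<^sup>2 / (4 * \<delta>)"
    using assms by simp
  then show ?thesis using Cauchy_Schwarz_ineq2[of x y] by linarith
qed

text \<open>\<open>U\<close>, \<open>V\<close> and \<open>W\<close> stand for u, \<open>u_t\<close>
  and the gradient of u. Derivatives are assumed only for scalar products with values of the curves
  themselves, and the tested equation is the only link between \<open>W\<close> and
  \<open>U\<close>, so no unbounded operator from \<open>'a\<close> to \<open>'b\<close> has to be
  mentioned. The kernel lives on the whole line, which makes its derivative two-sided at 0.\<close>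

locale viscoelastic_evolution =
  fixes U V :: "real \<Rightarrow> 'a::real_inner" and W :: "real \<Rightarrow> 'b::real_inner"
    and g g' :: "real \<Rightarrow> real" and \<mu> \<tau> :: real
  assumes tau_pos: "0 < \<tau>"
    and contU: "continuous_on {0..} U"
    and contV: "continuous_on {0..} V"
    and contW: "continuous_on {0..} W"
    and g_deriv: "\<And>t. (g has_real_derivative g' t) (at t)"
    and g'_cont: "continuous_on UNIV g'"
    and U_deriv: "\<And>s t. 0 \<le> s \<Longrightarrow> 0 < t \<Longrightarrow>
      ((\<lambda>t. V s \<bullet> U t) has_real_derivative V s \<bullet> V t) (at t)"
    and V_deriv: "\<And>t r. \<tau> < t \<Longrightarrow> 0 \<le> r \<Longrightarrow>
      ((\<lambda>t. V t \<bullet> U r) has_real_derivative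
        - (W t \<bullet> W r) + integral {0..t} (\<lambda>s. g (t - s) * (W s \<bullet> W r)) - \<mu> * (V (t - \<tau>) \<bullet> U r)) (at t)"
begin

lemma continuous_on_U [continuous_intros]:
  "continuous_on X b \<Longrightarrow> (\<And>x. x \<in> X \<Longrightarrow> 0 \<le> b x) \<Longrightarrow> continuous_on X (\<lambda>x. U (b x))"
  by (rule continuous_on_compose2[OF contU]) auto

lemma continuous_on_V [continuous_intros]:
  "continuous_on X b \<Longrightarrow> (\<And>x. x \<in> X \<Longrightarrow> 0 \<le> b x) \<Longrightarrow> continuous_on X (\<lambda>x. V (b x))"
  by (rule continuous_on_compose2[OF contV]) auto

lemma continuous_on_W [continuous_intros]:
  "continuous_on X b \<Longrightarrow> (\<And>x. x \<in> X \<Longrightarrow> 0 \<le> b x) \<Longrightarrow> continuous_on X (\<lambda>x. W (b x))"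
  by (rule continuous_on_compose2[OF contW]) auto

lemma continuous_on_g [continuous_intros]:
  "continuous_on X b \<Longrightarrow> continuous_on X (\<lambda>x. g (b x))"
  by (rule continuous_on_compose2[of UNIV g])
    (auto intro!: continuous_at_imp_continuous_on DERIV_isCont[OF g_deriv])

lemma continuous_on_g' [continuous_intros]:
  "continuous_on X b \<Longrightarrow> continuous_on X (\<lambda>x. g' (b x))"
  by (rule continuous_on_compose2[OF g'_cont]) auto

definition mass :: "real \<Rightarrow> real" where
  "mass t = integral {0..t} g"

definition mem :: "(real \<Rightarrow> real) \<Rightarrow> real \<Rightarrow> real" where
  "mem k t = integral {0..t} (\<lambda>s. k (t - s) * (norm (W t - W s))\<^sup>2)"

definition hist :: "real \<Rightarrow> real \<Rightarrow> real" where
  "hist \<sigma> t = integral {t-\<tau>..t} (\<lambda>s. exp (\<sigma> * (s - t)) * (norm (V s))\<^sup>2)"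

definition En :: "real \<Rightarrow> real \<Rightarrow> real \<Rightarrow> real" where
  "En \<xi> \<sigma> t = 1/2 * ((norm (V t))\<^sup>2 + (1 - mass t) * (norm (W t))\<^sup>2 + mem g t) + \<xi>/2 * hist \<sigma> t"

text \<open>The value that the equation prescribes for \<open>(u_tt(t), u(r))\<close>, defined
  without differentiating \<open>V\<close>.\<close>

definition acc :: "real \<Rightarrow> real \<Rightarrow> real" where
  "acc t r = - (W t \<bullet> W r) + integral {0..t} (\<lambda>s. g (t - s) * (W s \<bullet> W r)) - \<mu> * (V (t - \<tau>) \<bullet> U r)"

text \<open>The scalar product stands under the integral, which keeps the integrand
  real-valued.\<close>

definition chi :: "real \<Rightarrow> real" where
  "chi t = - integral {0..t} (\<lambda>s. g (t - s) * (V t \<bullet> (U t - U s)))"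

lemma integrable_kernel:
  fixes f :: "real \<Rightarrow> real"
  shows "continuous_on {0..t} f \<Longrightarrow> f integrable_on {0..t}"
  by (rule integrable_continuous_real)

lemma integral_g_reverse: "integral {0..t} (\<lambda>s. g (t - s)) = mass t"
  unfolding mass_def by (rule integral_reverse)

lemma integral_g'_reverse: "0 \<le> t \<Longrightarrow> integral {0..t} (\<lambda>s. g' (t - s)) = g t - g 0"
  unfolding integral_reverse
  by (intro integral_unique fundamental_theorem_of_calculus)
    (use g_deriv in \<open>auto simp flip: has_real_derivative_iff_has_vector_derivative intro: has_field_derivative_at_within\<close>)

section \<open>Derivatives of the energy and of its two perturbations\<close>

lemma mass_deriv: "0 < t \<Longrightarrow> (mass has_real_derivative g t) (at t)"
  using integral_upper_has_real_derivative[of "-1" g 0 t] 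
    continuous_on_g[OF continuous_on_id]
  unfolding mass_def by auto

text \<open>Multiplying out the square trades \<open>mem\<close> for kernels that can be
  differentiated. It is used with \<open>k = g\<close> to rewrite the energy and with
  \<open>k = g'\<close> to recognise its derivative.\<close>

lemma mem_expand:
  assumes t: "0 \<le> t" and k: "continuous_on UNIV k"
  shows "mem k t = integral {0..t} k * (W t \<bullet> W t) - 2 * integral {0..t} (\<lambda>s. k (t - s) * (W s \<bullet> W t))
     + integral {0..t} (\<lambda>s. k (t - s) * (W s \<bullet> W s))"
proof -
  have [continuous_intros]: "continuous_on X b \<Longrightarrow> continuous_on X (\<lambda>x. k (b x))" for X and b :: "real \<Rightarrow> real"
    by (rule continuous_on_compose2[OF k]) auto
  have "mem k t = integral {0..t} (\<lambda>s. (W t \<bullet> W t) * k (t - s) - 2 * (k (t - s) * (W s \<bullet> W t)) + k (t - s) * (W s \<bullet> W s))"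
    unfolding mem_def
    by (intro integral_cong) (simp add: power2_norm_eq_inner inner_diff algebra_simps inner_commute)
  also have "\<dots> = (W t \<bullet> W t) * integral {0..t} (\<lambda>s. k (t - s)) - 2 * integral {0..t} (\<lambda>s. k (t - s) * (W s \<bullet> W t))
     + integral {0..t} (\<lambda>s. k (t - s) * (W s \<bullet> W s))"
    by (subst integral_add integral_diff integral_mult_right; 
        (intro integrable_kernel continuous_intros)?; (use t in auto)?)+
  finally show ?thesis by (simp add: integral_reverse mult.commute)
qed

text \<open>By \<open>mem_expand\<close> the function is
  \<open>V t \<bullet> V t + W t \<bullet> W t - 2 * m t t\<close> plus the memory integral of
  \<open>W s \<bullet> W s\<close>. The first part falls under the kernel lemma, the second under
  differentiation of a memory integral, and the terms with \<open>g 0\<close> are absorbed into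
  \<open>mem g'\<close>.\<close>

lemma elastic_energy_deriv:
  assumes t: "\<tau> < t"
  shows "((\<lambda>t. (norm (V t))\<^sup>2 + (1 - mass t) * (norm (W t))\<^sup>2 + mem g t) has_real_derivative
     mem g' t - g t * (norm (W t))\<^sup>2 - 2 * \<mu> * (V (t - \<tau>) \<bullet> V t)) (at t)"
proof -
  define m where "m = (\<lambda>t r. integral {0..t} (\<lambda>s. g (t - s) * (W s \<bullet> W r)))"
  define m1 where "m1 = (\<lambda>t r. g 0 * (W t \<bullet> W r) + integral {0..t} (\<lambda>s. g' (t - s) * (W s \<bullet> W r)))"
  have m1: "((\<lambda>t. m t r) has_real_derivative m1 t r) (at t)" if "\<tau> < t" "\<tau> < r" for t r
  proof -
    \<comment> \<open>With \<open>r\<close> frozen the derivative falls on the kernel and on the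
      upper limit, so continuity of \<open>W\<close> suffices.\<close>
    have "((\<lambda>t. integral {0..t} (\<lambda>s. g (t - s) * (W s \<bullet> W r))) has_real_derivative
       g (t - t) * (W t \<bullet> W r) + integral {0..t} (\<lambda>s. g' (t - s) * (W s \<bullet> W r))) (at t)"
      by (rule has_real_derivative_memory[where a="\<tau>"])
        (use that tau_pos in \<open>auto simp: split_beta intro!: derivative_eq_intros DERIV_chain2[OF g_deriv] continuous_intros\<close>)
    then show ?thesis by (simp add: m_def m1_def)
  qed
  have "((\<lambda>t. V t \<bullet> V t + W t \<bullet> W t - 2 * m t t) has_real_derivative
     2 * (- \<mu> * (V (t - \<tau>) \<bullet> V t) - m1 t t)) (at t)"
  proof (rule has_real_derivative_energy_kernel[where T=\<tau> and q="\<lambda>t r. V t \<bullet> U r"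
      and p="\<lambda>t r. V t \<bullet> V r" and a="\<lambda>t r. W t \<bullet> W r" and m=m and dm=m1 
      and n="\<lambda>t r. - \<mu> * (V (t - \<tau>) \<bullet> U r)" and dn="\<lambda>t r. - \<mu> * (V (t - \<tau>) \<bullet> V r)"])
    show "((\<lambda>t. V t \<bullet> U r) has_real_derivative - (W t \<bullet> W r) + m t r + - \<mu> * (V (t - \<tau>) \<bullet> U r)) (at t)"
      if "\<tau> < t" "\<tau> < r" for t r
      using V_deriv[of t r] that tau_pos by (simp add: m_def)
    show "((\<lambda>r. - \<mu> * (V (t - \<tau>) \<bullet> U r)) has_real_derivative - \<mu> * (V (t - \<tau>) \<bullet> V r)) (at r)"
      if "\<tau> < t" "\<tau> < r" for t r
      by (rule DERIV_cmult, rule U_deriv) (use that tau_pos in auto)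
    show "continuous_on ({\<tau><..} \<times> {\<tau><..}) (\<lambda>(t, r). m t r)"
      unfolding m_def split_beta
      by (rule continuous_on_integral_upper) (use tau_pos in \<open>auto simp: split_beta intro!: continuous_intros\<close>)
    have "continuous_on ({\<tau><..} \<times> {\<tau><..}) (\<lambda>x. integral {0..fst x} (\<lambda>s. g' (fst x - s) * (W s \<bullet> W (snd x))))"
      by (rule continuous_on_integral_upper) (use tau_pos in \<open>auto simp: split_beta intro!: continuous_intros\<close>)
    then show "continuous_on ({\<tau><..} \<times> {\<tau><..}) (\<lambda>(t, r). m1 t r)"
      unfolding m1_def split_beta
      by (intro continuous_intros) (use tau_pos in \<open>auto intro!: continuous_intros\<close>)
  qed (use t tau_pos m1 U_deriv in \<open>auto simp: inner_commute split_beta intro!: continuous_intros\<close>)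
  moreover have "((\<lambda>t. integral {0..t} (\<lambda>s. g (t - s) * (W s \<bullet> W s))) has_real_derivative
       g (t - t) * (W t \<bullet> W t) + integral {0..t} (\<lambda>s. g' (t - s) * (W s \<bullet> W s))) (at t)"
    by (rule has_real_derivative_memory[where a="\<tau>"])
      (use t tau_pos in \<open>auto simp: split_beta intro!: derivative_eq_intros DERIV_chain2[OF g_deriv] continuous_intros\<close>)
  ultimately have D: "((\<lambda>t. V t \<bullet> V t + W t \<bullet> W t - 2 * m t t + integral {0..t} (\<lambda>s. g (t - s) * (W s \<bullet> W s))) has_real_derivative
     2 * (- \<mu> * (V (t - \<tau>) \<bullet> V t) - m1 t t) + (g (t - t) * (W t \<bullet> W t) + integral {0..t} (\<lambda>s. g' (t - s) * (W s \<bullet> W s)))) (at t)"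
    by (rule DERIV_add)
  have "mem g' t = (g t - g 0) * (W t \<bullet> W t) - 2 * integral {0..t} (\<lambda>s. g' (t - s) * (W s \<bullet> W t))
     + integral {0..t} (\<lambda>s. g' (t - s) * (W s \<bullet> W s))"
    using mem_expand[of t g'] t tau_pos integral_g'_reverse[of t] g'_cont by (simp add: integral_reverse)
  then have eq: "2 * (- \<mu> * (V (t - \<tau>) \<bullet> V t) - m1 t t) + (g (t - t) * (W t \<bullet> W t) + integral {0..t} (\<lambda>s. g' (t - s) * (W s \<bullet> W s)))
    = mem g' t - g t * (norm (W t))\<^sup>2 - 2 * \<mu> * (V (t - \<tau>) \<bullet> V t)"
    by (simp add: m1_def power2_norm_eq_inner algebra_simps)
  show ?thesis
    using D unfolding eq
  proof (rule has_field_derivative_transform_within_open[of _ _ _ "{\<tau><..}"])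
    show "V s \<bullet> V s + W s \<bullet> W s - 2 * m s s + integral {0..s} (\<lambda>r. g (s - r) * (W r \<bullet> W r))
      = (norm (V s))\<^sup>2 + (1 - mass s) * (norm (W s))\<^sup>2 + mem g s" if "s \<in> {\<tau><..}" for s
      using mem_expand[of s g] that tau_pos continuous_on_g[OF continuous_on_id, of UNIV]
      by (simp add: m_def mass_def power2_norm_eq_inner algebra_simps)
  qed (use t in auto)
qed

text \<open>Pulling the factor \<open>exp (- (\<sigma> * t))\<close> out leaves a window integral of
  a fixed function, that is, a difference of two primitives. For \<open>\<tau> < t\<close> the
  window lies in positive times, where \<open>V\<close> is continuous.\<close>

lemma hist_deriv:
  assumes t: "\<tau> < t"
  shows "(hist \<sigma> has_real_derivative
     - \<sigma> * hist \<sigma> t + (norm (V t))\<^sup>2 - exp (- \<sigma> * \<tau>) * (norm (V (t - \<tau>)))\<^sup>2) (at t)"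
proof -
  define f where "f = (\<lambda>s. exp (\<sigma> * s) * (norm (V s))\<^sup>2)"
  have cf: "continuous_on {0<..} f" "continuous_on {0..} f" unfolding f_def by (auto intro!: continuous_intros)
  \<comment> \<open>A positive base point that lies below both ends of the window for all times near
    \<open>t\<close>.\<close>
  define c where "c = (t - \<tau>) / 2"
  have c: "0 < c" "c < t - \<tau>" using t by (auto simp: c_def)
  have heq: "hist \<sigma> s = exp (- (\<sigma> * s)) * (integral {c..s} f - integral {c..s-\<tau>} f)" if "c + \<tau> < s" for s
  proof -
    have "integral {s-\<tau>..s} f = integral {c..s} f - integral {c..s-\<tau>} f"
      by (rule integral_diff_upper[OF cf(1) c(1)]) (use that tau_pos in auto)
    moreover have "hist \<sigma> s = integral {s-\<tau>..s} (\<lambda>r. exp (- (\<sigma> * s)) * f r)"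
      unfolding hist_def f_def
      by (intro integral_cong) (simp add: algebra_simps exp_diff exp_minus field_simps)
    ultimately show ?thesis by simp
  qed
  have "((\<lambda>s. exp (- (\<sigma> * s)) * (integral {c..s} f - integral {c..s-\<tau>} f)) has_real_derivative
     - \<sigma> * hist \<sigma> t + (norm (V t))\<^sup>2 - exp (- \<sigma> * \<tau>) * (norm (V (t - \<tau>)))\<^sup>2) (at t)"
  proof -
    have 1: "((\<lambda>s. integral {c..s} f) has_real_derivative f t) (at t)"
      using integral_upper_has_real_derivative[OF cf(1) c(1), of t] c tau_pos by simp
    have 2: "((\<lambda>s. integral {c..s-\<tau>} f) has_real_derivative f (t-\<tau>)) (at t)"
      using integral_upper_has_real_derivative[OF cf(1) c(1), of "t-\<tau>"] c tau_pos
        DERIV_shift[of "\<lambda>s. integral {c..s} f" "f (t-\<tau>)" t "-\<tau>"] by simp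
    have e: "exp (- (\<sigma> * t)) * exp (\<sigma> * (t - \<tau>)) = exp (- \<sigma> * \<tau>)"
      by (simp add: algebra_simps flip: exp_add)
    have "exp (- (\<sigma> * t)) * (f t - f (t - \<tau>)) = (norm (V t))\<^sup>2 - exp (- \<sigma> * \<tau>) * (norm (V (t - \<tau>)))\<^sup>2"
      unfolding f_def right_diff_distrib mult.assoc[symmetric] e by (simp flip: exp_add)
    moreover have "\<sigma> * hist \<sigma> t = \<sigma> * (exp (- (\<sigma> * t)) * (integral {c..t} f - integral {c..t-\<tau>} f))"
      using heq[of t] c by simp
    ultimately show ?thesis
      by (auto intro!: derivative_eq_intros 1 2 simp: algebra_simps)
  qed
  then show ?thesis
    by (rule has_field_derivative_transform_within_open[of _ _ _ "{c+\<tau><..}"]) (use c heq in auto)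
qed

lemma En_deriv:
  assumes t: "\<tau> < t"
  shows "(En \<xi> \<sigma> has_real_derivative
     1/2 * (mem g' t - g t * (norm (W t))\<^sup>2 - 2 * \<mu> * (V (t - \<tau>) \<bullet> V t))
     + \<xi>/2 * (- \<sigma> * hist \<sigma> t + (norm (V t))\<^sup>2 - exp (- \<sigma> * \<tau>) * (norm (V (t - \<tau>)))\<^sup>2)) (at t)"
  unfolding En_def by (intro DERIV_add DERIV_cmult elastic_energy_deriv hist_deriv t)

lemma inner_VU_deriv:
  assumes t: "\<tau> < t"
  shows "((\<lambda>t. V t \<bullet> U t) has_real_derivative acc t t + (norm (V t))\<^sup>2) (at t)"
proof -
  have "((\<lambda>t. V t \<bullet> U t) has_real_derivative acc t t + V t \<bullet> V t) (at t)"
    by (rule has_real_derivative_diagonal[where a=\<tau>])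
      (use t tau_pos V_deriv U_deriv in \<open>auto simp: acc_def split_beta intro!: continuous_intros\<close>)
  then show ?thesis by (simp add: power2_norm_eq_inner)
qed

lemma chi_expand:
  assumes "0 \<le> t"
  shows "chi t = integral {0..t} (\<lambda>s. g (t - s) * (V t \<bullet> U s)) - mass t * (V t \<bullet> U t)"
proof -
  have "integral {0..t} (\<lambda>s. g (t - s) * (V t \<bullet> (U t - U s)))
    = integral {0..t} (\<lambda>s. (V t \<bullet> U t) * g (t - s) - g (t - s) * (V t \<bullet> U s))"
    by (intro integral_cong) (simp add: inner_diff algebra_simps)
  also have "\<dots> = (V t \<bullet> U t) * integral {0..t} (\<lambda>s. g (t - s)) - integral {0..t} (\<lambda>s. g (t - s) * (V t \<bullet> U s))"
    by (subst integral_diff integral_mult_right; 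
        (intro integrable_kernel continuous_intros)?; (use assms in auto)?)+
  finally show ?thesis by (simp add: chi_def integral_g_reverse mult.commute)
qed

lemma continuous_on_acc: "continuous_on ({\<tau><..} \<times> {0..}) (\<lambda>(t, r). acc t r)"
proof -
  have "continuous_on ({\<tau><..} \<times> {0..}) (\<lambda>x. integral {0..fst x} (\<lambda>s. g (fst x - s) * (W s \<bullet> W (snd x))))"
    by (rule continuous_on_integral_upper) (use tau_pos in \<open>auto simp: split_beta intro!: continuous_intros\<close>)
  then show ?thesis
    unfolding acc_def split_beta
    by (intro continuous_intros) (use tau_pos in \<open>auto intro!: continuous_intros\<close>)
qed

text \<open>The expanded form is differentiated and regrouped. As \<open>g'\<close> integrates to
  \<open>g t - g 0\<close>, re-centring its integral at \<open>U t\<close> swallows both boundary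
  terms; the factor \<open>mass t\<close> re-centres the \<open>acc\<close> terms in the same
  way.\<close>

lemma chi_deriv:
  assumes t: "\<tau> < t"
  shows "(chi has_real_derivative - mass t * (norm (V t))\<^sup>2
     - integral {0..t} (\<lambda>s. g' (t - s) * (V t \<bullet> (U t - U s)))
     - integral {0..t} (\<lambda>s. g (t - s) * (acc t t - acc t s))) (at t)"
proof -
  have t0: "0 < t" using t tau_pos by simp
  have ca: "continuous_on {0..t} (acc t)"
    by (rule continuous_on_compose2[OF continuous_on_acc, of "{0..t}" "\<lambda>s. (t,s)", simplified])
       (use t in \<open>auto intro!: continuous_intros\<close>)
  note ca[continuous_intros]
  have "((\<lambda>t. integral {0..t} (\<lambda>s. g (t - s) * (V t \<bullet> U s))) has_real_derivative
       g (t - t) * (V t \<bullet> U t) + integral {0..t} (\<lambda>s. g' (t - s) * (V t \<bullet> U s) + g (t - s) * acc t s)) (at t)"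
  proof (rule has_real_derivative_memory[where a="\<tau>"])
    show "((\<lambda>t. g (t - s) * (V t \<bullet> U s)) has_real_derivative g' (t - s) * (V t \<bullet> U s) + g (t - s) * acc t s) (at t)"
      if "\<tau> < t" "0 \<le> s" for t s
      using V_deriv[OF that] by (auto intro!: derivative_eq_intros DERIV_chain2[OF g_deriv] simp: acc_def)
    show "continuous_on ({\<tau><..} \<times> {0..}) (\<lambda>(t, s). g' (t - s) * (V t \<bullet> U s) + g (t - s) * acc t s)"
      using continuous_on_acc tau_pos by (auto simp: split_beta intro!: continuous_intros)
  qed (use t tau_pos in \<open>auto simp: split_beta intro!: continuous_intros\<close>)
  moreover have "((\<lambda>t. mass t * (V t \<bullet> U t)) has_real_derivative 
      g t * (V t \<bullet> U t) + mass t * (acc t t + (norm (V t))\<^sup>2)) (at t)"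
    using t0 t by (auto intro!: derivative_eq_intros mass_deriv inner_VU_deriv)
  ultimately have D: "((\<lambda>t. integral {0..t} (\<lambda>s. g (t - s) * (V t \<bullet> U s)) - mass t * (V t \<bullet> U t)) has_real_derivative
      (g (t - t) * (V t \<bullet> U t) + integral {0..t} (\<lambda>s. g' (t - s) * (V t \<bullet> U s) + g (t - s) * acc t s))
      - (g t * (V t \<bullet> U t) + mass t * (acc t t + (norm (V t))\<^sup>2))) (at t)"
    by (rule DERIV_diff)
  have 1: "integral {0..t} (\<lambda>s. g' (t - s) * (V t \<bullet> U s) + g (t - s) * acc t s)
    = integral {0..t} (\<lambda>s. g' (t - s) * (V t \<bullet> U s)) + integral {0..t} (\<lambda>s. g (t - s) * acc t s)"
    by (intro integral_add integrable_kernel continuous_intros ca) (use t0 in auto)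
  have "integral {0..t} (\<lambda>s. g' (t - s) * (V t \<bullet> (U t - U s)))
    = integral {0..t} (\<lambda>s. (V t \<bullet> U t) * g' (t - s) - g' (t - s) * (V t \<bullet> U s))"
    by (intro integral_cong) (simp add: inner_diff algebra_simps)
  also have "\<dots> = (V t \<bullet> U t) * integral {0..t} (\<lambda>s. g' (t - s)) - integral {0..t} (\<lambda>s. g' (t - s) * (V t \<bullet> U s))"
    by (subst integral_diff integral_mult_right; 
        (intro integrable_kernel continuous_intros)?; (use t0 in auto)?)+
  finally have 2: "integral {0..t} (\<lambda>s. g' (t - s) * (V t \<bullet> (U t - U s)))
     = (V t \<bullet> U t) * (g t - g 0) - integral {0..t} (\<lambda>s. g' (t - s) * (V t \<bullet> U s))"
    using t0 by (simp add: integral_g'_reverse)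
  have "integral {0..t} (\<lambda>s. g (t - s) * (acc t t - acc t s))
    = integral {0..t} (\<lambda>s. acc t t * g (t - s) - g (t - s) * acc t s)"
    by (intro integral_cong) (simp add: algebra_simps)
  also have "\<dots> = acc t t * integral {0..t} (\<lambda>s. g (t - s)) - integral {0..t} (\<lambda>s. g (t - s) * acc t s)"
    by (subst integral_diff integral_mult_right; 
        (intro integrable_kernel continuous_intros ca)?; (use t0 in auto)?)+
  finally have 3: "integral {0..t} (\<lambda>s. g (t - s) * (acc t t - acc t s))
     = acc t t * mass t - integral {0..t} (\<lambda>s. g (t - s) * acc t s)"
    by (simp add: integral_g_reverse)
  have eq: "(g (t - t) * (V t \<bullet> U t) + integral {0..t} (\<lambda>s. g' (t - s) * (V t \<bullet> U s) + g (t - s) * acc t s))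
      - (g t * (V t \<bullet> U t) + mass t * (acc t t + (norm (V t))\<^sup>2))
    = - mass t * (norm (V t))\<^sup>2
     - integral {0..t} (\<lambda>s. g' (t - s) * (V t \<bullet> (U t - U s)))
     - integral {0..t} (\<lambda>s. g (t - s) * (acc t t - acc t s))"
    unfolding 1 2 3 by (simp add: algebra_simps)
  show ?thesis
    using D unfolding eq
    by (rule has_field_derivative_transform_within_open[of _ _ _ "{\<tau><..}"])
      (use t tau_pos in \<open>auto simp: chi_expand\<close>)
qed

end

section \<open>Absorption estimates with the Poincare and Young inequalities\<close>

context viscoelastic_evolution
begin

lemma integral_kernel_mono:
  fixes f h :: "real \<Rightarrow> real"
  assumes "continuous_on {0..t} f" "continuous_on {0..t} h" "\<And>s. 0 \<le> s \<Longrightarrow> s \<le> t \<Longrightarrow> f s \<le> h s"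
  shows "integral {0..t} f \<le> integral {0..t} h"
  by (rule integral_le) (use assms in \<open>auto intro: integrable_kernel\<close>)

end

text \<open>\<open>poincare_diff\<close> is assumed separately because \<open>W\<close> is not tied
  to \<open>U\<close> by a linear map here. The decay condition includes the time 0, which the
  argument \<open>t - s\<close> reaches at \<open>s = t\<close>.\<close>

locale viscoelastic_decay = viscoelastic_evolution +
  fixes \<zeta> l t0 g0 C :: real
  assumes g_nonneg: "\<And>t. 0 \<le> t \<Longrightarrow> 0 \<le> g t"
    and g_decay: "\<And>t. 0 \<le> t \<Longrightarrow> g' t \<le> - \<zeta> * g t"
    and zeta_pos: "0 < \<zeta>" and g_0: "0 < g 0"
    and l_pos: "0 < l" and mass_le: "\<And>t. 0 \<le> t \<Longrightarrow> mass t \<le> 1 - l"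
    and t0_pos: "0 < t0" and mass_ge: "\<And>t. t0 \<le> t \<Longrightarrow> g0 \<le> mass t" and g0_pos: "0 < g0"
    and C_pos: "0 < C"
    and poincare: "\<And>t. 0 \<le> t \<Longrightarrow> norm (U t) \<le> C * norm (W t)"
    and poincare_diff: "\<And>s t. 0 \<le> s \<Longrightarrow> 0 \<le> t \<Longrightarrow> norm (U t - U s) \<le> C * norm (W t - W s)"
begin

lemma g'_nonpos: "0 \<le> t \<Longrightarrow> g' t \<le> 0"
  using g_decay[of t] g_nonneg[of t] zeta_pos mult_nonneg_nonneg[of \<zeta> "g t"] by linarith

lemma mass_nonneg: "0 \<le> t \<Longrightarrow> 0 \<le> mass t"
  unfolding mass_def by (rule integral_nonneg) (auto intro!: g_nonneg integrable_kernel continuous_intros)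

lemma mem_nonneg: "0 \<le> t \<Longrightarrow> 0 \<le> mem g t"
  unfolding mem_def
  by (rule integral_nonneg) (auto intro!: g_nonneg mult_nonneg_nonneg integrable_kernel continuous_intros)

lemma mem_g'_le: "0 \<le> t \<Longrightarrow> mem g' t \<le> - \<zeta> * mem g t"
  unfolding mem_def
proof (subst integral_mult_right[symmetric], rule integral_kernel_mono)
  show "g' (t - s) * (norm (W t - W s))\<^sup>2 \<le> - \<zeta> * (g (t - s) * (norm (W t - W s))\<^sup>2)"
    if "0 \<le> s" "s \<le> t" for s
    using mult_right_mono[OF g_decay[of "t - s"], of "(norm (W t - W s))\<^sup>2"] that
    by (simp add: mult.assoc)
qed (auto intro!: continuous_intros)

lemma hist_nonneg: "\<tau> < t \<Longrightarrow> 0 \<le> hist \<sigma> t"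
  unfolding hist_def
  by (rule integral_nonneg) (auto intro!: integrable_continuous_real continuous_intros)

lemma norm_U_sq: "0 \<le> t \<Longrightarrow> (norm (U t))\<^sup>2 \<le> C\<^sup>2 * (norm (W t))\<^sup>2"
  using power_mono[OF poincare, of t 2] by (simp add: power_mult_distrib)

lemma norm_U_diff_sq: "0 \<le> s \<Longrightarrow> 0 \<le> t \<Longrightarrow> (norm (U t - U s))\<^sup>2 \<le> C\<^sup>2 * (norm (W t - W s))\<^sup>2"
  using power_mono[OF poincare_diff, of s t 2] by (simp add: power_mult_distrib)

text \<open>The bound \<open>mass t \<le> 1 - l\<close> leaves \<open>l\<close> times the squared
  gradient. Memory and delay may each spend \<open>l/4\<close> of it, which fixes the weights in
  Young's inequality.\<close>

lemma acc_le:
  assumes t: "\<tau> < t" and mu: "\<bar>\<mu>\<bar> \<le> 1"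
  shows "acc t t \<le> - (l / 2) * (norm (W t))\<^sup>2 + mem g t / l + C\<^sup>2 / l * (norm (V (t - \<tau>)))\<^sup>2"
proof -
  have t0: "0 < t" using t tau_pos by simp
  let ?A = "(norm (W t))\<^sup>2"
  have "integral {0..t} (\<lambda>s. g (t - s) * (W s \<bullet> W t))
     \<le> integral {0..t} (\<lambda>s. (1 + l/4) * ?A * g (t - s) + (1 / l) * (g (t - s) * (norm (W t - W s))\<^sup>2))"
  proof (rule integral_kernel_mono)
    fix s assume s: "0 \<le> s" "s \<le> t"
    have "W s \<bullet> W t = ?A - W t \<bullet> (W t - W s)"
      by (simp add: inner_diff power2_norm_eq_inner inner_commute)
    also have "\<dots> \<le> (1 + l/4) * ?A + (1 / l) * (norm (W t - W s))\<^sup>2"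
      using young_inner[of "l/4" "W t" "W t - W s"] l_pos by (simp add: algebra_simps)
    finally have "g (t - s) * (W s \<bullet> W t) \<le> g (t - s) * ((1 + l/4) * ?A + (1 / l) * (norm (W t - W s))\<^sup>2)"
      using g_nonneg[of "t - s"] s by (intro mult_left_mono) auto
    then show "g (t - s) * (W s \<bullet> W t) \<le> (1 + l/4) * ?A * g (t - s) + (1 / l) * (g (t - s) * (norm (W t - W s))\<^sup>2)"
      by (simp add: algebra_simps)
  qed (use l_pos in \<open>auto intro!: continuous_intros\<close>)
  also have "\<dots> = (1 + l/4) * ?A * mass t + (1 / l) * mem g t"
    unfolding mem_def integral_g_reverse[symmetric]
    by (subst integral_add integral_mult_right; 
        (intro integrable_kernel continuous_intros)?; (use t0 in auto)?)+
  also have "(1 + l/4) * ?A * mass t \<le> mass t * ?A + l/4 * ?A"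
    using mass_le[of t] mass_nonneg[of t] t0 l_pos mult_right_mono[of "mass t" 1 "l/4 * ?A"]
    by (simp add: algebra_simps)
  also have "mass t * ?A \<le> (1 - l) * ?A"
    using mass_le[of t] t0 by (intro mult_right_mono) auto
  finally have 1: "integral {0..t} (\<lambda>s. g (t - s) * (W s \<bullet> W t)) \<le> (1 - l) * ?A + l/4 * ?A + (1 / l) * mem g t"
    by simp
  have "- \<mu> * (V (t - \<tau>) \<bullet> U t) \<le> \<bar>\<mu>\<bar> * \<bar>U t \<bullet> V (t - \<tau>)\<bar>"
    by (metis abs_ge_self abs_minus_cancel abs_mult inner_commute minus_mult_left)
  also have "\<dots> \<le> \<bar>U t \<bullet> V (t - \<tau>)\<bar>"
    using mu by (intro mult_left_le_one_le) auto
  \<comment> \<open>The weight is \<open>l/4\<close> divided by \<open>C\<^sup>2\<close>, so that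
    the Poincare inequality returns \<open>l/4\<close>.\<close>
  also have "\<dots> \<le> l / (4 * C\<^sup>2) * (norm (U t))\<^sup>2 + C\<^sup>2 / l * (norm (V (t - \<tau>)))\<^sup>2"
    using young_inner[of "l / (4 * C\<^sup>2)" "U t" "V (t - \<tau>)"] l_pos C_pos by (simp add: mult.commute)
  also have "l / (4 * C\<^sup>2) * (norm (U t))\<^sup>2 \<le> l / (4 * C\<^sup>2) * (C\<^sup>2 * ?A)"
    using norm_U_sq[of t] t0 l_pos C_pos by (intro mult_left_mono) auto
  also have "\<dots> = l/4 * ?A"
    using C_pos by simp
  finally have 2: "- \<mu> * (V (t - \<tau>) \<bullet> U t) \<le> l/4 * ?A + C\<^sup>2 / l * (norm (V (t - \<tau>)))\<^sup>2"
    by simp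
  show ?thesis
    using 1 2 unfolding acc_def by (simp add: power2_norm_eq_inner algebra_simps)
qed

text \<open>The term with \<open>mass t\<close> damps the velocity at rate \<open>g0\<close> after
  \<open>t0\<close>. Velocity, gradient and delayed velocity otherwise appear with the small weight
  \<delta>, at the price of large multiples of \<open>mem g\<close> and \<open>- mem g'\<close>, for
  which the dissipation in the energy identity pays.\<close>

lemma chi_deriv_le:
  assumes t: "\<tau> < t" "t0 \<le> t" and mu: "\<bar>\<mu>\<bar> \<le> 1" and \<delta>: "0 < \<delta>"
  shows "- mass t * (norm (V t))\<^sup>2
     - integral {0..t} (\<lambda>s. g' (t - s) * (V t \<bullet> (U t - U s)))
     - integral {0..t} (\<lambda>s. g (t - s) * (acc t t - acc t s))
    \<le> - (g0 - \<delta>) * (norm (V t))\<^sup>2 + \<delta> * (norm (W t))\<^sup>2 + \<delta> * (norm (V (t - \<tau>)))\<^sup>2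
      + (1 + (1 + C\<^sup>2) / (4 * \<delta>)) * mem g t + g 0 * C\<^sup>2 / (4 * \<delta>) * (- mem g' t)"
proof -
  have t0: "0 < t" using t tau_pos by simp
  let ?A = "(norm (W t))\<^sup>2" and ?P = "(norm (V t))\<^sup>2" and ?Z = "(norm (V (t - \<tau>)))\<^sup>2"
  let ?D = "\<lambda>s. (norm (W t - W s))\<^sup>2"
  have mass1: "0 \<le> mass t" "mass t \<le> 1" using mass_nonneg[of t] mass_le[of t] l_pos t0 by auto
  have ca: "continuous_on {0..t} (acc t)"
    by (rule continuous_on_compose2[OF continuous_on_acc, of "{0..t}" "\<lambda>s. (t,s)", simplified])
       (use t in \<open>auto intro!: continuous_intros\<close>)
  \<comment> \<open>The total weight of \<open>- g'\<close> on \<open>{0..t}\<close> is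
    \<open>g 0 - g t \<le> g 0\<close>, so this choice makes the coefficient of the squared velocity
    at most \<delta>.\<close>
  define \<kappa> where "\<kappa> = \<delta> / g 0"
  have \<kappa>: "0 < \<kappa>" using \<delta> g_0 by (simp add: \<kappa>_def)
  have "integral {0..t} (\<lambda>s. - g' (t - s) * (V t \<bullet> (U t - U s)))
     \<le> integral {0..t} (\<lambda>s. (- \<kappa> * ?P) * g' (t - s) + (- C\<^sup>2 / (4 * \<kappa>)) * (g' (t - s) * ?D s))"
  proof (rule integral_kernel_mono)
    fix s assume s: "0 \<le> s" "s \<le> t"
    have "V t \<bullet> (U t - U s) \<le> \<kappa> * ?P + (norm (U t - U s))\<^sup>2 / (4 * \<kappa>)"
      using young_inner[OF \<kappa>, of "V t" "U t - U s"] by simp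
    also have "\<dots> \<le> \<kappa> * ?P + C\<^sup>2 * ?D s / (4 * \<kappa>)"
      using norm_U_diff_sq[of s t] s \<kappa> by (intro add_left_mono divide_right_mono) auto
    finally have "- g' (t - s) * (V t \<bullet> (U t - U s)) \<le> - g' (t - s) * (\<kappa> * ?P + C\<^sup>2 * ?D s / (4 * \<kappa>))"
      using g'_nonpos[of "t - s"] s by (intro mult_left_mono) auto
    also have "\<dots> = (- \<kappa> * ?P) * g' (t - s) + (- C\<^sup>2 / (4 * \<kappa>)) * (g' (t - s) * ?D s)"
      by (simp add: algebra_simps)
    finally show "- g' (t - s) * (V t \<bullet> (U t - U s)) \<le> (- \<kappa> * ?P) * g' (t - s) + (- C\<^sup>2 / (4 * \<kappa>)) * (g' (t - s) * ?D s)" .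
  qed (use \<kappa> in \<open>auto intro!: continuous_intros\<close>)
  also have "\<dots> = (- \<kappa> * ?P) * integral {0..t} (\<lambda>s. g' (t - s)) + (- C\<^sup>2 / (4 * \<kappa>)) * mem g' t"
    unfolding mem_def
    by (subst integral_add integral_mult_right; 
        (intro integrable_kernel continuous_intros)?; (use t0 in auto)?)+
  also have "\<dots> = \<kappa> * ?P * (g 0 - g t) + g 0 * C\<^sup>2 / (4 * \<delta>) * (- mem g' t)"
    using t0 g_0 \<delta> by (simp add: integral_g'_reverse \<kappa>_def algebra_simps diff_divide_distrib)
  also have "\<kappa> * ?P * (g 0 - g t) \<le> \<kappa> * ?P * g 0"
    using \<kappa> g_nonneg[of t] t0 by (intro mult_left_mono) auto
  also have "\<kappa> * ?P * g 0 = \<delta> * ?P" using g_0 by (simp add: \<kappa>_def)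
  finally have I1: "- integral {0..t} (\<lambda>s. g' (t - s) * (V t \<bullet> (U t - U s)))
      \<le> \<delta> * ?P + g 0 * C\<^sup>2 / (4 * \<delta>) * (- mem g' t)"
    by simp
  \<comment> \<open>One half comes from the double memory term, the rest from Young's inequality
    with weight \<delta> for the gradient and for the delayed velocity. The remaining half in the
    final coefficient stems from \<open>mem g t / 2\<close> below.\<close>
  define K where "K = 1/2 + (1 + C\<^sup>2) / (4 * \<delta>)"
  have acc_diff: "- (acc t t - acc t s) \<le> \<delta> * ?A + \<delta> * ?Z + mem g t / 2 + K * ?D s" if s: "0 \<le> s" "s \<le> t" for s
  proof -
    let ?d = "W t - W s"
    have "integral {0..t} (\<lambda>r. g (t - r) * (W r \<bullet> W t)) - integral {0..t} (\<lambda>r. g (t - r) * (W r \<bullet> W s))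
      = integral {0..t} (\<lambda>r. g (t - r) * (W r \<bullet> W t) - g (t - r) * (W r \<bullet> W s))"
      by (subst integral_diff) (use s in \<open>auto intro!: integrable_kernel continuous_intros\<close>)
    \<comment> \<open>Writing \<open>W r\<close> as \<open>W t - (W t - W r)\<close> makes the
      gradient appear with the factor \<open>1 - mass t\<close>, which lies in \<open>[0,1]\<close>,
      and leaves a difference that \<open>mem g\<close> controls.\<close>
    also have "\<dots> = integral {0..t} (\<lambda>r. (W t \<bullet> ?d) * g (t - r) - g (t - r) * ((W t - W r) \<bullet> ?d))"
      by (intro integral_cong) (simp add: inner_diff algebra_simps)
    also have "\<dots> = (W t \<bullet> ?d) * mass t - integral {0..t} (\<lambda>r. g (t - r) * ((W t - W r) \<bullet> ?d))"
      unfolding integral_g_reverse[symmetric]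
      by (subst integral_diff integral_mult_right; 
        (intro integrable_kernel continuous_intros)?; (use s in auto)?)+
    finally have eq: "acc t t - acc t s = - (1 - mass t) * (W t \<bullet> ?d)
        - integral {0..t} (\<lambda>r. g (t - r) * ((W t - W r) \<bullet> ?d)) - \<mu> * (V (t - \<tau>) \<bullet> (U t - U s))"
      unfolding acc_def by (simp add: inner_diff algebra_simps)
    have "(1 - mass t) * (W t \<bullet> ?d) \<le> \<bar>W t \<bullet> ?d\<bar>"
      using mass1 mult_left_le_one_le[of "\<bar>W t \<bullet> ?d\<bar>" "1 - mass t"]
        mult_left_mono[OF abs_ge_self[of "W t \<bullet> ?d"], of "1 - mass t"] by simp
    also have "\<dots> \<le> \<delta> * ?A + ?D s / (4 * \<delta>)" by (rule young_inner[OF \<delta>])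
    finally have 1: "(1 - mass t) * (W t \<bullet> ?d) \<le> \<delta> * ?A + ?D s / (4 * \<delta>)" .
    have "integral {0..t} (\<lambda>r. g (t - r) * ((W t - W r) \<bullet> ?d))
       \<le> integral {0..t} (\<lambda>r. (1/2) * (g (t - r) * ?D r) + (?D s / 2) * g (t - r))"
    proof (rule integral_kernel_mono)
      fix r assume r: "0 \<le> r" "r \<le> t"
      have "(W t - W r) \<bullet> ?d \<le> ?D r / 2 + ?D s / 2"
        using young_inner[of "1/2" "W t - W r" ?d] by simp
      then have "g (t - r) * ((W t - W r) \<bullet> ?d) \<le> g (t - r) * (?D r / 2 + ?D s / 2)"
        using g_nonneg[of "t - r"] r by (intro mult_left_mono) auto
      then show "g (t - r) * ((W t - W r) \<bullet> ?d) \<le> (1/2) * (g (t - r) * ?D r) + (?D s / 2) * g (t - r)"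
        by (simp add: algebra_simps)
    qed (use s in \<open>auto intro!: continuous_intros\<close>)
    also have "\<dots> = (1/2) * mem g t + (?D s / 2) * mass t"
      unfolding mem_def integral_g_reverse[symmetric]
      by (subst integral_add integral_mult_right; 
        (intro integrable_kernel continuous_intros)?; (use s in auto)?)+
    also have "(?D s / 2) * mass t \<le> ?D s / 2"
      using mass1 by (intro mult_left_le) auto
    finally have 2: "integral {0..t} (\<lambda>r. g (t - r) * ((W t - W r) \<bullet> ?d)) \<le> mem g t / 2 + ?D s / 2"
      by simp
    have "\<mu> * (V (t - \<tau>) \<bullet> (U t - U s)) \<le> \<bar>\<mu>\<bar> * \<bar>V (t - \<tau>) \<bullet> (U t - U s)\<bar>"
      by (metis abs_ge_self abs_mult)
    also have "\<dots> \<le> \<bar>V (t - \<tau>) \<bullet> (U t - U s)\<bar>"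
      using mu by (intro mult_left_le_one_le) auto
    also have "\<dots> \<le> \<delta> * ?Z + (norm (U t - U s))\<^sup>2 / (4 * \<delta>)" by (rule young_inner[OF \<delta>])
    also have "\<dots> \<le> \<delta> * ?Z + C\<^sup>2 * ?D s / (4 * \<delta>)"
      using norm_U_diff_sq[of s t] s \<delta> by (intro add_left_mono divide_right_mono) auto
    finally have 3: "\<mu> * (V (t - \<tau>) \<bullet> (U t - U s)) \<le> \<delta> * ?Z + C\<^sup>2 * ?D s / (4 * \<delta>)" .
    have "K * ?D s = ?D s / 2 + ?D s / (4 * \<delta>) + C\<^sup>2 * ?D s / (4 * \<delta>)"
      unfolding K_def by (simp add: add_divide_distrib algebra_simps)
    then show ?thesis using 1 2 3 unfolding eq by (simp add: algebra_simps)
  qed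
  have "integral {0..t} (\<lambda>s. - (g (t - s) * (acc t t - acc t s)))
     \<le> integral {0..t} (\<lambda>s. (\<delta> * ?A + \<delta> * ?Z + mem g t / 2) * g (t - s) + K * (g (t - s) * ?D s))"
  proof (rule integral_kernel_mono)
    fix s assume s: "0 \<le> s" "s \<le> t"
    have "g (t - s) * - (acc t t - acc t s) \<le> g (t - s) * (\<delta> * ?A + \<delta> * ?Z + mem g t / 2 + K * ?D s)"
      using g_nonneg[of "t - s"] s by (intro mult_left_mono acc_diff) auto
    then show "- (g (t - s) * (acc t t - acc t s)) \<le> (\<delta> * ?A + \<delta> * ?Z + mem g t / 2) * g (t - s) + K * (g (t - s) * ?D s)"
      by (simp add: algebra_simps)
  qed (auto intro!: continuous_intros ca)
  also have "\<dots> = (\<delta> * ?A + \<delta> * ?Z + mem g t / 2) * mass t + K * mem g t"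
    unfolding mem_def integral_g_reverse[symmetric]
    by (subst integral_add integral_mult_right; 
        (intro integrable_kernel continuous_intros)?; (use t0 in auto)?)+
  also have "(\<delta> * ?A + \<delta> * ?Z + mem g t / 2) * mass t \<le> \<delta> * ?A + \<delta> * ?Z + mem g t / 2"
    using mass1 \<delta> mem_nonneg[of t] t0 by (intro mult_left_le) auto
  finally have "- integral {0..t} (\<lambda>s. g (t - s) * (acc t t - acc t s))
     \<le> \<delta> * ?A + \<delta> * ?Z + mem g t / 2 + K * mem g t"
    by simp
  also have "\<delta> * ?A + \<delta> * ?Z + mem g t / 2 + K * mem g t = \<delta> * ?A + \<delta> * ?Z + (1 + (1 + C\<^sup>2) / (4 * \<delta>)) * mem g t"
    by (simp add: K_def distrib_right)
  finally have I2: "- integral {0..t} (\<lambda>s. g (t - s) * (acc t t - acc t s))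
     \<le> \<delta> * ?A + \<delta> * ?Z + (1 + (1 + C\<^sup>2) / (4 * \<delta>)) * mem g t" .
  have "- mass t * ?P \<le> - g0 * ?P"
    using mass_ge[OF t(2)] by (intro mult_right_mono) auto
  then show ?thesis using I1 I2 by (simp add: algebra_simps)
qed

lemma inner_VU_bound: "0 \<le> t \<Longrightarrow> \<bar>V t \<bullet> U t\<bar> \<le> (norm (V t))\<^sup>2 / 2 + C\<^sup>2 / 2 * (norm (W t))\<^sup>2"
  using young_inner[of "1/2" "V t" "U t"] norm_U_sq[of t] by simp

text \<open>Young's inequality with weight 1/2 under the integral; \<open>mass t \<le> 1\<close>
  keeps the velocity coefficient at 1/2.\<close>

lemma chi_bound:
  assumes t: "0 \<le> t"
  shows "\<bar>chi t\<bar> \<le> (norm (V t))\<^sup>2 / 2 + C\<^sup>2 / 2 * mem g t"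
proof -
  let ?f = "\<lambda>s. g (t - s) * (V t \<bullet> (U t - U s))"
  let ?h = "\<lambda>s. (norm (V t))\<^sup>2 / 2 * g (t - s) + C\<^sup>2 / 2 * (g (t - s) * (norm (W t - W s))\<^sup>2)"
  have pt: "\<bar>?f s\<bar> \<le> ?h s" if s: "0 \<le> s" "s \<le> t" for s
  proof -
    have "\<bar>?f s\<bar> = g (t - s) * \<bar>V t \<bullet> (U t - U s)\<bar>"
      using g_nonneg[of "t - s"] s by (simp add: abs_mult)
    also have "\<dots> \<le> g (t - s) * ((norm (V t))\<^sup>2 / 2 + C\<^sup>2 / 2 * (norm (W t - W s))\<^sup>2)"
      using young_inner[of "1/2" "V t" "U t - U s"] norm_U_diff_sq[of s t] s g_nonneg[of "t - s"]
      by (intro mult_left_mono) auto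
    finally show ?thesis by (simp add: algebra_simps)
  qed
  have h: "integral {0..t} ?h = (norm (V t))\<^sup>2 / 2 * mass t + C\<^sup>2 / 2 * mem g t"
    unfolding mem_def integral_g_reverse[symmetric]
    by (subst integral_add integral_mult_right; 
        (intro integrable_kernel continuous_intros)?; (use t in auto)?)+
  have "norm (integral {0..t} ?f) \<le> integral {0..t} ?h"
    by (rule integral_norm_bound_integral) (use pt in \<open>auto intro!: integrable_kernel continuous_intros\<close>)
  also have "\<dots> \<le> (norm (V t))\<^sup>2 / 2 + C\<^sup>2 / 2 * mem g t"
    unfolding h using mass_le[OF t] l_pos mass_nonneg[OF t] by (auto intro!: mult_left_le)
  finally show ?thesis by (simp add: chi_def)
qed

text \<open>The conditions \<open>small\<close> bound the perturbation by half of the energy and let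
  a quarter of \<open>- mem g'\<close> absorb all memory terms. The conditions \<open>mu\<close>
  give the two velocity coefficients the right sign, and \<open>C1\<close> covers both the factor 1
  of the velocity and the factor \<open>C\<^sup>2 / l\<close> of the delayed velocity.\<close>

theorem energy_decay:
  fixes \<epsilon>1 \<epsilon>2 \<delta> C1 \<xi> \<sigma> T1 :: real
  defines "k1 \<equiv> \<epsilon>2 * (g0 - \<delta>) - \<epsilon>1 * C1" and "k2 \<equiv> \<epsilon>1 * C1 + \<epsilon>2 * \<delta>"
  assumes T1: "\<tau> < T1" "t0 \<le> T1"
    and pos: "0 < \<delta>" "0 < \<epsilon>1" "0 < \<epsilon>2" "0 < \<xi>" "0 < \<sigma>"
    and C1: "1 + C\<^sup>2 / l \<le> C1"
    and \<delta>: "\<delta> < l * g0 / (16 * C1)" and \<epsilon>1: "\<epsilon>2 * (g0 / (8 * C1)) < \<epsilon>1"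
    and mu: "\<bar>\<mu>\<bar> \<le> 1" "\<bar>\<mu>\<bar> < 2 * k1 - \<xi>" "\<bar>\<mu>\<bar> < \<xi> * exp (- \<sigma> * \<tau>) - 2 * k2"
    and small: "(\<epsilon>1 / l + \<epsilon>2 * (1 + (1 + C\<^sup>2) / (4 * \<delta>))) / \<zeta> + \<epsilon>2 * (g 0 * C\<^sup>2 / (4 * \<delta>)) \<le> 1/4"
      "\<epsilon>1 + \<epsilon>2 \<le> 1/2" "\<epsilon>1 * C\<^sup>2 \<le> l / 2" "\<epsilon>2 * C\<^sup>2 \<le> 1/2"
  shows "\<exists>lam>0. \<forall>t\<ge>T1. En \<xi> \<sigma> t \<le> 3 * En \<xi> \<sigma> T1 * exp (- lam * (t - T1))"
proof -
  define L where "L = (\<lambda>t. En \<xi> \<sigma> t + \<epsilon>1 * (V t \<bullet> U t) + \<epsilon>2 * chi t)"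
  define dL where "dL = (\<lambda>t. 1/2 * (mem g' t - g t * (norm (W t))\<^sup>2 - 2 * \<mu> * (V (t - \<tau>) \<bullet> V t))
     + \<xi>/2 * (- \<sigma> * hist \<sigma> t + (norm (V t))\<^sup>2 - exp (- \<sigma> * \<tau>) * (norm (V (t - \<tau>)))\<^sup>2)
     + \<epsilon>1 * (acc t t + (norm (V t))\<^sup>2) + \<epsilon>2 * (- mass t * (norm (V t))\<^sup>2
     - integral {0..t} (\<lambda>s. g' (t - s) * (V t \<bullet> (U t - U s)))
     - integral {0..t} (\<lambda>s. g (t - s) * (acc t t - acc t s))))"
  \<comment> \<open>\<open>\<alpha>\<close>, \<open>\<beta>\<close>, \<open>\<zeta> / 4\<close> and
    \<open>\<xi> / 2 * \<sigma>\<close> become the damping coefficients of velocity, gradient,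
    memory and history; \<open>c\<close> compares them with the coefficients 1/2, 1/2, 1/2 and
    \<open>\<xi> / 2\<close> that bound the energy.\<close>
  define \<alpha> where "\<alpha> = (2 * k1 - \<xi> - \<bar>\<mu>\<bar>) / 2"
  define \<beta> where "\<beta> = \<epsilon>1 * l / 2 - \<epsilon>2 * \<delta>"
  define c where "c = Min {2 * \<alpha>, 2 * \<beta>, \<zeta> / 2, \<sigma>}"
  have "0 \<le> C\<^sup>2 / l" using l_pos by simp
  then have C1': "1 \<le> C1" "C\<^sup>2 / l \<le> C1" using C1 by linarith+
  \<comment> \<open>The constants 16 and 8 in the hypotheses \<open>\<delta>\<close> and
    \<open>\<epsilon>1\<close> differ by just the factor 2 of \<open>l / 2\<close>.\<close>
  have "\<epsilon>2 * \<delta> < \<epsilon>2 * (l * g0 / (16 * C1))"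
    using \<delta> pos by (intro mult_strict_left_mono) auto
  also have "\<dots> = \<epsilon>2 * (g0 / (8 * C1)) * (l / 2)" by simp
  also have "\<dots> < \<epsilon>1 * (l / 2)" using \<epsilon>1 l_pos by (intro mult_strict_right_mono) auto
  finally have \<beta>: "0 < \<beta>" by (simp add: \<beta>_def)
  have \<alpha>: "0 < \<alpha>" using mu by (simp add: \<alpha>_def)
  have c: "0 < c" "c \<le> 2 * \<alpha>" "c \<le> 2 * \<beta>" "c \<le> \<zeta> / 2" "c \<le> \<sigma>"
    using \<alpha> \<beta> zeta_pos pos by (auto simp: c_def)
  have L_deriv: "(L has_real_derivative dL t) (at t)" if t: "\<tau> < t" for t
    unfolding L_def dL_def by (intro DERIV_add DERIV_cmult En_deriv inner_VU_deriv chi_deriv t)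
  have En_ge: "((norm (V t))\<^sup>2 + l * (norm (W t))\<^sup>2 + mem g t) / 2 \<le> En \<xi> \<sigma> t" if t: "T1 \<le> t" for t
  proof -
    define Q where "Q = (1 - mass t) * (norm (W t))\<^sup>2"
    have "l * (norm (W t))\<^sup>2 \<le> Q"
      unfolding Q_def using mass_le[of t] t T1 tau_pos by (intro mult_right_mono) auto
    moreover have "0 \<le> \<xi>/2 * hist \<sigma> t" using hist_nonneg[of t \<sigma>] pos t T1 by simp
    ultimately show ?thesis unfolding En_def Q_def[symmetric] by (simp add: add_divide_distrib)
  qed
  have En_le: "En \<xi> \<sigma> t \<le> ((norm (V t))\<^sup>2 + (norm (W t))\<^sup>2 + mem g t) / 2 + \<xi>/2 * hist \<sigma> t" if t: "T1 \<le> t" for t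
  proof -
    have "(1 - mass t) * (norm (W t))\<^sup>2 \<le> (norm (W t))\<^sup>2"
      using mass_nonneg[of t] t T1 tau_pos by (intro mult_left_le_one_le) (use mass_le[of t] l_pos in auto)
    then show ?thesis unfolding En_def by simp
  qed
  \<comment> \<open>So \<open>L\<close> lies between \<open>1/2\<close> and \<open>3/2\<close> times
    the energy; this is the source of the factor 2/3 in \<open>lam\<close> and of the factor 3 in
    the conclusion.\<close>
  have L_En: "\<bar>L t - En \<xi> \<sigma> t\<bar> \<le> En \<xi> \<sigma> t / 2" if t: "T1 \<le> t" for t
  proof -
    have t': "0 \<le> t" using t T1 tau_pos by simp
    have "\<bar>L t - En \<xi> \<sigma> t\<bar> \<le> \<epsilon>1 * \<bar>V t \<bullet> U t\<bar> + \<epsilon>2 * \<bar>chi t\<bar>"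
      unfolding L_def using pos abs_triangle_ineq[of "\<epsilon>1 * (V t \<bullet> U t)" "\<epsilon>2 * chi t"] by (simp add: abs_mult)
    also have "\<dots> \<le> \<epsilon>1 * ((norm (V t))\<^sup>2 / 2 + C\<^sup>2 / 2 * (norm (W t))\<^sup>2) + \<epsilon>2 * ((norm (V t))\<^sup>2 / 2 + C\<^sup>2 / 2 * mem g t)"
      using pos inner_VU_bound[OF t'] chi_bound[OF t'] by (intro add_mono mult_left_mono) auto
    also have "\<dots> = (\<epsilon>1 + \<epsilon>2) * ((norm (V t))\<^sup>2 / 2) + (\<epsilon>1 * C\<^sup>2) * ((norm (W t))\<^sup>2 / 2) + (\<epsilon>2 * C\<^sup>2) * (mem g t / 2)"
      by (simp add: algebra_simps)
    also have "\<dots> \<le> 1/2 * ((norm (V t))\<^sup>2 / 2) + l/2 * ((norm (W t))\<^sup>2 / 2) + 1/2 * (mem g t / 2)"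
      using small mem_nonneg[OF t'] by (intro add_mono mult_right_mono) auto
    also have "\<dots> \<le> En \<xi> \<sigma> t / 2" using En_ge[OF t] by (simp add: field_simps)
    finally show ?thesis .
  qed
  have dL_le: "dL t \<le> - c * En \<xi> \<sigma> t" if t: "T1 \<le> t" for t
  proof -
    have t': "\<tau> < t" "t0 \<le> t" "0 \<le> t" using t T1 tau_pos by auto
    define P A Z M M' H where "P = (norm (V t))\<^sup>2" and "A = (norm (W t))\<^sup>2" and "Z = (norm (V (t - \<tau>)))\<^sup>2"
      and "M = mem g t" and "M' = - mem g' t" and "H = hist \<sigma> t"
    define K where "K = 1 + (1 + C\<^sup>2) / (4 * \<delta>)"
    define K' where "K' = g 0 * C\<^sup>2 / (4 * \<delta>)"
    have nn: "0 \<le> P" "0 \<le> A" "0 \<le> Z" "0 \<le> M" "0 \<le> H"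
      using mem_nonneg[OF t'(3)] hist_nonneg[OF t'(1)] by (auto simp: P_def A_def Z_def M_def H_def)
    have M': "\<zeta> * M \<le> M'" using mem_g'_le[OF t'(3)] by (simp add: M_def M'_def)
    have M'0: "0 \<le> M'" using M' zeta_pos nn mult_nonneg_nonneg[of \<zeta> M] by linarith
    have K: "0 < K" using pos by (simp add: K_def add_pos_nonneg)
    have "- \<mu> * (V (t - \<tau>) \<bullet> V t) \<le> \<bar>\<mu>\<bar> * \<bar>V (t - \<tau>) \<bullet> V t\<bar>"
      by (metis abs_ge_self abs_minus_cancel abs_mult)
    also have "\<dots> \<le> \<bar>\<mu>\<bar> * (Z / 2 + P / 2)"
      using young_inner[of "1/2" "V (t - \<tau>)" "V t"] by (intro mult_left_mono) (auto simp: Z_def P_def)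
    finally have 1: "- \<mu> * (V (t - \<tau>) \<bullet> V t) \<le> \<bar>\<mu>\<bar> * (Z / 2 + P / 2)" .
    have 2: "\<epsilon>1 * (acc t t + P) \<le> \<epsilon>1 * (- (l / 2) * A + M / l + C\<^sup>2 / l * Z + P)"
      using acc_le[OF t'(1) mu(1)] pos by (intro mult_left_mono) (auto simp: A_def M_def Z_def P_def)
    have 3: "\<epsilon>2 * (- mass t * P - integral {0..t} (\<lambda>s. g' (t - s) * (V t \<bullet> (U t - U s)))
       - integral {0..t} (\<lambda>s. g (t - s) * (acc t t - acc t s)))
      \<le> \<epsilon>2 * (- (g0 - \<delta>) * P + \<delta> * A + \<delta> * Z + K * M + K' * M')"
      using chi_deriv_le[OF t'(1,2) mu(1) pos(1)] pos 
      by (intro mult_left_mono) (auto simp: A_def M_def M'_def Z_def P_def K_def K'_def)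
    have 4: "0 \<le> g t * A" using g_nonneg[OF t'(3)] nn by simp
    have 5: "\<epsilon>1 * P \<le> \<epsilon>1 * C1 * P" "\<epsilon>1 * (C\<^sup>2 / l) * Z \<le> \<epsilon>1 * C1 * Z"
      using mult_right_mono[OF mult_left_mono[OF C1'(1), of \<epsilon>1], of P]
        mult_right_mono[OF mult_left_mono[OF C1'(2), of \<epsilon>1], of Z] pos nn by auto
    \<comment> \<open>Exchanging \<open>M\<close> for \<open>M' / \<zeta>\<close> charges all memory
      terms to the single dissipative term \<open>- M' / 2\<close>, half of which is left
      over.\<close>
    have "(\<epsilon>1 / l + \<epsilon>2 * K) * M \<le> (\<epsilon>1 / l + \<epsilon>2 * K) * (M' / \<zeta>)"
      using pos l_pos K M' zeta_pos by (intro mult_left_mono) (auto simp: field_simps)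
    also have "\<dots> + \<epsilon>2 * K' * M' = ((\<epsilon>1 / l + \<epsilon>2 * K) / \<zeta> + \<epsilon>2 * K') * M'"
      by (simp add: algebra_simps add_divide_distrib)
    also have "\<dots> \<le> 1/4 * M'" using small(1) M'0 unfolding K_def K'_def by (intro mult_right_mono) auto
    finally have 6: "(\<epsilon>1 / l + \<epsilon>2 * K) * M + \<epsilon>2 * K' * M' \<le> M' / 4" by simp
    have 7: "(\<bar>\<mu>\<bar> - \<xi> * exp (- \<sigma> * \<tau>) + 2 * k2) * Z \<le> 0"
      using mu nn by (intro mult_nonpos_nonneg) auto
    have "dL t = - M' / 2 - g t * A / 2 - \<mu> * (V (t - \<tau>) \<bullet> V t)
       + \<xi>/2 * (- \<sigma> * H + P - exp (- \<sigma> * \<tau>) * Z) + \<epsilon>1 * (acc t t + P)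
       + \<epsilon>2 * (- mass t * P - integral {0..t} (\<lambda>s. g' (t - s) * (V t \<bullet> (U t - U s)))
       - integral {0..t} (\<lambda>s. g (t - s) * (acc t t - acc t s)))"
      unfolding dL_def P_def A_def Z_def M'_def H_def by (simp add: algebra_simps)
    also have "\<dots> \<le> - M' / 2 + \<bar>\<mu>\<bar> * (Z / 2 + P / 2) + \<xi>/2 * (- \<sigma> * H + P - exp (- \<sigma> * \<tau>) * Z)
       + \<epsilon>1 * (- (l / 2) * A + M / l + C\<^sup>2 / l * Z + P) + \<epsilon>2 * (- (g0 - \<delta>) * P + \<delta> * A + \<delta> * Z + K * M + K' * M')"
      using 1 2 3 4 by linarith
    also have "\<dots> = - M' / 2 + (\<bar>\<mu>\<bar> / 2 + \<xi> / 2 - \<epsilon>2 * (g0 - \<delta>)) * P + \<epsilon>1 * P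
        + (\<bar>\<mu>\<bar> / 2 - \<xi> * exp (- \<sigma> * \<tau>) / 2 + \<epsilon>2 * \<delta>) * Z + \<epsilon>1 * (C\<^sup>2 / l) * Z
        - \<beta> * A + ((\<epsilon>1 / l + \<epsilon>2 * K) * M + \<epsilon>2 * K' * M') - \<xi> / 2 * \<sigma> * H"
      unfolding \<beta>_def by (simp add: algebra_simps)
    also have "\<dots> \<le> - M' / 2 + (\<bar>\<mu>\<bar> / 2 + \<xi> / 2 - \<epsilon>2 * (g0 - \<delta>)) * P + \<epsilon>1 * C1 * P
        + (\<bar>\<mu>\<bar> / 2 - \<xi> * exp (- \<sigma> * \<tau>) / 2 + \<epsilon>2 * \<delta>) * Z + \<epsilon>1 * C1 * Z
        - \<beta> * A + M' / 4 - \<xi> / 2 * \<sigma> * H"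
      using 5 6 by linarith
    also have "\<dots> = - M' / 4 - \<alpha> * P + (\<bar>\<mu>\<bar> - \<xi> * exp (- \<sigma> * \<tau>) + 2 * k2) * Z / 2 - \<beta> * A - \<xi> / 2 * \<sigma> * H"
      unfolding \<alpha>_def k1_def k2_def by (simp add: field_simps)
    \<comment> \<open>What is left of \<open>M'\<close> now supplies the decay of the memory; the
      delayed velocity has a nonpositive coefficient and is dropped.\<close>
    also have "\<dots> \<le> - (\<zeta> * M) / 4 - \<alpha> * P - \<beta> * A - \<xi> / 2 * \<sigma> * H"
      using 7 M' by linarith
    also have "\<dots> \<le> - c * ((P + A + M) / 2 + \<xi>/2 * H)"
    proof -
      have "c * P \<le> 2 * \<alpha> * P" "c * A \<le> 2 * \<beta> * A" "c * M \<le> \<zeta> / 2 * M" "c * (\<xi> / 2 * H) \<le> \<sigma> * (\<xi> / 2 * H)"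
        by (rule mult_right_mono; use c nn pos in auto)+
      then show ?thesis by (simp add: algebra_simps)
    qed
    also have "\<dots> \<le> - c * En \<xi> \<sigma> t"
      using En_le[OF t] c unfolding P_def A_def M_def H_def by simp
    finally show ?thesis .
  qed
  define lam where "lam = 2 * c / 3"
  have lam: "0 < lam" using c by (simp add: lam_def)
  \<comment> \<open>Gronwall with an integrating factor: \<open>L \<le> 3/2 * En\<close> gives
    \<open>lam * L \<le> c * En\<close>.\<close>
  have decay: "L t * exp (lam * t) \<le> L T1 * exp (lam * T1)" if t: "T1 \<le> t" for t
  proof (rule DERIV_nonpos_imp_nonincreasing[OF t])
    fix x assume x: "T1 \<le> x" "x \<le> t"
    have "((\<lambda>t. L t * exp (lam * t)) has_real_derivative (dL x + lam * L x) * exp (lam * x)) (at x)"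
      using x T1 by (auto intro!: derivative_eq_intros L_deriv simp: algebra_simps)
    moreover have "dL x + lam * L x \<le> 0"
    proof -
      have "lam * L x \<le> lam * (3/2 * En \<xi> \<sigma> x)"
        using abs_le_D1[OF L_En[OF x(1)]] lam by (intro mult_left_mono) auto
      then show ?thesis using dL_le[OF x(1)] by (simp add: lam_def)
    qed
    ultimately show "\<exists>y. ((\<lambda>t. L t * exp (lam * t)) has_real_derivative y) (at x) \<and> y \<le> 0"
      using mult_nonpos_nonneg by (metis exp_ge_zero)
  qed
  show ?thesis
  proof (intro exI[of _ lam] conjI allI impI lam)
    fix t assume t: "T1 \<le> t"
    have "En \<xi> \<sigma> t \<le> 2 * L t" using L_En[OF t] by linarith
    also have "L t = L t * exp (lam * t) * exp (- lam * t)" by (simp flip: exp_add)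
    also have "\<dots> \<le> L T1 * exp (lam * T1) * exp (- lam * t)"
      using decay[OF t] by (intro mult_right_mono) auto
    also have "\<dots> = L T1 * exp (- lam * (t - T1))" by (simp add: algebra_simps flip: exp_add)
    also have "\<dots> \<le> (3/2 * En \<xi> \<sigma> T1) * exp (- lam * (t - T1))"
      using abs_le_D1[OF L_En[OF order_refl]] by (intro mult_right_mono) auto
    finally show "En \<xi> \<sigma> t \<le> 3 * En \<xi> \<sigma> T1 * exp (- lam * (t - T1))" by (simp add: ac_simps)
  qed
qed

end

subsection \<open>Functions of class Ck\<close>

text \<open>Uniqueness of the derivative lets any explicitly known \<open>f'\<close> take the place
  of \<open>frechet_derivative\<close>.\<close>

lemma Ck_SucI:
  assumes "\<And>x. (f has_derivative f' x) (at x)" "\<And>i. i \<in> Basis \<Longrightarrow> Ck k (\<lambda>x. f' x i)"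
  shows "Ck (Suc k) f"
proof -
  have "frechet_derivative f (at x) = f' x" for x
    using frechet_derivative_at[OF assms(1)] by metis
  then show ?thesis using assms by (auto simp: differentiable_def)
qed

lemma Ck_Suc_real:
  fixes f :: "real \<Rightarrow> real"
  assumes "\<And>x. (f has_real_derivative f' x) (at x)" "Ck k f'"
  shows "Ck (Suc k) f"
  using assms by (intro Ck_SucI[of f "\<lambda>x. (*) (f' x)"]) (auto simp: has_field_derivative_def)

lemma Ck_Suc_has_derivative: "Ck (Suc k) f \<Longrightarrow> (f has_derivative frechet_derivative f (at x)) (at x)"
  by (simp add: frechet_derivative_works)

lemma Ck_continuous: "Ck k f \<Longrightarrow> continuous_on UNIV f"
  by (cases k) (auto intro!: continuous_at_imp_continuous_on differentiable_imp_continuous_within)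

lemma Ck_Suc_imp_Ck: "Ck (Suc k) f \<Longrightarrow> Ck k f"
proof (induction k arbitrary: f)
  case 0
  then show ?case using Ck_continuous[of "Suc 0" f] by simp
next
  case (Suc k)
  then show ?case by (metis Ck.simps(2))
qed

lemma Ck_const: "Ck k (\<lambda>x. c)"
  by (induction k arbitrary: c) (auto intro: Ck_SucI[of _ "\<lambda>_ _. 0"])

lemma Ck_add: "Ck k f \<Longrightarrow> Ck k h \<Longrightarrow> Ck k (\<lambda>x. f x + h x)"
proof (induction k arbitrary: f h)
  case 0
  then show ?case by (auto intro: continuous_intros)
next
  case (Suc k)
  show ?case
    by (rule Ck_SucI[OF has_derivative_add[OF Ck_Suc_has_derivative Ck_Suc_has_derivative]])
      (use Suc in \<open>auto intro!: Suc.IH\<close>)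
qed

lemma Ck_Suc_partial: "Ck (Suc k) f \<Longrightarrow> i \<in> Basis \<Longrightarrow> Ck k (\<lambda>x. frechet_derivative f (at x) i)"
  by simp

lemma Ck_mult: "Ck k f \<Longrightarrow> Ck k h \<Longrightarrow> Ck k (\<lambda>x. f x * h x)"
proof (induction k arbitrary: f h)
  case 0
  then show ?case by (auto intro: continuous_intros)
next
  case (Suc k)
  show ?case
  proof (rule Ck_SucI[OF has_derivative_mult[OF Ck_Suc_has_derivative Ck_Suc_has_derivative]])
    fix i :: 'a assume "i \<in> Basis"
    then show "Ck k (\<lambda>x. f x * frechet_derivative h (at x) i + frechet_derivative f (at x) i * h x)"
      by (intro Ck_add Suc.IH Ck_Suc_imp_Ck[OF Suc.prems(1)] Ck_Suc_imp_Ck[OF Suc.prems(2)]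
          Ck_Suc_partial[OF Suc.prems(1)] Ck_Suc_partial[OF Suc.prems(2)])
  qed (rule Suc.prems)+
qed

lemma Ck_cmult: "Ck k f \<Longrightarrow> Ck k (\<lambda>x. c * f x)"
  by (intro Ck_mult Ck_const)

lemma Ck_diff: "Ck k f \<Longrightarrow> Ck k h \<Longrightarrow> Ck k (\<lambda>x. f x - h x)"
  using Ck_add[of k f "\<lambda>x. -1 * h x"] Ck_cmult[of k h "-1"] by simp

lemma Ck_prod: "finite I \<Longrightarrow> (\<And>i. i \<in> I \<Longrightarrow> Ck k (f i)) \<Longrightarrow> Ck k (\<lambda>x. \<Prod>i\<in>I. f i x)"
  by (induction I rule: finite_induct) (auto intro: Ck_const Ck_mult)

text \<open>The partial derivative along \<open>i\<close> is the constant
  \<open>i \<bullet> v\<close> times the derivative of \<open>h\<close> at the same affine argument,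
  so the induction runs over all \<open>h\<close>.\<close>

lemma Ck_affine:
  fixes h :: "real \<Rightarrow> real" and v :: "'a::euclidean_space"
  shows "Ck k h \<Longrightarrow> Ck k (\<lambda>x. h (a + x \<bullet> v))"
proof (induction k arbitrary: h)
  case 0
  then show ?case by (auto intro!: continuous_intros continuous_on_compose2[of UNIV h])
next
  case (Suc k)
  let ?h' = "\<lambda>y. frechet_derivative h (at y) 1"
  \<comment> \<open>On the real axis a Frechet derivative is multiplication by its value at
    1.\<close>
  have D: "(h has_derivative (\<lambda>z. z * ?h' y)) (at y)" for y
  proof -
    have *: "(h has_derivative frechet_derivative h (at y)) (at y)"
      by (rule Ck_Suc_has_derivative[OF Suc.prems])
    have "frechet_derivative h (at y) z = z * ?h' y" for z
      using linear_cmul[OF has_derivative_linear[OF *], of z 1] by simp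
    then show ?thesis using * by (metis (no_types, lifting) ext)
  qed
  have "((\<lambda>x. h (a + x \<bullet> v)) has_derivative (\<lambda>z. (z \<bullet> v) * ?h' (a + x \<bullet> v))) (at x)" for x
    by (rule has_derivative_compose[OF _ D]) (auto intro!: derivative_eq_intros)
  then show ?case
  proof (rule Ck_SucI)
    show "Ck k (\<lambda>x. (i \<bullet> v) * ?h' (a + x \<bullet> v))" for i
      using Suc.prems by (intro Ck_cmult Suc.IH) auto
  qed
qed

subsection \<open>Bump functions\<close>

text \<open>The powers of \<open>x\<close> make the family closed under differentiation up to linear combinations.\<close>

definition flat :: "nat \<Rightarrow> real \<Rightarrow> real" where
  "flat n x = (if x \<le> 0 then 0 else exp (- (1 / x)) / x ^ n)"

lemma flat_tendsto_0: "(flat n \<longlongrightarrow> 0) (at_right 0)"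
proof -
  have "((\<lambda>x::real. x ^ n / exp x) \<longlongrightarrow> 0) at_top" by (rule tendsto_power_div_exp_0)
  then have "((\<lambda>x::real. inverse x ^ n / exp (inverse x)) \<longlongrightarrow> 0) (at_right 0)"
    by (rule filterlim_compose[OF _ filterlim_inverse_at_top_right])
  then show ?thesis
    by (rule Lim_transform_eventually)
      (auto simp: eventually_at_right_field flat_def exp_minus field_simps intro!: exI[of _ 1])
qed

lemma flat_deriv: "(flat n has_real_derivative flat (n+2) x - real n * flat (n+1) x) (at x)"
proof (cases "x = 0")
  case True
  have "((\<lambda>y. (flat n y - flat n 0) / (y - 0)) \<longlongrightarrow> 0) (at 0)"
  proof (rule filterlim_split_at)
    \<comment> \<open>To the right of 0 the difference quotient is \<open>flat (Suc n)\<close>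
      itself.\<close>
    show "((\<lambda>y. (flat n y - flat n 0) / (y - 0)) \<longlongrightarrow> 0) (at_right 0)"
      using flat_tendsto_0[of "Suc n"]
      by (rule Lim_transform_eventually)
        (auto simp: eventually_at_right_field flat_def field_simps intro!: exI[of _ 1])
    show "((\<lambda>y. (flat n y - flat n 0) / (y - 0)) \<longlongrightarrow> 0) (at_left 0)"
      by (rule Lim_transform_eventually[OF tendsto_const])
        (auto simp: eventually_at_left_field flat_def intro!: exI[of _ "-1"])
  qed
  then show ?thesis unfolding has_field_derivative_iff True by (simp add: flat_def)
next
  case False
  then consider "x < 0" | "0 < x" by linarith
  then show ?thesis
  proof cases
    case 1
    have "((\<lambda>x. 0) has_real_derivative 0) (at x)" by simp
    then have "(flat n has_real_derivative 0) (at x)"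
      by (rule has_field_derivative_transform_within_open[of _ _ _ "{..<0}"]) (use 1 in \<open>auto simp: flat_def\<close>)
    then show ?thesis using 1 by (simp add: flat_def)
  next
    case 2
    have "((\<lambda>x. exp (- (1 / x)) / x ^ n) has_real_derivative flat (n+2) x - real n * flat (n+1) x) (at x)"
      using 2 by (auto intro!: derivative_eq_intros simp: flat_def divide_simps power2_eq_square)
         (cases n; auto simp: algebra_simps)
    then show ?thesis
      by (rule has_field_derivative_transform_within_open[of _ _ _ "{0<..}"]) (use 2 in \<open>auto simp: flat_def\<close>)
  qed
qed

lemma Ck_flat: "Ck k (flat n)"
proof (induction k arbitrary: n)
  case 0
  show ?case by (auto intro!: continuous_at_imp_continuous_on DERIV_isCont[OF flat_deriv])
next
  case (Suc k)
  show ?case by (rule Ck_Suc_real[OF flat_deriv]) (intro Ck_diff Ck_cmult Suc)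
qed

lemma flat_bounds: "0 \<le> flat 0 x" "flat 0 x \<le> 1"
  by (auto simp: flat_def)

lemma flat_scaled_tendsto: "(\<lambda>k. flat 0 (real k * x)) \<longlonglongrightarrow> (if 0 < x then 1 else 0)"
proof (cases "0 < x")
  case True
  have "(\<lambda>k. exp (- ((1 / x) * inverse (real k)))) \<longlonglongrightarrow> exp (- ((1 / x) * 0))"
    by (intro tendsto_intros lim_inverse_n)
  then have "(\<lambda>k. exp (- ((1 / x) * inverse (real k)))) \<longlonglongrightarrow> 1" by simp
  then have "(\<lambda>k. flat 0 (real k * x)) \<longlonglongrightarrow> 1"
    by (rule Lim_transform_eventually)
      (use True in \<open>auto simp: eventually_sequentially flat_def zero_less_mult_iff mult_le_0_iff field_simps intro!: exI[of _ 1]\<close>)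
  then show ?thesis using True by simp
qed (auto simp: flat_def mult_le_0_iff)

text \<open>Steepening \<open>flat 0\<close> by the factor \<open>k\<close> makes these products
  converge pointwise, with values in \<open>[0,1]\<close>, to the indicator of the open box.
  Integrals over boxes thus become limits of integrals against test functions.\<close>

definition box_bump :: "'a::euclidean_space \<Rightarrow> 'a \<Rightarrow> nat \<Rightarrow> 'a \<Rightarrow> real" where
  "box_bump a b k x = (\<Prod>i\<in>Basis. flat 0 (real k * (x \<bullet> i - a \<bullet> i)) * flat 0 (real k * (b \<bullet> i - x \<bullet> i)))"

lemma Ck_box_bump: "Ck m (box_bump a b k)"
proof -
  have "Ck m (\<lambda>x. flat 0 (real k * (x \<bullet> i - a \<bullet> i)) * flat 0 (real k * (b \<bullet> i - x \<bullet> i)))" for i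
    using Ck_mult[OF Ck_affine[OF Ck_flat[of m 0], of "- (real k * (a \<bullet> i))" "real k *\<^sub>R i"]
        Ck_affine[OF Ck_flat[of m 0], of "real k * (b \<bullet> i)" "- (real k *\<^sub>R i)"]]
    by (simp add: algebra_simps)
  then show ?thesis unfolding box_bump_def[abs_def] by (intro Ck_prod) auto
qed

lemma box_bump_eq_0: "x \<notin> box a b \<Longrightarrow> box_bump a b k x = 0"
  unfolding box_bump_def by (rule prod_zero) (auto simp: mem_box flat_def mult_le_0_iff not_less)

lemma box_bump_bounds: "0 \<le> box_bump a b k x" "box_bump a b k x \<le> 1"
  unfolding box_bump_def by (auto intro!: prod_nonneg prod_le_1 mult_le_one mult_nonneg_nonneg flat_bounds)

lemma box_bump_tendsto: "(\<lambda>k. box_bump a b k x) \<longlonglongrightarrow> indicator (box a b) x"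
proof (cases "x \<in> box a b")
  case True
  have "(\<lambda>k. box_bump a b k x) \<longlonglongrightarrow> (\<Prod>i\<in>Basis. (if 0 < x \<bullet> i - a \<bullet> i then 1 else 0) * (if 0 < b \<bullet> i - x \<bullet> i then 1 else 0))"
    unfolding box_bump_def by (intro tendsto_intros flat_scaled_tendsto)
  also have "(\<Prod>i\<in>Basis. (if 0 < x \<bullet> i - a \<bullet> i then 1 else 0) * (if 0 < b \<bullet> i - x \<bullet> i then 1 else 0::real)) = 1"
    using True by (intro prod.neutral) (auto simp: mem_box)
  finally show ?thesis using True by simp
qed (simp add: box_bump_eq_0)

lemma box_bump_test: "cbox a b \<subseteq> \<Omega> \<Longrightarrow> box_bump a b k \<in> test_functions \<Omega>"
  unfolding test_functions_def
  using box_subset_cbox[of a b] by (auto simp: Ck_box_bump intro!: exI[of _ "cbox a b"] box_bump_eq_0)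

subsection \<open>Test functions\<close>

lemma test_function_Ck: "\<phi> \<in> test_functions \<Omega> \<Longrightarrow> Ck k \<phi>"
  by (auto simp: test_functions_def)

lemma test_function_continuous: "\<phi> \<in> test_functions \<Omega> \<Longrightarrow> continuous_on UNIV \<phi>"
  using test_function_Ck[of \<phi> \<Omega> 0] by simp

lemma test_function_has_derivative:
  "\<phi> \<in> test_functions \<Omega> \<Longrightarrow> (\<phi> has_derivative frechet_derivative \<phi> (at x)) (at x)"
  using Ck_Suc_has_derivative[OF test_function_Ck] .

lemma test_function_partial_continuous:
  "\<phi> \<in> test_functions \<Omega> \<Longrightarrow> i \<in> Basis \<Longrightarrow> continuous_on UNIV (\<lambda>x. frechet_derivative \<phi> (at x) i)"
  using test_function_Ck[of \<phi> \<Omega> 1] by simp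

lemma test_function_support:
  assumes "\<phi> \<in> test_functions \<Omega>"
  obtains K where "compact K" "K \<subseteq> \<Omega>" "\<And>x. x \<notin> K \<Longrightarrow> \<phi> x = 0" "\<And>x. x \<notin> K \<Longrightarrow> frechet_derivative \<phi> (at x) = (\<lambda>_. 0)"
proof -
  obtain K where K: "compact K" "K \<subseteq> \<Omega>" "\<And>x. x \<notin> K \<Longrightarrow> \<phi> x = 0"
    using assms by (auto simp: test_functions_def)
  have "frechet_derivative \<phi> (at x) = (\<lambda>_. 0)" if "x \<notin> K" for x
  proof -
    have "((\<lambda>_. 0) has_derivative (\<lambda>_. 0)) (at x)" by simp
    then have "(\<phi> has_derivative (\<lambda>_. 0)) (at x)"
      by (rule has_derivative_transform_within_open[of _ _ _ _ "- K"])
        (use K that compact_imp_closed in auto)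
    from frechet_derivative_at[OF this] show ?thesis by simp
  qed
  then show ?thesis using K that by blast
qed

lemma test_functions_linear:
  assumes "\<phi> \<in> test_functions \<Omega>" "\<psi> \<in> test_functions \<Omega>"
  shows "(\<lambda>x. \<phi> x + \<psi> x) \<in> test_functions \<Omega>" "(\<lambda>x. c * \<phi> x) \<in> test_functions \<Omega>"
    "(\<lambda>x. \<phi> x - \<psi> x) \<in> test_functions \<Omega>"
proof -
  obtain K where K: "compact K" "K \<subseteq> \<Omega>" "\<And>x. x \<notin> K \<Longrightarrow> \<phi> x = 0"
    using assms by (auto simp: test_functions_def)
  obtain K' where K': "compact K'" "K' \<subseteq> \<Omega>" "\<And>x. x \<notin> K' \<Longrightarrow> \<psi> x = 0"
    using assms by (auto simp: test_functions_def)
  show "(\<lambda>x. \<phi> x + \<psi> x) \<in> test_functions \<Omega>" "(\<lambda>x. \<phi> x - \<psi> x) \<in> test_functions \<Omega>"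
    using K K' assms unfolding test_functions_def
    by (auto intro!: Ck_add Ck_diff exI[of _ "K \<union> K'"])
  show "(\<lambda>x. c * \<phi> x) \<in> test_functions \<Omega>"
    using K assms unfolding test_functions_def by (auto intro!: Ck_cmult exI[of _ K])
qed

lemma compact_support_integrable:
  fixes f :: "'a::euclidean_space \<Rightarrow> 'b::{banach,second_countable_topology}"
  assumes "continuous_on UNIV f" "compact K" "\<And>x. x \<notin> K \<Longrightarrow> f x = 0"
  shows "integrable lborel f"
proof -
  have "integrable lborel (\<lambda>x. indicator K x *\<^sub>R f x)"
    by (rule borel_integrable_compact[OF assms(2)]) (rule continuous_on_subset[OF assms(1)], simp)
  then show ?thesis
    by (rule back_subst[where P="integrable lborel"]) (use assms(3) in \<open>auto simp: indicator_def\<close>)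
qed

text \<open>Translation invariance makes every difference quotient of \<open>F\<close> integrate to
  0, and dominated convergence carries this over to the derivative. Integration by parts is thereby
  obtained without iterated integrals.\<close>

lemma integral_directional_derivative_eq_0:
  fixes F :: "'a::euclidean_space \<Rightarrow> real"
  assumes F: "\<And>x. (F has_derivative F' x) (at x)"
    and cont: "continuous_on UNIV (\<lambda>x. F' x v)"
    and K: "compact K" "\<And>x. x \<notin> K \<Longrightarrow> F x = 0"
  shows "(LINT x|lborel. F' x v) = 0"
proof -
  have cF: "continuous_on UNIV F"
    using F by (auto intro!: continuous_at_imp_continuous_on has_derivative_continuous)
  have F'0: "F' x v = 0" if "x \<notin> K" for x
  proof -
    have "((\<lambda>_. 0) has_derivative (\<lambda>_. 0)) (at x)" by simp
    then have "(F has_derivative (\<lambda>_. 0)) (at x)"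
      by (rule has_derivative_transform_within_open[of _ _ _ _ "- K"])
        (use K that compact_imp_closed in auto)
    from has_derivative_unique[OF this F] show ?thesis by metis
  qed
  obtain R where R: "\<And>x. x \<in> K \<Longrightarrow> norm x \<le> R"
    using compact_imp_bounded[OF K(1)] by (auto simp: bounded_iff)
  obtain B0 where B0: "\<And>x. x \<in> K \<Longrightarrow> \<bar>F' x v\<bar> \<le> B0"
    using compact_imp_bounded[OF compact_continuous_image[OF continuous_on_subset[OF cont] K(1)]]
    by (auto simp: bounded_iff)
  define B where "B = max 0 B0"
  have B: "\<bar>F' x v\<bar> \<le> B" for x using B0[of x] F'0[of x] by (cases "x \<in> K") (auto simp: B_def)
  \<comment> \<open>Steps of length at most 1 keep the supports of all difference quotients inside a
    common ball.\<close>
  define h where "h = (\<lambda>n. inverse (real (Suc n)))"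
  have h: "0 < h n" "h n \<le> 1" for n by (auto simp: h_def inverse_le_1_iff)
  have h0: "h \<longlonglongrightarrow> 0" unfolding h_def by (rule LIMSEQ_inverse_real_of_nat)
  define D where "D = (\<lambda>n x. (F (x + h n *\<^sub>R v) - F x) / h n)"
  have path: "((\<lambda>s. F (x + s *\<^sub>R v)) has_real_derivative F' (x + s *\<^sub>R v) v) (at s)" for x s
  proof -
    have "((\<lambda>s. F (x + s *\<^sub>R v)) has_derivative (\<lambda>r. F' (x + s *\<^sub>R v) (r *\<^sub>R v))) (at s)"
      by (rule has_derivative_compose[OF _ F]) (auto intro!: derivative_eq_intros)
    moreover have "F' (x + s *\<^sub>R v) (r *\<^sub>R v) = F' (x + s *\<^sub>R v) v * r" for r
      using linear_cmul[OF has_derivative_linear[OF F]] by simp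
    ultimately show ?thesis by (simp add: has_field_derivative_def)
  qed
  have D_bound: "norm (D n x) \<le> B * indicator (cball 0 (R + norm v)) x" for n x
  proof (cases "norm x \<le> R + norm v")
    case True
    obtain s where "F (x + h n *\<^sub>R v) - F (x + 0 *\<^sub>R v) = (h n - 0) * F' (x + s *\<^sub>R v) v"
      using MVT2[OF h(1)[of n], of "\<lambda>s. F (x + s *\<^sub>R v)" "\<lambda>s. F' (x + s *\<^sub>R v) v"] path by auto
    then have "D n x = F' (x + s *\<^sub>R v) v" using h(1)[of n] by (simp add: D_def)
    then show ?thesis using B True by simp
  next
    case False
    have "norm x \<le> norm (x + h n *\<^sub>R v) + norm (h n *\<^sub>R v)" by (metis add_diff_cancel_right' norm_triangle_ineq4)
    also have "norm (h n *\<^sub>R v) \<le> norm v" using h[of n] by (simp add: mult_left_le_one_le)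
    finally have "R < norm (x + h n *\<^sub>R v)" "R < norm x" using False norm_ge_zero[of v] by linarith+
    then have "F (x + h n *\<^sub>R v) = 0" "F x = 0" using R K(2) by (meson not_le)+
    then show ?thesis by (simp add: D_def B_def)
  qed
  have intF: "integrable lborel F" by (rule compact_support_integrable[OF cF K]) 
  have [measurable]: "F \<in> borel_measurable borel" "(\<lambda>x. F' x v) \<in> borel_measurable borel"
    using cF cont by (auto intro: borel_measurable_continuous_onI)
  have intFt: "integrable lborel (\<lambda>x. F (w + x))" "(LINT x|lborel. F (w + x)) = (LINT x|lborel. F x)" for w
    using integral_distr[of "(+) w" lborel borel F] integrable_distr_eq[of "(+) w" lborel borel F] intF
    by (simp_all add: lborel_distr_plus)
  have "(\<lambda>n. LINT x|lborel. D n x) \<longlonglongrightarrow> (LINT x|lborel. F' x v)"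
  proof (rule integral_dominated_convergence[where w="\<lambda>x. B * indicator (cball 0 (R + norm v)) x"])
    show "integrable lborel (\<lambda>x. B * indicator (cball 0 (R + norm v)) x)"
      by (intro integrable_mult_right integrable_real_indicator) (auto intro: emeasure_bounded_finite[unfolded infinity_ennreal_def])
    show "AE x in lborel. (\<lambda>n. D n x) \<longlonglongrightarrow> F' x v"
    proof (rule AE_I2)
      fix x
      have "((\<lambda>s. (F (x + s *\<^sub>R v) - F x) / s) \<longlongrightarrow> F' x v) (at 0)"
        using path[of x 0] by (simp add: DERIV_def)
      moreover have "filterlim h (at 0) sequentially"
        using h0 h by (auto simp: filterlim_at less_imp_neq[symmetric])
      ultimately show "(\<lambda>n. D n x) \<longlonglongrightarrow> F' x v"
        unfolding D_def by (rule filterlim_compose)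
    qed
    show "AE x in lborel. norm (D n x) \<le> B * indicator (cball 0 (R + norm v)) x" for n
      using D_bound by auto
  qed (auto simp: D_def)
  moreover have "(LINT x|lborel. D n x) = 0" for n
    using intFt[of "h n *\<^sub>R v"] intF by (simp add: D_def add.commute)
  ultimately show ?thesis by (simp add: LIMSEQ_const_iff)
qed

subsection \<open>The Hilbert space of square integrable functions\<close>

lemma L2_inner_integrable:
  assumes "f \<in> L2 \<Omega>" "h \<in> L2 \<Omega>"
  shows "integrable (lebesgue_on \<Omega>) (\<lambda>x. f x \<bullet> h x)"
proof (rule Bochner_Integration.integrable_bound)
  have [measurable]: "f \<in> borel_measurable (lebesgue_on \<Omega>)" "h \<in> borel_measurable (lebesgue_on \<Omega>)"
    using assms by (auto simp: L2_def)
  show "(\<lambda>x. f x \<bullet> h x) \<in> borel_measurable (lebesgue_on \<Omega>)" by measurable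
  show "integrable (lebesgue_on \<Omega>) (\<lambda>x. (norm (f x))\<^sup>2 + (norm (h x))\<^sup>2)"
    using assms by (auto simp: L2_def)
  show "AE x in lebesgue_on \<Omega>. norm (f x \<bullet> h x) \<le> norm ((norm (f x))\<^sup>2 + (norm (h x))\<^sup>2)"
  proof (rule AE_I2)
    fix x
    have "\<bar>f x \<bullet> h x\<bar> \<le> norm (f x) * norm (h x)" by (rule Cauchy_Schwarz_ineq2)
    also have "\<dots> \<le> (norm (f x))\<^sup>2 + (norm (h x))\<^sup>2"
      using zero_le_power2[of "norm (f x) - norm (h x)"] zero_le_power2[of "norm (f x)"] zero_le_power2[of "norm (h x)"]
      unfolding power2_diff by linarith
    finally show "norm (f x \<bullet> h x) \<le> norm ((norm (f x))\<^sup>2 + (norm (h x))\<^sup>2)" by simp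
  qed
qed

lemma L2_add: 
  assumes "f \<in> L2 \<Omega>" "h \<in> L2 \<Omega>"
  shows "(\<lambda>x. f x + h x) \<in> L2 \<Omega>"
proof -
  have "(norm (f x + h x))\<^sup>2 = (norm (f x))\<^sup>2 + 2 * (f x \<bullet> h x) + (norm (h x))\<^sup>2" for x
    by (simp add: power2_norm_eq_inner inner_add inner_commute)
  then show ?thesis
    using assms L2_inner_integrable[OF assms] by (auto simp: L2_def)
qed

lemma L2_scaleR: "f \<in> L2 \<Omega> \<Longrightarrow> (\<lambda>x. c *\<^sub>R f x) \<in> L2 \<Omega>"
  by (auto simp: L2_def power_mult_distrib)

lemma L2_diff: "f \<in> L2 \<Omega> \<Longrightarrow> h \<in> L2 \<Omega> \<Longrightarrow> (\<lambda>x. f x - h x) \<in> L2 \<Omega>"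
  using L2_add[of f \<Omega> "\<lambda>x. (-1) *\<^sub>R h x"] L2_scaleR[of h \<Omega> "-1"] by simp

lemma L2_zero: "(\<lambda>x. 0) \<in> L2 \<Omega>"
  by (auto simp: L2_def)

text \<open>Square integrability is part of the relation, so \<open>l2_eq f f\<close> says exactly
  that \<open>f\<close> belongs to \<open>L2 UNIV\<close>. A type cannot depend on \<Omega>, hence
  the whole space as domain.\<close>

definition l2_eq :: "('a::euclidean_space \<Rightarrow> 'b::euclidean_space) \<Rightarrow> ('a \<Rightarrow> 'b) \<Rightarrow> bool" where
  "l2_eq f h \<longleftrightarrow> f \<in> L2 UNIV \<and> h \<in> L2 UNIV \<and> (AE x in lebesgue. f x = h x)"

quotient_type (overloaded) ('a, 'b) l2 = "'a::euclidean_space \<Rightarrow> 'b::euclidean_space" / partial: l2_eq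
proof (rule part_equivpI)
  show "\<exists>f :: 'a \<Rightarrow> 'b. l2_eq f f"
    by (rule exI[of _ "\<lambda>x. 0"]) (simp add: l2_eq_def L2_zero)
  show "symp (l2_eq :: ('a \<Rightarrow> 'b) \<Rightarrow> _)"
    by (auto simp: symp_def l2_eq_def elim: AE_mp)
  show "transp (l2_eq :: ('a \<Rightarrow> 'b) \<Rightarrow> _)"
    by (auto simp: transp_def l2_eq_def elim: AE_mp)
qed

instantiation l2 :: (euclidean_space, euclidean_space) real_vector
begin

lift_definition zero_l2 :: "('a, 'b) l2" is "\<lambda>x. 0"
  by (simp add: l2_eq_def L2_zero)

lift_definition plus_l2 :: "('a, 'b) l2 \<Rightarrow> ('a, 'b) l2 \<Rightarrow> ('a, 'b) l2" is "\<lambda>f h x. f x + h x"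
  by (auto simp: l2_eq_def L2_add)

lift_definition minus_l2 :: "('a, 'b) l2 \<Rightarrow> ('a, 'b) l2 \<Rightarrow> ('a, 'b) l2" is "\<lambda>f h x. f x - h x"
  by (auto simp: l2_eq_def L2_diff)

lift_definition scaleR_l2 :: "real \<Rightarrow> ('a, 'b) l2 \<Rightarrow> ('a, 'b) l2" is "\<lambda>c f x. c *\<^sub>R f x"
  by (auto simp: l2_eq_def L2_scaleR)

lift_definition uminus_l2 :: "('a, 'b) l2 \<Rightarrow> ('a, 'b) l2" is "\<lambda>f x. - f x"
  using L2_scaleR[of _ UNIV "-1"] by (auto simp: l2_eq_def)

instance
proof
  fix x y z :: "('a, 'b) l2" and c d :: real
  show "x + y + z = x + (y + z)" "x + y = y + x" "0 + x = x" "- x + x = 0" "x - y = x + - y"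
    by (transfer; use L2_scaleR[of _ UNIV "-1"] in \<open>auto simp: l2_eq_def L2_add L2_diff L2_zero algebra_simps\<close>)+
  show "c *\<^sub>R (x + y) = c *\<^sub>R x + c *\<^sub>R y" "(c + d) *\<^sub>R x = c *\<^sub>R x + d *\<^sub>R x"
    "c *\<^sub>R d *\<^sub>R x = (c * d) *\<^sub>R x" "1 *\<^sub>R x = x"
    by (transfer; auto simp: l2_eq_def L2_add L2_scaleR algebra_simps)+
qed

end

instantiation l2 :: (euclidean_space, euclidean_space) real_inner
begin

lift_definition inner_l2 :: "('a, 'b) l2 \<Rightarrow> ('a, 'b) l2 \<Rightarrow> real" is "L2_inner UNIV"
  unfolding l2_eq_def L2_inner_def lebesgue_on_UNIV_eq
  by (rule integral_cong_AE) (auto simp: L2_def lebesgue_on_UNIV_eq)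

definition norm_l2 :: "('a, 'b) l2 \<Rightarrow> real" where "norm_l2 x = sqrt (inner x x)"
definition dist_l2 :: "('a, 'b) l2 \<Rightarrow> ('a, 'b) l2 \<Rightarrow> real" where "dist_l2 x y = norm (x - y)"
definition sgn_l2 :: "('a, 'b) l2 \<Rightarrow> ('a, 'b) l2" where "sgn_l2 x = x /\<^sub>R norm x"
definition uniformity_l2 :: "(('a, 'b) l2 \<times> ('a, 'b) l2) filter" where
  "uniformity_l2 = (INF e\<in>{0<..}. principal {(x, y). dist x y < e})"
definition open_l2 :: "('a, 'b) l2 set \<Rightarrow> bool" where
  "open_l2 S = (\<forall>x\<in>S. \<forall>\<^sub>F (x', y) in uniformity. x' = x \<longrightarrow> y \<in> S)"

instance
proof
  fix x y z :: "('a, 'b) l2" and c :: real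
  show "dist x y = norm (x - y)" by (rule dist_l2_def)
  show "sgn x = x /\<^sub>R norm x" by (rule sgn_l2_def)
  show "uniformity = (INF e\<in>{0<..}. principal {(x, y). dist (x::('a, 'b) l2) y < e})" by (rule uniformity_l2_def)
  show "open S = (\<forall>x\<in>S. \<forall>\<^sub>F (x', y) in uniformity. x' = x \<longrightarrow> y \<in> S)" for S :: "('a, 'b) l2 set"
    by (rule open_l2_def)
  show "norm x = sqrt (x \<bullet> x)" by (rule norm_l2_def)
  show "x \<bullet> y = y \<bullet> x" by transfer (simp add: L2_inner_def inner_commute)
  show "(x + y) \<bullet> z = x \<bullet> z + y \<bullet> z"
    by transfer (simp add: l2_eq_def L2_inner_def inner_add L2_inner_integrable)
  show "(c *\<^sub>R x) \<bullet> y = c * (x \<bullet> y)"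
    by transfer (simp add: L2_inner_def)
  show "0 \<le> x \<bullet> x" by transfer (simp add: L2_inner_def)
  show "(x \<bullet> x = 0) = (x = 0)"
  proof transfer
    fix f :: "'a \<Rightarrow> 'b" assume f: "l2_eq f f"
    then have "(L2_inner UNIV f f = 0) = (AE x in lebesgue. f x \<bullet> f x = 0)"
      unfolding L2_inner_def lebesgue_on_UNIV_eq
      using L2_inner_integrable[of f UNIV f] by (intro integral_nonneg_eq_0_iff_AE) (auto simp: l2_eq_def lebesgue_on_UNIV_eq)
    then show "(L2_inner UNIV f f = 0) = l2_eq f (\<lambda>x. 0)"
      using f by (simp add: l2_eq_def L2_zero)
  qed
qed

end

text \<open>Extension by zero embeds the functions on \<Omega> isometrically into the one type
  \<open>l2\<close>, whatever \<Omega> is.\<close>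

definition to_l2 :: "'a::euclidean_space set \<Rightarrow> ('a \<Rightarrow> 'b::euclidean_space) \<Rightarrow> ('a, 'b) l2" where
  "to_l2 \<Omega> f = abs_l2 (\<lambda>x. indicator \<Omega> x *\<^sub>R f x)"

context
  fixes \<Omega> :: "'a::euclidean_space set"
  assumes \<Omega>: "\<Omega> \<in> sets lebesgue"
begin

lemma L2_extend:
  assumes "f \<in> L2 \<Omega>"
  shows "(\<lambda>x. indicator \<Omega> x *\<^sub>R f x) \<in> L2 UNIV"
proof -
  have "(norm (indicator \<Omega> x *\<^sub>R f x))\<^sup>2 = indicator \<Omega> x *\<^sub>R (norm (f x))\<^sup>2" for x
    by (simp add: indicator_def)
  then show ?thesis
    using assms \<Omega> unfolding L2_def lebesgue_on_UNIV_eq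
    by (simp add: integrable_restrict_space borel_measurable_restrict_space_iff)
qed

lemma l2_eq_extend:
  assumes "f \<in> L2 \<Omega>"
  shows "l2_eq (\<lambda>x. indicator \<Omega> x *\<^sub>R f x) (\<lambda>x. indicator \<Omega> x *\<^sub>R f x)"
  using L2_extend[OF assms] by (simp add: l2_eq_def)

lemma to_l2_eqI:
  assumes "f \<in> L2 \<Omega>" "h \<in> L2 \<Omega>" "AE x in lebesgue_on \<Omega>. f x = h x"
  shows "to_l2 \<Omega> f = to_l2 \<Omega> h"
proof -
  have "AE x in lebesgue. indicator \<Omega> x *\<^sub>R f x = indicator \<Omega> x *\<^sub>R h x"
    using assms(3) \<Omega> by (subst (asm) AE_restrict_space_iff) (auto simp: indicator_def elim: AE_mp)
  then have "l2_eq (\<lambda>x. indicator \<Omega> x *\<^sub>R f x) (\<lambda>x. indicator \<Omega> x *\<^sub>R h x)"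
    using L2_extend[OF assms(1)] L2_extend[OF assms(2)] by (simp add: l2_eq_def)
  then show ?thesis
    unfolding to_l2_def by (rule Quotient3_rel_abs[OF Quotient3_l2])
qed

lemma to_l2_inner:
  assumes "f \<in> L2 \<Omega>" "h \<in> L2 \<Omega>"
  shows "to_l2 \<Omega> f \<bullet> to_l2 \<Omega> h = L2_inner \<Omega> f h"
proof -
  have "to_l2 \<Omega> f \<bullet> to_l2 \<Omega> h = L2_inner UNIV (\<lambda>x. indicator \<Omega> x *\<^sub>R f x) (\<lambda>x. indicator \<Omega> x *\<^sub>R h x)"
    unfolding to_l2_def by (rule inner_l2.abs_eq) (intro l2_eq_extend assms)+
  also have "\<dots> = (LINT x|lebesgue. indicator \<Omega> x *\<^sub>R (f x \<bullet> h x))"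
    unfolding L2_inner_def lebesgue_on_UNIV_eq
    by (intro Bochner_Integration.integral_cong) (auto simp: indicator_def)
  also have "\<dots> = L2_inner \<Omega> f h"
    unfolding L2_inner_def using \<Omega> by (subst integral_restrict_space) auto
  finally show ?thesis .
qed

lemma to_l2_norm: "f \<in> L2 \<Omega> \<Longrightarrow> norm (to_l2 \<Omega> f) = L2_norm \<Omega> f"
  by (simp add: norm_eq_sqrt_inner to_l2_inner L2_inner_def L2_norm_def power2_norm_eq_inner)

lemma to_l2_add: "f \<in> L2 \<Omega> \<Longrightarrow> h \<in> L2 \<Omega> \<Longrightarrow> to_l2 \<Omega> (\<lambda>x. f x + h x) = to_l2 \<Omega> f + to_l2 \<Omega> h"
  unfolding to_l2_def by (subst plus_l2.abs_eq) (auto intro: l2_eq_extend simp: scaleR_add_right)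

lemma to_l2_diff: "f \<in> L2 \<Omega> \<Longrightarrow> h \<in> L2 \<Omega> \<Longrightarrow> to_l2 \<Omega> (\<lambda>x. f x - h x) = to_l2 \<Omega> f - to_l2 \<Omega> h"
  unfolding to_l2_def by (subst minus_l2.abs_eq) (auto intro: l2_eq_extend simp: scaleR_diff_right)

lemma to_l2_scaleR: "f \<in> L2 \<Omega> \<Longrightarrow> to_l2 \<Omega> (\<lambda>x. c *\<^sub>R f x) = c *\<^sub>R to_l2 \<Omega> f"
  unfolding to_l2_def by (subst scaleR_l2.abs_eq) (auto intro: l2_eq_extend simp: mult.commute)

end

subsection \<open>The fundamental lemma of the calculus of variations\<close>

lemma continuous_borel_measurable_lebesgue_on:
  fixes f :: "'a::euclidean_space \<Rightarrow> 'b::euclidean_space"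
  shows "continuous_on UNIV f \<Longrightarrow> f \<in> borel_measurable (lebesgue_on \<Omega>)"
  by (intro measurable_restrict_space1 measurable_completion) (simp add: borel_measurable_continuous_onI)

text \<open>The bumps of a box are test functions because the closed box lies in \<Omega>, and
  \<open>norm (f x)\<close> dominates the products with \<open>f\<close>.\<close>

lemma integral_box_eq_0:
  fixes f :: "'a::euclidean_space \<Rightarrow> real"
  assumes \<Omega>: "\<Omega> \<in> sets lebesgue" and f: "integrable (lebesgue_on \<Omega>) f"
    and 0: "\<And>\<phi>. \<phi> \<in> test_functions \<Omega> \<Longrightarrow> (LINT x|lebesgue_on \<Omega>. f x * \<phi> x) = 0"
    and ab: "cbox a b \<subseteq> \<Omega>"
  shows "(LINT x|lebesgue_on \<Omega>. f x * indicator (box a b) x) = 0"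
proof -
  have [measurable]: "f \<in> borel_measurable (lebesgue_on \<Omega>)" using f by auto
  have m: "box_bump a b k \<in> borel_measurable (lebesgue_on \<Omega>)" for k
    by (rule continuous_borel_measurable_lebesgue_on[OF Ck_continuous[OF Ck_box_bump]])
  have "(\<lambda>k. LINT x|lebesgue_on \<Omega>. f x * box_bump a b k x) \<longlonglongrightarrow> (LINT x|lebesgue_on \<Omega>. f x * indicator (box a b) x)"
  proof (rule integral_dominated_convergence[where w="\<lambda>x. norm (f x)"])
    show "AE x in lebesgue_on \<Omega>. (\<lambda>k. f x * box_bump a b k x) \<longlonglongrightarrow> f x * indicator (box a b) x"
      by (intro AE_I2 tendsto_intros box_bump_tendsto)
    show "AE x in lebesgue_on \<Omega>. norm (f x * box_bump a b k x) \<le> norm (f x)" for k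
      using box_bump_bounds[of a b k] by (auto simp: abs_mult intro!: mult_left_le)
    show "integrable (lebesgue_on \<Omega>) (\<lambda>x. norm (f x))" using f by simp
    have "box a b \<inter> \<Omega> \<in> sets (lebesgue_on \<Omega>)" using \<Omega> by (auto simp: sets_restrict_space_iff)
    then have "(\<lambda>x. indicator (box a b) x :: real) \<in> borel_measurable (lebesgue_on \<Omega>)"
      by (subst borel_measurable_indicator_iff) (simp add: Int_commute)
    then show "(\<lambda>x. f x * indicator (box a b) x) \<in> borel_measurable (lebesgue_on \<Omega>)" by measurable
    show "(\<lambda>x. f x * box_bump a b k x) \<in> borel_measurable (lebesgue_on \<Omega>)" for k
      using m[of k] by measurable
  qed
  then show ?thesis using 0[OF box_bump_test[OF ab]] by (simp add: LIMSEQ_const_iff)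
qed

text \<open>Integrals over boxes in \<Omega> vanish, and by Lebesgue's differentiation theorem the
  averages over shrinking cubes recover \<open>f\<close> almost everywhere.\<close>

lemma fundamental_lemma_variations:
  fixes f :: "'a::euclidean_space \<Rightarrow> real"
  assumes op: "open \<Omega>" and f: "integrable (lebesgue_on \<Omega>) f"
    and 0: "\<And>\<phi>. \<phi> \<in> test_functions \<Omega> \<Longrightarrow> (LINT x|lebesgue_on \<Omega>. f x * \<phi> x) = 0"
  shows "AE x in lebesgue_on \<Omega>. f x = 0"
proof -
  have \<Omega>: "\<Omega> \<in> sets lebesgue" using op by auto
  define F where "F = (\<lambda>x. indicator \<Omega> x *\<^sub>R f x)"
  have intF: "integrable lebesgue F"
    unfolding F_def using f \<Omega> by (subst (asm) integrable_restrict_space) auto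
  have FS: "set_integrable lebesgue S F" if "S \<in> sets lebesgue" for S
    unfolding set_integrable_def by (rule integrable_mult_indicator[OF that intF])
  have cbox0: "integral (cbox a b) F = 0" if "cbox a b \<subseteq> \<Omega>" for a b
  proof -
    have "integral (cbox a b) F = integral (box a b) F"
      by (simp add: integral_open_interval)
    also have "\<dots> = (LINT x:box a b|lebesgue. F x)"
      by (rule set_lebesgue_integral_eq_integral(2)[symmetric]) (auto intro!: FS)
    also have "\<dots> = (LINT x|lebesgue. indicator \<Omega> x *\<^sub>R (f x * indicator (box a b) x))"
      unfolding set_lebesgue_integral_def F_def
      by (intro Bochner_Integration.integral_cong) (auto simp: indicator_def)
    also have "\<dots> = (LINT x|lebesgue_on \<Omega>. f x * indicator (box a b) x)"
      using \<Omega> by (subst integral_restrict_space) auto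
    also have "\<dots> = 0" by (rule integral_box_eq_0[OF \<Omega> f 0 that])
    finally show ?thesis .
  qed
  have "F integrable_on cbox a b" for a b
    by (rule set_lebesgue_integral_eq_integral(1)) (auto intro!: FS)
  \<comment> \<open>Lebesgue's differentiation theorem for cubes with lower corner
    \<open>x\<close>.\<close>
  then obtain N where N: "negligible N"
    "\<And>x e. x \<notin> N \<Longrightarrow> 0 < e \<Longrightarrow> \<exists>d>0. \<forall>h. 0 < h \<and> h < d \<longrightarrow>
       norm (integral (cbox x (x + h *\<^sub>R One)) F /\<^sub>R h ^ DIM('a) - F x) < e"
    using integrable_ccontinuous_explicit[of F] by metis
  have f0: "f x = 0" if x: "x \<in> \<Omega>" "x \<notin> N" for x
  proof (rule ccontr)
    assume "f x \<noteq> 0"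
    then have "0 < norm (F x)" using x by (simp add: F_def)
    from N(2)[OF x(2) this] obtain d where d: "d > 0"
      "\<And>h. 0 < h \<Longrightarrow> h < d \<Longrightarrow> norm (integral (cbox x (x + h *\<^sub>R One)) F /\<^sub>R h ^ DIM('a) - F x) < norm (F x)"
      by blast
    obtain r where r: "0 < r" "ball x r \<subseteq> \<Omega>" using op x(1) openE by blast
    \<comment> \<open>A point of the cube differs from \<open>x\<close> by at most
      \<open>h * DIM('a)\<close> in the sum norm, so the cube stays in the ball of radius
      \<open>r\<close>.\<close>
    define h where "h = min (d / 2) (r / (2 * DIM('a)))"
    have h: "0 < h" "h < d" "h * DIM('a) < r"
      using d r by (auto simp: h_def min_def field_simps)
    have "cbox x (x + h *\<^sub>R One) \<subseteq> \<Omega>"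
    proof
      fix y assume y: "y \<in> cbox x (x + h *\<^sub>R One)"
      have "norm (y - x) \<le> (\<Sum>i\<in>Basis. \<bar>(y - x) \<bullet> i\<bar>)" by (rule norm_le_l1)
      also have "\<dots> \<le> (\<Sum>i\<in>(Basis::'a set). h)"
        using y by (intro sum_mono) (auto simp: mem_box inner_simps)
      also have "\<dots> < r" using h by (simp add: mult.commute)
      finally show "y \<in> \<Omega>" using r by (auto simp: dist_norm norm_minus_commute)
    qed
    then show False using d(2)[OF h(1,2)] cbox0 by simp
  qed
  have "N \<in> null_sets lebesgue" using N(1) by (simp add: negligible_iff_null_sets)
  then have "AE x in lebesgue. x \<in> \<Omega> \<longrightarrow> f x = 0"
    by (rule AE_I') (use f0 in auto)
  then show ?thesis using \<Omega> by (subst AE_restrict_space_iff) auto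
qed

subsection \<open>Weak gradients\<close>

definition test_grad :: "('a::euclidean_space \<Rightarrow> real) \<Rightarrow> 'a \<Rightarrow> 'a" where
  "test_grad \<phi> x = (\<Sum>i\<in>Basis. frechet_derivative \<phi> (at x) i *\<^sub>R i)"

lemma test_grad_inner: "i \<in> Basis \<Longrightarrow> test_grad \<phi> x \<bullet> i = frechet_derivative \<phi> (at x) i"
  by (simp add: test_grad_def inner_sum_left inner_Basis if_distrib cong: if_cong)

context
  fixes \<Omega> :: "'a::euclidean_space set"
  assumes open_\<Omega>: "open \<Omega>" and bounded_\<Omega>: "bounded \<Omega>"
begin

lemma \<Omega>_lebesgue: "\<Omega> \<in> sets lebesgue"
  using open_\<Omega> by auto

lemma L2_component: "f \<in> L2 \<Omega> \<Longrightarrow> (\<lambda>x. f x \<bullet> i) \<in> L2 \<Omega>" for f :: "'a \<Rightarrow> 'b::euclidean_space"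
proof -
  assume f: "f \<in> L2 \<Omega>"
  then have [measurable]: "f \<in> borel_measurable (lebesgue_on \<Omega>)" by (auto simp: L2_def)
  have "integrable (lebesgue_on \<Omega>) (\<lambda>x. (norm (f x \<bullet> i))\<^sup>2)"
  proof (rule Bochner_Integration.integrable_bound[of _ "\<lambda>x. (norm i)\<^sup>2 * (norm (f x))\<^sup>2"])
    show "AE x in lebesgue_on \<Omega>. norm ((norm (f x \<bullet> i))\<^sup>2) \<le> norm ((norm i)\<^sup>2 * (norm (f x))\<^sup>2)"
    proof (rule AE_I2)
      fix x
      show "norm ((norm (f x \<bullet> i))\<^sup>2) \<le> norm ((norm i)\<^sup>2 * (norm (f x))\<^sup>2)"
        using power_mono[OF Cauchy_Schwarz_ineq2[of "f x" i], of 2] by (simp add: power_mult_distrib mult.commute)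
    qed
  qed (use f in \<open>auto simp: L2_def\<close>)
  then show ?thesis by (auto simp: L2_def)
qed

lemma L2_bounded: 
  fixes f :: "'a \<Rightarrow> 'b::euclidean_space"
  assumes "continuous_on UNIV f" "\<And>x. norm (f x) \<le> B"
  shows "f \<in> L2 \<Omega>"
proof -
  interpret finite_measure "lebesgue_on \<Omega>"
    by (rule finite_measure_lebesgue_on[OF bounded_set_imp_lmeasurable[OF bounded_\<Omega> \<Omega>_lebesgue]])
  have [measurable]: "f \<in> borel_measurable (lebesgue_on \<Omega>)"
    by (rule continuous_borel_measurable_lebesgue_on[OF assms(1)])
  have "integrable (lebesgue_on \<Omega>) (\<lambda>x. (norm (f x))\<^sup>2)"
    by (rule integrable_const_bound[where B="B\<^sup>2"]) (use assms(2) in \<open>auto intro!: power_mono AE_I2\<close>)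
  then show ?thesis by (auto simp: L2_def)
qed

lemma L2_integrable:
  fixes f :: "'a \<Rightarrow> real"
  assumes "f \<in> L2 \<Omega>" 
  shows "integrable (lebesgue_on \<Omega>) f"
  using L2_inner_integrable[OF assms, of "\<lambda>x. 1"] L2_bounded[of "\<lambda>x. 1::real" 1] by simp

lemma compact_support_bounded:
  fixes f :: "'a \<Rightarrow> real"
  assumes "continuous_on UNIV f" "compact K" "\<And>x. x \<notin> K \<Longrightarrow> f x = 0"
  obtains B where "\<And>x. norm (f x) \<le> B"
proof -
  obtain B where B: "\<And>x. x \<in> K \<Longrightarrow> norm (f x) \<le> B"
    using compact_imp_bounded[OF compact_continuous_image[OF continuous_on_subset[OF assms(1)] assms(2)]]
    by (auto simp: bounded_iff)
  have "norm (f x) \<le> max 0 B" for x using B[of x] assms(3)[of x] by (cases "x \<in> K") auto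
  then show ?thesis by (rule that)
qed

lemma test_function_L2: "\<phi> \<in> test_functions \<Omega> \<Longrightarrow> \<phi> \<in> L2 \<Omega>"
  by (metis test_function_support compact_support_bounded test_function_continuous L2_bounded)

lemma test_function_partial_L2:
  "\<phi> \<in> test_functions \<Omega> \<Longrightarrow> i \<in> Basis \<Longrightarrow> (\<lambda>x. frechet_derivative \<phi> (at x) i) \<in> L2 \<Omega>"
  by (metis (mono_tags, lifting) test_function_support compact_support_bounded test_function_partial_continuous L2_bounded)

lemma integral_support_\<Omega>:
  fixes f :: "'a \<Rightarrow> real"
  assumes "continuous_on UNIV f" "\<And>x. x \<notin> \<Omega> \<Longrightarrow> f x = 0"
  shows "(LINT x|lebesgue_on \<Omega>. f x) = (LINT x|lborel. f x)"
proof -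
  have "(LINT x|lebesgue_on \<Omega>. f x) = (LINT x|lebesgue. indicator \<Omega> x *\<^sub>R f x)"
    using \<Omega>_lebesgue by (subst integral_restrict_space) auto
  also have "\<dots> = (LINT x|lebesgue. f x)"
    by (intro Bochner_Integration.integral_cong) (use assms(2) in \<open>auto simp: indicator_def\<close>)
  also have "\<dots> = (LINT x|lborel. f x)"
    by (rule integral_completion) (use assms(1) in \<open>auto intro: borel_measurable_continuous_onI\<close>)
  finally show ?thesis .
qed

lemma test_grad_L2: "\<phi> \<in> test_functions \<Omega> \<Longrightarrow> test_grad \<phi> \<in> L2 \<Omega>"
proof -
  assume \<phi>: "\<phi> \<in> test_functions \<Omega>"
  have "(\<lambda>x. \<Sum>i\<in>I. frechet_derivative \<phi> (at x) i *\<^sub>R i) \<in> L2 \<Omega>" if "I \<subseteq> Basis" "finite I" for I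
    using that(2,1)
  proof (induction I rule: finite_induct)
    case (insert i I)
    obtain B where "\<And>x. norm (frechet_derivative \<phi> (at x) i) \<le> B"
      using test_function_support[OF \<phi>] compact_support_bounded test_function_partial_continuous[OF \<phi>] insert.prems
      by (metis (mono_tags, lifting) insert_subset)
    then have "(\<lambda>x. frechet_derivative \<phi> (at x) i *\<^sub>R i) \<in> L2 \<Omega>"
      using insert.prems by (intro L2_bounded[of _ B] continuous_intros test_function_partial_continuous[OF \<phi>]) auto
    then show ?case using insert by (simp add: L2_add)
  qed (simp add: L2_zero)
  then show ?thesis unfolding test_grad_def[abs_def] by simp
qed

text \<open>The derivative of the compactly supported product \<open>\<phi> * \<psi>\<close>
  integrates to 0, which is the defining identity after the product rule.\<close>

lemma test_function_weak_gradient: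
  assumes \<phi>: "\<phi> \<in> test_functions \<Omega>"
  shows "has_weak_gradient \<Omega> \<phi> (test_grad \<phi>)"
  unfolding has_weak_gradient_def
proof (intro ballI)
  fix \<psi> i assume \<psi>: "\<psi> \<in> test_functions \<Omega>" and i: "i \<in> (Basis :: 'a set)"
  obtain K where K: "compact K" "K \<subseteq> \<Omega>" "\<And>x. x \<notin> K \<Longrightarrow> \<phi> x = 0" 
    using test_function_support[OF \<phi>] by metis
  let ?D = "\<lambda>x. \<phi> x * frechet_derivative \<psi> (at x) i + frechet_derivative \<phi> (at x) i * \<psi> x"
  have c: "continuous_on UNIV ?D"
    by (intro continuous_intros test_function_continuous[OF \<phi>] test_function_continuous[OF \<psi>] 
       test_function_partial_continuous[OF \<phi> i] test_function_partial_continuous[OF \<psi> i])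
  have "(LINT x|lborel. ?D x) = 0"
    by (rule integral_directional_derivative_eq_0[OF has_derivative_mult[OF test_function_has_derivative[OF \<phi>] test_function_has_derivative[OF \<psi>]] c K(1)])
      (use K in auto)
  moreover obtain K' where "K' \<subseteq> \<Omega>" "\<And>x. x \<notin> K' \<Longrightarrow> \<phi> x = 0" "\<And>x. x \<notin> K' \<Longrightarrow> frechet_derivative \<phi> (at x) = (\<lambda>_. 0)"
    using test_function_support[OF \<phi>] by metis
  ultimately have "(LINT x|lebesgue_on \<Omega>. ?D x) = 0"
    using integral_support_\<Omega>[OF c] by (metis (no_types, lifting) add.right_neutral mult_zero_left subsetD)
  moreover have "(LINT x|lebesgue_on \<Omega>. ?D x) = (LINT x|lebesgue_on \<Omega>. \<phi> x * frechet_derivative \<psi> (at x) i)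
      + (LINT x|lebesgue_on \<Omega>. frechet_derivative \<phi> (at x) i * \<psi> x)"
    using L2_inner_integrable[OF test_function_L2[OF \<phi>] test_function_partial_L2[OF \<psi> i]]
      L2_inner_integrable[OF test_function_partial_L2[OF \<phi> i] test_function_L2[OF \<psi>]]
    by (intro Bochner_Integration.integral_add) auto
  ultimately show "(LINT x|lebesgue_on \<Omega>. \<phi> x * frechet_derivative \<psi> (at x) i) = - (LINT x|lebesgue_on \<Omega>. test_grad \<phi> x \<bullet> i * \<psi> x)"
    using i by (simp add: test_grad_inner)
qed

text \<open>The fundamental lemma applies to each component of the difference. This makes the choice
  in \<open>grad\<close> harmless.\<close>

lemma weak_gradient_unique:
  assumes "has_weak_gradient \<Omega> w G" "has_weak_gradient \<Omega> w H" "G \<in> L2 \<Omega>" "H \<in> L2 \<Omega>"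
  shows "AE x in lebesgue_on \<Omega>. G x = H x"
proof -
  have "AE x in lebesgue_on \<Omega>. (G x - H x) \<bullet> i = 0" if i: "i \<in> Basis" for i
  proof (rule fundamental_lemma_variations[OF open_\<Omega>])
    have L: "(\<lambda>x. G x \<bullet> i) \<in> L2 \<Omega>" "(\<lambda>x. H x \<bullet> i) \<in> L2 \<Omega>" using assms L2_component by blast+
    show "integrable (lebesgue_on \<Omega>) (\<lambda>x. (G x - H x) \<bullet> i)"
      using L2_integrable[OF L(1)] L2_integrable[OF L(2)] by (simp add: inner_diff_left)
    fix \<phi> assume \<phi>: "\<phi> \<in> test_functions \<Omega>"
    have "(LINT x|lebesgue_on \<Omega>. (G x - H x) \<bullet> i * \<phi> x)
      = (LINT x|lebesgue_on \<Omega>. (G x \<bullet> i) * \<phi> x) - (LINT x|lebesgue_on \<Omega>. (H x \<bullet> i) * \<phi> x)"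
      using L2_inner_integrable[OF L(1) test_function_L2[OF \<phi>]] L2_inner_integrable[OF L(2) test_function_L2[OF \<phi>]]
      by (simp add: inner_diff_left left_diff_distrib)
    also have "\<dots> = 0"
      using assms(1,2)[unfolded has_weak_gradient_def, rule_format, OF \<phi> i] by simp
    finally show "(LINT x|lebesgue_on \<Omega>. (G x - H x) \<bullet> i * \<phi> x) = 0" .
  qed
  then have "AE x in lebesgue_on \<Omega>. \<forall>i\<in>Basis. (G x - H x) \<bullet> i = 0"
    by (simp add: AE_finite_all)
  then show ?thesis
    by eventually_elim (subst euclidean_eq_iff, simp add: inner_diff_left)
qed

lemma has_weak_gradient_linear:
  assumes w: "has_weak_gradient \<Omega> w G" "w \<in> L2 \<Omega>" "G \<in> L2 \<Omega>" and v: "has_weak_gradient \<Omega> v H" "v \<in> L2 \<Omega>" "H \<in> L2 \<Omega>"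
  shows "has_weak_gradient \<Omega> (\<lambda>x. c * w x + d * v x) (\<lambda>x. c *\<^sub>R G x + d *\<^sub>R H x)"
  unfolding has_weak_gradient_def
proof (intro ballI)
  fix \<psi> i assume \<psi>: "\<psi> \<in> test_functions \<Omega>" and i: "i \<in> (Basis :: 'a set)"
  note p = test_function_partial_L2[OF \<psi> i] and q = test_function_L2[OF \<psi>]
  have "(LINT x|lebesgue_on \<Omega>. (c * w x + d * v x) * frechet_derivative \<psi> (at x) i)
    = (LINT x|lebesgue_on \<Omega>. c * (w x * frechet_derivative \<psi> (at x) i) + d * (v x * frechet_derivative \<psi> (at x) i))"
    by (simp add: algebra_simps)
  also have "\<dots> = c * (LINT x|lebesgue_on \<Omega>. w x * frechet_derivative \<psi> (at x) i) + d * (LINT x|lebesgue_on \<Omega>. v x * frechet_derivative \<psi> (at x) i)"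
    using L2_inner_integrable[OF w(2) p] L2_inner_integrable[OF v(2) p] by simp
  also have "\<dots> = - (c * (LINT x|lebesgue_on \<Omega>. (G x \<bullet> i) * \<psi> x) + d * (LINT x|lebesgue_on \<Omega>. (H x \<bullet> i) * \<psi> x))"
    using w(1) v(1) \<psi> i by (simp add: has_weak_gradient_def)
  also have "\<dots> = - (LINT x|lebesgue_on \<Omega>. c * ((G x \<bullet> i) * \<psi> x) + d * ((H x \<bullet> i) * \<psi> x))"
    using L2_inner_integrable[OF L2_component[OF w(3)] q, of i] L2_inner_integrable[OF L2_component[OF v(3)] q, of i] by simp
  also have "\<dots> = - (LINT x|lebesgue_on \<Omega>. ((c *\<^sub>R G x + d *\<^sub>R H x) \<bullet> i) * \<psi> x)"
    by (simp add: algebra_simps inner_add_left)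
  finally show "(LINT x|lebesgue_on \<Omega>. (c * w x + d * v x) * frechet_derivative \<psi> (at x) i)
    = - (LINT x|lebesgue_on \<Omega>. ((c *\<^sub>R G x + d *\<^sub>R H x) \<bullet> i) * \<psi> x)" .
qed

section \<open>Sobolev functions and their gradients as elements of \<open>l2\<close>\<close>

lemma grad_weak_gradient: "w \<in> H1 \<Omega> \<Longrightarrow> grad \<Omega> w \<in> L2 \<Omega> \<and> has_weak_gradient \<Omega> w (grad \<Omega> w)"
  unfolding grad_def
  using someI_ex[of "\<lambda>G. G \<in> L2 \<Omega> \<and> has_weak_gradient \<Omega> w G"] by (auto simp: H1_def)

lemma grad_AE_eq:
  assumes "w \<in> L2 \<Omega>" "G \<in> L2 \<Omega>" "has_weak_gradient \<Omega> w G"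
  shows "w \<in> H1 \<Omega>" "AE x in lebesgue_on \<Omega>. grad \<Omega> w x = G x"
proof -
  show w: "w \<in> H1 \<Omega>" using assms by (auto simp: H1_def)
  show "AE x in lebesgue_on \<Omega>. grad \<Omega> w x = G x"
    using weak_gradient_unique grad_weak_gradient[OF w] assms by blast
qed

lemma H1_L2: "w \<in> H1 \<Omega> \<Longrightarrow> w \<in> L2 \<Omega>"
  by (simp add: H1_def)

definition l2_fun :: "('a \<Rightarrow> real) \<Rightarrow> ('a, real) l2" where "l2_fun w = to_l2 \<Omega> w"
definition l2_grad :: "('a \<Rightarrow> real) \<Rightarrow> ('a, 'a) l2" where "l2_grad w = to_l2 \<Omega> (grad \<Omega> w)"

text \<open>\<open>grad\<close> picks one of many functions that agree almost everywhere, so its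
  linearity is expressed after passing to classes; this is why the solution is described through
  \<open>l2_grad\<close>.\<close>

lemma H1_linear:
  assumes w: "w \<in> H1 \<Omega>" and v: "v \<in> H1 \<Omega>"
  shows "(\<lambda>x. c * w x + d * v x) \<in> H1 \<Omega>" "l2_grad (\<lambda>x. c * w x + d * v x) = c *\<^sub>R l2_grad w + d *\<^sub>R l2_grad v"
    "l2_fun (\<lambda>x. c * w x + d * v x) = c *\<^sub>R l2_fun w + d *\<^sub>R l2_fun v"
proof -
  note gw = grad_weak_gradient[OF w] and gv = grad_weak_gradient[OF v]
  note lw = H1_L2[OF w] and lv = H1_L2[OF v]
  have L: "(\<lambda>x. c * w x + d * v x) \<in> L2 \<Omega>" 
    using L2_add[OF L2_scaleR[OF lw, of c] L2_scaleR[OF lv, of d]] by simp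
  have LG: "(\<lambda>x. c *\<^sub>R grad \<Omega> w x + d *\<^sub>R grad \<Omega> v x) \<in> L2 \<Omega>"
    using gw gv by (intro L2_add L2_scaleR) auto
  have W: "has_weak_gradient \<Omega> (\<lambda>x. c * w x + d * v x) (\<lambda>x. c *\<^sub>R grad \<Omega> w x + d *\<^sub>R grad \<Omega> v x)"
    using gw gv lw lv by (intro has_weak_gradient_linear) auto
  show H: "(\<lambda>x. c * w x + d * v x) \<in> H1 \<Omega>" by (rule grad_AE_eq(1)[OF L LG W])
  have "l2_grad (\<lambda>x. c * w x + d * v x) = to_l2 \<Omega> (\<lambda>x. c *\<^sub>R grad \<Omega> w x + d *\<^sub>R grad \<Omega> v x)"
    unfolding l2_grad_def
    by (rule to_l2_eqI[OF \<Omega>_lebesgue _ LG grad_AE_eq(2)[OF L LG W]]) (use grad_weak_gradient[OF H] in auto)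
  also have "\<dots> = c *\<^sub>R l2_grad w + d *\<^sub>R l2_grad v"
    unfolding l2_grad_def using gw gv by (simp add: to_l2_add to_l2_scaleR L2_scaleR \<Omega>_lebesgue)
  finally show "l2_grad (\<lambda>x. c * w x + d * v x) = c *\<^sub>R l2_grad w + d *\<^sub>R l2_grad v" .
  show "l2_fun (\<lambda>x. c * w x + d * v x) = c *\<^sub>R l2_fun w + d *\<^sub>R l2_fun v"
    unfolding l2_fun_def using lw lv to_l2_add[OF \<Omega>_lebesgue L2_scaleR[OF lw, of c] L2_scaleR[OF lv, of d]]
      to_l2_scaleR[OF \<Omega>_lebesgue lw, of c] to_l2_scaleR[OF \<Omega>_lebesgue lv, of d] by simp
qed

lemma H1_diff:
  assumes "w \<in> H1 \<Omega>" "v \<in> H1 \<Omega>"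
  shows "(\<lambda>x. w x - v x) \<in> H1 \<Omega>" "l2_grad (\<lambda>x. w x - v x) = l2_grad w - l2_grad v" "l2_fun (\<lambda>x. w x - v x) = l2_fun w - l2_fun v"
  using H1_linear[OF assms, of 1 "-1"] by simp_all

lemma H1_cmult:
  assumes "w \<in> H1 \<Omega>"
  shows "(\<lambda>x. c * w x) \<in> H1 \<Omega>" "l2_grad (\<lambda>x. c * w x) = c *\<^sub>R l2_grad w" "l2_fun (\<lambda>x. c * w x) = c *\<^sub>R l2_fun w"
  using H1_linear[OF assms assms, of c 0] by simp_all

lemma H1_norm_eq: "w \<in> H1 \<Omega> \<Longrightarrow> H1_norm \<Omega> w = sqrt ((norm (l2_fun w))\<^sup>2 + (norm (l2_grad w))\<^sup>2)"
  using grad_weak_gradient[of w] H1_L2[of w] by (simp add: H1_norm_def l2_fun_def l2_grad_def to_l2_norm \<Omega>_lebesgue)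

lemma norm_l2_grad_le: "w \<in> H1 \<Omega> \<Longrightarrow> norm (l2_grad w) \<le> H1_norm \<Omega> w"
  and norm_l2_fun_le: "w \<in> H1 \<Omega> \<Longrightarrow> norm (l2_fun w) \<le> H1_norm \<Omega> w"
  by (auto simp: H1_norm_eq intro: real_le_rsqrt)

lemma test_function_H1: "\<phi> \<in> test_functions \<Omega> \<Longrightarrow> \<phi> \<in> H1 \<Omega>"
  by (auto simp: H1_def test_function_L2 intro!: bexI[of _ "test_grad \<phi>"] test_grad_L2 test_function_weak_gradient)

lemma l2_grad_test_function: "\<phi> \<in> test_functions \<Omega> \<Longrightarrow> l2_grad \<phi> = to_l2 \<Omega> (test_grad \<phi>)"
  unfolding l2_grad_def
  by (rule to_l2_eqI[OF \<Omega>_lebesgue])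
    (use grad_weak_gradient[OF test_function_H1] in \<open>auto intro!: test_grad_L2 grad_AE_eq(2) test_function_weak_gradient test_function_L2\<close>)

text \<open>On \<open>H1\<close> the norm is the product norm of the pair
  \<open>(l2_fun w, l2_grad w)\<close>, whose triangle inequality is inherited.\<close>

lemma H1_norm_triangle:
  assumes "w \<in> H1 \<Omega>" "v \<in> H1 \<Omega>"
  shows "H1_norm \<Omega> (\<lambda>x. w x - v x) \<le> H1_norm \<Omega> w + H1_norm \<Omega> v"
proof -
  have "H1_norm \<Omega> (\<lambda>x. w x - v x) = norm ((l2_fun w, l2_grad w) - (l2_fun v, l2_grad v))"
    using assms by (simp add: H1_norm_eq H1_diff norm_Pair)
  also have "\<dots> \<le> norm (l2_fun w, l2_grad w) + norm (l2_fun v, l2_grad v)" by (rule norm_triangle_ineq4)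
  finally show ?thesis using assms by (simp add: H1_norm_eq norm_Pair)
qed

section \<open>The space \<open>H1_0\<close> and the Poincare inequality\<close>

lemma H1_0_H1: "w \<in> H1_0 \<Omega> \<Longrightarrow> w \<in> H1 \<Omega>"
  by (simp add: H1_0_def)

lemma H1_0_approx: "w \<in> H1_0 \<Omega> \<Longrightarrow> 0 < e \<Longrightarrow> \<exists>\<phi>\<in>test_functions \<Omega>. H1_norm \<Omega> (\<lambda>x. w x - \<phi> x) < e"
  by (simp add: H1_0_def)

lemma H1_0_diff:
  assumes w: "w \<in> H1_0 \<Omega>" and v: "v \<in> H1_0 \<Omega>"
  shows "(\<lambda>x. w x - v x) \<in> H1_0 \<Omega>"
  unfolding H1_0_def
proof (intro CollectI conjI allI impI)
  note hw = H1_0_H1[OF w] and hv = H1_0_H1[OF v]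
  show "(\<lambda>x. w x - v x) \<in> H1 \<Omega>" by (rule H1_diff(1)[OF hw hv])
  fix e :: real assume e: "0 < e"
  obtain \<phi> \<psi> where \<phi>: "\<phi> \<in> test_functions \<Omega>" "H1_norm \<Omega> (\<lambda>x. w x - \<phi> x) < e/2"
    and \<psi>: "\<psi> \<in> test_functions \<Omega>" "H1_norm \<Omega> (\<lambda>x. v x - \<psi> x) < e/2"
    using H1_0_approx[OF w, of "e/2"] H1_0_approx[OF v, of "e/2"] e by auto
  have "H1_norm \<Omega> (\<lambda>x. (w x - v x) - (\<phi> x - \<psi> x)) = H1_norm \<Omega> (\<lambda>x. (w x - \<phi> x) - (v x - \<psi> x))"
    by (simp add: algebra_simps)
  also have "\<dots> \<le> H1_norm \<Omega> (\<lambda>x. w x - \<phi> x) + H1_norm \<Omega> (\<lambda>x. v x - \<psi> x)"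
    by (intro H1_norm_triangle H1_diff hw hv test_function_H1 \<phi> \<psi>)
  also have "\<dots> < e" using \<phi> \<psi> by simp
  finally show "\<exists>\<phi>\<in>test_functions \<Omega>. H1_norm \<Omega> (\<lambda>x. (w x - v x) - \<phi> x) < e"
    using test_functions_linear(3)[OF \<phi>(1) \<psi>(1)] by (intro bexI[of _ "\<lambda>x. \<phi> x - \<psi> x"])
qed

lemma H1_norm_cmult: "w \<in> H1 \<Omega> \<Longrightarrow> H1_norm \<Omega> (\<lambda>x. c * w x) = \<bar>c\<bar> * H1_norm \<Omega> w"
  by (simp add: H1_norm_eq H1_cmult power_mult_distrib real_sqrt_mult flip: distrib_left)

lemma H1_0_cmult:
  assumes w: "w \<in> H1_0 \<Omega>"
  shows "(\<lambda>x. c * w x) \<in> H1_0 \<Omega>"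
  unfolding H1_0_def
proof (intro CollectI conjI allI impI)
  note hw = H1_0_H1[OF w]
  show "(\<lambda>x. c * w x) \<in> H1 \<Omega>" by (rule H1_cmult(1)[OF hw])
  fix e :: real assume e: "0 < e"
  \<comment> \<open>The added 1 covers the case \<open>c = 0\<close> and makes the final inequality
    strict.\<close>
  obtain \<phi> where \<phi>: "\<phi> \<in> test_functions \<Omega>" "H1_norm \<Omega> (\<lambda>x. w x - \<phi> x) < e / (\<bar>c\<bar> + 1)"
    using H1_0_approx[OF w, of "e / (\<bar>c\<bar> + 1)"] e by (auto simp: add_nonneg_pos)
  have "H1_norm \<Omega> (\<lambda>x. c * w x - c * \<phi> x) = \<bar>c\<bar> * H1_norm \<Omega> (\<lambda>x. w x - \<phi> x)"
    using H1_norm_cmult[OF H1_diff(1)[OF hw test_function_H1[OF \<phi>(1)]], of c] by (simp add: algebra_simps)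
  also have "\<dots> \<le> \<bar>c\<bar> * (e / (\<bar>c\<bar> + 1))" using \<phi> by (intro mult_left_mono) auto
  also have "\<dots> < e" using e by (simp add: field_simps)
  finally show "\<exists>\<phi>\<in>test_functions \<Omega>. H1_norm \<Omega> (\<lambda>x. c * w x - \<phi> x) < e"
    using test_functions_linear(2)[OF \<phi>(1) \<phi>(1), of c] by (intro bexI[of _ "\<lambda>x. c * \<phi> x"])
qed

text \<open>For test functions this is the identity \<open>\<integral> \<phi>\<^sup>2 = - 2 \<integral> x\<^sub>i \<phi> \<partial>\<^sub>i \<phi>\<close>.\<close>

lemma poincare_inequality:
  obtains C where "0 < C" "\<And>w. w \<in> H1_0 \<Omega> \<Longrightarrow> norm (l2_fun w) \<le> C * norm (l2_grad w)"
proof -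
  obtain i :: 'a where i: "i \<in> Basis" using nonempty_Basis by blast
  obtain R where R: "\<And>x. x \<in> \<Omega> \<Longrightarrow> norm x \<le> R" using bounded_\<Omega> by (auto simp: bounded_iff)
  \<comment> \<open>Twice \<open>R\<close> bounds \<open>2 * \<bar>x \<bullet> i\<bar>\<close> on
    \<Omega>; the maximum makes \<open>C\<close> positive whatever \<open>R\<close> is.\<close>
  define C where "C = 2 * max 1 R"
  have C: "0 < C" by (simp add: C_def)
  have test: "norm (l2_fun \<phi>) \<le> C * norm (l2_grad \<phi>)" if \<phi>: "\<phi> \<in> test_functions \<Omega>" for \<phi>
  proof -
    obtain K where K: "compact K" "K \<subseteq> \<Omega>" "\<And>x. x \<notin> K \<Longrightarrow> \<phi> x = 0" 
      using test_function_support[OF \<phi>] by metis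
    define D where "D = (\<lambda>x. frechet_derivative \<phi> (at x) i)"
    note L = test_function_L2[OF \<phi>] and LD = test_grad_L2[OF \<phi>]
    have cD: "continuous_on UNIV D" unfolding D_def by (rule test_function_partial_continuous[OF \<phi> i])
    have c\<phi>: "continuous_on UNIV \<phi>" by (rule test_function_continuous[OF \<phi>])
    let ?d = "\<lambda>x. (\<phi> x)\<^sup>2 + 2 * (x \<bullet> i) * \<phi> x * D x"
    have cd: "continuous_on UNIV ?d" by (intro continuous_intros c\<phi> cD)
    have "(LINT x|lborel. ?d x) = 0"
    proof -
      have der: "((\<lambda>x. (x \<bullet> i) * (\<phi> x * \<phi> x)) has_derivative
         (\<lambda>h. (x \<bullet> i) * (\<phi> x * frechet_derivative \<phi> (at x) h + frechet_derivative \<phi> (at x) h * \<phi> x) + (h \<bullet> i) * (\<phi> x * \<phi> x))) (at x)" for x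
        by (intro derivative_intros test_function_has_derivative[OF \<phi>])
      have eq: "(x \<bullet> i) * (\<phi> x * frechet_derivative \<phi> (at x) i + frechet_derivative \<phi> (at x) i * \<phi> x) + (i \<bullet> i) * (\<phi> x * \<phi> x) = ?d x" for x
        using i by (simp add: D_def power2_eq_square algebra_simps)
      show ?thesis
        using integral_directional_derivative_eq_0[OF der, where v=i and K=K, unfolded eq, OF cd K(1)] K(3) by simp
    qed
    then have int0: "(LINT x|lebesgue_on \<Omega>. ?d x) = 0"
      using integral_support_\<Omega>[OF cd] K by (metis (no_types, lifting) add.right_neutral mult_zero_left mult_zero_right power_zero_numeral subsetD)
    have int_p: "integrable (lebesgue_on \<Omega>) (\<lambda>x. (\<phi> x)\<^sup>2)"
      using L2_inner_integrable[OF L L] by (simp add: power2_eq_square)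
    have int_g: "integrable (lebesgue_on \<Omega>) (\<lambda>x. (norm (test_grad \<phi> x))\<^sup>2)"
      using LD by (simp add: L2_def)
    have int_d: "integrable (lebesgue_on \<Omega>) ?d"
    proof -
      obtain B where "\<And>x. norm (?d x) \<le> B"
        using compact_support_bounded[OF cd K(1)] K(3) by auto
      then show ?thesis using L2_integrable[OF L2_bounded[OF cd]] by blast
    qed
    \<comment> \<open>Young: \<open>2 x\<^sub>i \<phi> D \<ge> - \<phi>\<^sup>2/2 - 2 R\<^sup>2 D\<^sup>2\<close>\<close>
    have "0 \<ge> (LINT x|lebesgue_on \<Omega>. (\<phi> x)\<^sup>2 / 2 - C\<^sup>2 / 2 * (norm (test_grad \<phi> x))\<^sup>2)"
      unfolding int0[symmetric]
    proof (rule integral_mono)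
      fix x assume "x \<in> space (lebesgue_on \<Omega>)"
      then have x: "x \<in> \<Omega>" using \<Omega>_lebesgue by (simp add: space_restrict_space)
      have "\<bar>D x\<bar> \<le> norm (test_grad \<phi> x)"
        using Basis_le_norm[OF i, of "test_grad \<phi> x"] i by (simp add: test_grad_inner D_def)
      moreover have "2 * \<bar>x \<bullet> i\<bar> \<le> C" using Basis_le_norm[OF i, of x] R[OF x] by (simp add: C_def)
      ultimately have "2 * \<bar>x \<bullet> i\<bar> * \<bar>D x\<bar> \<le> C * norm (test_grad \<phi> x)" using C by (intro mult_mono) auto
      then have "(2 * \<bar>x \<bullet> i\<bar> * \<bar>D x\<bar>)\<^sup>2 \<le> (C * norm (test_grad \<phi> x))\<^sup>2" by (intro power_mono) auto
      then have 1: "(2 * (x \<bullet> i) * D x)\<^sup>2 \<le> C\<^sup>2 * (norm (test_grad \<phi> x))\<^sup>2" by (simp add: power_mult_distrib)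
      have "0 \<le> (\<phi> x + 2 * (x \<bullet> i) * D x)\<^sup>2" by simp
      then have "- ((\<phi> x)\<^sup>2 + (2 * (x \<bullet> i) * D x)\<^sup>2) / 2 \<le> 2 * (x \<bullet> i) * \<phi> x * D x"
        by (simp add: power2_sum algebra_simps)
      then show "(\<phi> x)\<^sup>2 / 2 - C\<^sup>2 / 2 * (norm (test_grad \<phi> x))\<^sup>2 \<le> ?d x" using 1 by simp
    qed (use int_p int_g int_d in auto)
    then have "(LINT x|lebesgue_on \<Omega>. (\<phi> x)\<^sup>2) \<le> C\<^sup>2 * (LINT x|lebesgue_on \<Omega>. (norm (test_grad \<phi> x))\<^sup>2)"
      using int_p int_g by simp
    then have "(norm (l2_fun \<phi>))\<^sup>2 \<le> (C * norm (l2_grad \<phi>))\<^sup>2"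
      using L LD by (simp add: l2_fun_def l2_grad_test_function[OF \<phi>] to_l2_norm \<Omega>_lebesgue L2_norm_def power_mult_distrib)
    then show ?thesis using C by (simp add: power2_le_iff_abs_le)
  qed
  \<comment> \<open>Both sides are continuous in the \<open>H1\<close> norm, so the density of test
    functions carries the inequality over. An error of \<open>e / (1 + C)\<close> enters once with
    factor 1 and once with factor \<open>C\<close>.\<close>
  have "norm (l2_fun w) \<le> C * norm (l2_grad w)" if w: "w \<in> H1_0 \<Omega>" for w
  proof (rule field_le_epsilon)
    fix e :: real assume e: "0 < e"
    note hw = H1_0_H1[OF w]
    obtain \<phi> where \<phi>: "\<phi> \<in> test_functions \<Omega>" "H1_norm \<Omega> (\<lambda>x. w x - \<phi> x) < e / (1 + C)"
      using H1_0_approx[OF w, of "e / (1 + C)"] e C by auto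
    note h = H1_diff[OF hw test_function_H1[OF \<phi>(1)]]
    have d: "norm (l2_fun w - l2_fun \<phi>) \<le> e / (1 + C)" "norm (l2_grad w - l2_grad \<phi>) \<le> e / (1 + C)"
      using norm_l2_fun_le[OF h(1)] norm_l2_grad_le[OF h(1)] \<phi>(2) h by auto
    have "norm (l2_fun w) \<le> norm (l2_fun w - l2_fun \<phi>) + norm (l2_fun \<phi>)" by (metis diff_add_cancel norm_triangle_ineq)
    also have "\<dots> \<le> e / (1 + C) + C * norm (l2_grad \<phi>)" using d test[OF \<phi>(1)] by simp
    also have "norm (l2_grad \<phi>) \<le> norm (l2_grad w) + norm (l2_grad w - l2_grad \<phi>)" by (metis norm_minus_commute norm_triangle_sub add.commute)
    also have "\<dots> \<le> norm (l2_grad w) + e / (1 + C)" using d by simp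
    finally have "norm (l2_fun w) \<le> e / (1 + C) + C * (norm (l2_grad w) + e / (1 + C))" using C by simp
    also have "\<dots> = C * norm (l2_grad w) + (1 + C) * (e / (1 + C))"
      by (simp only: distrib_left distrib_right)
    also have "\<dots> = C * norm (l2_grad w) + e" using C by simp
    finally show "norm (l2_fun w) \<le> C * norm (l2_grad w) + e" .
  qed
  then show ?thesis using that C by blast
qed

end

subsection \<open>Testing in time\<close>

text \<open>The solution concept integrates over \<open>{0..T}\<close>, the lemmas on weak
  derivatives over open and possibly shorter intervals; this moves an integrand between them when it
  vanishes outside their intersection.\<close>

lemma LINT_support_cong:
  fixes f :: "'a::euclidean_space \<Rightarrow> real"
  assumes "S \<in> sets lebesgue" "S' \<in> sets lebesgue" "\<And>x. x \<notin> S \<inter> S' \<Longrightarrow> f x = 0"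
  shows "(LINT x|lebesgue_on S. f x) = (LINT x|lebesgue_on S'. f x)"
proof -
  have "(LINT x|lebesgue_on S. f x) = (LINT x|lebesgue. f x)" if "S \<in> sets lebesgue" "\<And>x. x \<notin> S \<Longrightarrow> f x = 0" for S
  proof -
    have "(\<lambda>x. indicator S x *\<^sub>R f x) = f" using that(2) by (auto simp: indicator_def fun_eq_iff)
    then show ?thesis using that(1) integral_restrict_space[of S lebesgue f] by simp
  qed
  then show ?thesis using assms by simp
qed

lemma deriv_eq_frechet: "f differentiable (at x) \<Longrightarrow> deriv f x = frechet_derivative f (at x) 1" for f :: "real \<Rightarrow> real"
proof -
  assume f: "f differentiable (at x)"
  then have "(f has_real_derivative deriv f x) (at x)"
    using DERIV_deriv_iff_real_differentiable by blast
  from frechet_derivative_at[OF this[unfolded has_field_derivative_def]] show ?thesis by (metis mult_1_right)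
qed

lemma test_function_DERIV:
  fixes \<phi> :: "real \<Rightarrow> real"
  assumes "\<phi> \<in> test_functions S"
  shows "(\<phi> has_real_derivative deriv \<phi> t) (at t)" "deriv \<phi> t = frechet_derivative \<phi> (at t) 1"
    "continuous_on UNIV (deriv \<phi>)"
proof -
  have d: "\<phi> differentiable (at t)" for t
    using test_function_has_derivative[OF assms] by (auto simp: differentiable_def)
  then show "(\<phi> has_real_derivative deriv \<phi> t) (at t)" "deriv \<phi> t = frechet_derivative \<phi> (at t) 1"
    using DERIV_deriv_iff_real_differentiable deriv_eq_frechet by blast+
  have "deriv \<phi> = (\<lambda>t. frechet_derivative \<phi> (at t) 1)" using deriv_eq_frechet[OF d] by blast
  then show "continuous_on UNIV (deriv \<phi>)" using test_function_partial_continuous[OF assms, of 1] by simp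
qed

lemma test_function_outside:
  fixes \<phi> :: "real \<Rightarrow> real"
  assumes "\<phi> \<in> test_functions S" "t \<notin> S"
  shows "\<phi> t = 0" "deriv \<phi> t = 0"
  using test_function_support[OF assms(1)] assms(2) test_function_DERIV(2)[OF assms(1)] by (metis subsetD)+

lemma test_functions_mono: "S \<subseteq> S' \<Longrightarrow> test_functions S \<subseteq> test_functions S'"
  unfolding test_functions_def by blast

lemma test_function_parts:
  fixes \<phi> \<psi> :: "real \<Rightarrow> real"
  assumes "\<phi> \<in> test_functions {a<..<b}" "\<psi> \<in> test_functions {a<..<b}"
  shows "(LINT t|lebesgue_on {a<..<b}. \<phi> t * deriv \<psi> t) = - (LINT t|lebesgue_on {a<..<b}. deriv \<phi> t * \<psi> t)"
  using test_function_weak_gradient[where \<Omega>="{a<..<b}" and \<phi>=\<phi>] assms test_grad_inner[where i=1 and \<phi>=\<phi>]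
  by (simp add: has_weak_gradient_def test_function_DERIV(2)[OF assms(1)] test_function_DERIV(2)[OF assms(2)])

section \<open>Weak derivatives of continuous functions of one variable\<close>

lemma continuous_AE_eq_0:
  fixes f :: "'a::euclidean_space \<Rightarrow> real"
  assumes "open S" "continuous_on S f" "AE x in lebesgue_on S. f x = 0" "x \<in> S"
  shows "f x = 0"
proof (rule ccontr)
  assume x: "f x \<noteq> 0"
  have S: "S \<in> sets lebesgue" using assms(1) by auto
  have "open (S \<inter> f -` (- {0}))"
    by (rule continuous_open_preimage[OF assms(2,1)]) auto
  moreover have "negligible (S \<inter> f -` (- {0}))"
  proof -
    have "AE x in lebesgue. x \<in> S \<longrightarrow> f x = 0" using assms(3) S by (subst (asm) AE_restrict_space_iff) auto
    then obtain N where N: "N \<in> null_sets lebesgue" "{x \<in> space lebesgue. \<not> (x \<in> S \<longrightarrow> f x = 0)} \<subseteq> N"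
      unfolding eventually_ae_filter by (elim bexE)
    from N(1) have "negligible N" by (simp only: negligible_iff_null_sets)
    then show ?thesis by (rule negligible_subset) (use N(2) in auto)
  qed
  ultimately have "S \<inter> f -` (- {0}) = {}" using open_not_negligible by blast
  then show False using x assms(4) by auto
qed

lemma continuous_integrable_Ioo:
  fixes f :: "real \<Rightarrow> real"
  assumes "continuous_on {a..b} f"
  shows "integrable (lebesgue_on {a<..<b}) f"
proof -
  have "set_integrable lebesgue {a..b} f"
    using continuous_imp_integrable_real[OF assms] by (simp add: set_integrable_def integrable_restrict_space)
  then have "set_integrable lebesgue {a<..<b} f" by (rule set_integrable_subset) auto
  then show ?thesis by (simp add: set_integrable_def integrable_restrict_space)
qed

text \<open>The primitive vanishes to the left of the support and, because the total integral is 0,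
  also to its right; this is what makes its support compact.\<close>

lemma antiderivative_test_function:
  fixes h :: "real \<Rightarrow> real"
  assumes h: "h \<in> test_functions {a<..<b}" and 0: "(LINT t|lebesgue_on {a<..<b}. h t) = 0"
  obtains \<phi> where "\<phi> \<in> test_functions {a<..<b}" "deriv \<phi> = h"
proof -
  obtain K where K: "compact K" "K \<subseteq> {a<..<b}" "\<And>x. x \<notin> K \<Longrightarrow> h x = 0"
    using test_function_support[OF h] by metis
  have ch: "continuous_on S h" for S
    using test_function_continuous[OF h] continuous_on_subset by blast
  show ?thesis
  proof (cases "K = {}")
    case True
    then have "h = (\<lambda>_. 0)" using K by auto
    moreover have "(\<lambda>_. 0) \<in> test_functions {a<..<b}"
      by (auto simp: test_functions_def Ck_const intro!: exI[of _ "{}"])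
    ultimately show ?thesis using that[of "\<lambda>_. 0"] by (auto simp: fun_eq_iff)
  next
    case False
    define c where "c = Inf K" 
    define d where "d = Sup K"
    have cd: "c \<in> K" "d \<in> K" unfolding c_def d_def
      using K(1) False by (auto intro!: closed_contains_Inf closed_contains_Sup compact_imp_closed bounded_imp_bdd_below bounded_imp_bdd_above compact_imp_bounded)
    have Kcd: "K \<subseteq> {c..d}" unfolding c_def d_def
      using K(1) by (auto intro!: cInf_lower cSup_upper bounded_imp_bdd_below bounded_imp_bdd_above compact_imp_bounded)
    have ab: "a < c" "d < b" using cd K by auto
    define \<phi> where "\<phi> = (\<lambda>t. integral {a..t} h)"
    have h0: "h x = 0" if "x < c \<or> d < x" for x using Kcd that by (intro K(3)) force
    have \<phi>l: "\<phi> t = 0" if "t < c" for t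
    proof -
      have "integral {a..t} h = integral {a..t} (\<lambda>_. 0)"
        using that h0 by (intro Henstock_Kurzweil_Integration.integral_cong) auto
      then show ?thesis by (simp add: \<phi>_def)
    qed
    have \<phi>r: "\<phi> t = 0" if "d < t" for t
    proof -
      have "(LINT t|lebesgue_on {a<..<b}. h t) = (LINT x|lebesgue_on {a..t}. h x)"
        by (rule LINT_support_cong) (use Kcd ab that K(3) in \<open>auto intro!: h0\<close>)
      also have "\<dots> = integral {a..t} h"
        by (rule lebesgue_integral_eq_integral) (auto intro: continuous_imp_integrable_real ch)
      finally show ?thesis using 0 by (simp add: \<phi>_def)
    qed
    have D: "(\<phi> has_real_derivative h t) (at t)" for t
    proof (cases "t < c")
      case True
      have "((\<lambda>_. 0) has_real_derivative 0) (at t)" by simp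
      then have "(\<phi> has_real_derivative 0) (at t)"
        by (rule has_field_derivative_transform_within_open[of _ _ _ "{..<c}"]) (use True \<phi>l in auto)
      then show ?thesis using h0 True by simp
    next
      case False
      then show ?thesis unfolding \<phi>_def
        using integral_upper_has_real_derivative[of "a - 1" h a t] ch ab by simp
    qed
    have "Ck k \<phi>" for k
      by (rule Ck_Suc_imp_Ck[OF Ck_Suc_real[OF D test_function_Ck[OF h]]])
    then have "\<phi> \<in> test_functions {a<..<b}"
      unfolding test_functions_def using \<phi>l \<phi>r ab by (auto intro!: exI[of _ "{c..d}"] simp: not_le)
    moreover have "deriv \<phi> = h" using DERIV_imp_deriv[OF D] by blast
    ultimately show ?thesis using that by blast
  qed
qed

text \<open>The test function used is the antiderivative of \<open>\<psi> - (\<integral> \<psi> / \<integral> \<rho>) \<rho>\<close> for a fixed bump \<open>\<rho>\<close>.\<close>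

lemma weak_derivative_zero_imp_constant:
  fixes w :: "real \<Rightarrow> real"
  assumes ab: "a < b" and cw: "continuous_on {a..b} w"
    and 0: "\<And>\<phi>. \<phi> \<in> test_functions {a<..<b} \<Longrightarrow> (LINT t|lebesgue_on {a<..<b}. deriv \<phi> t * w t) = 0"
  obtains c where "\<And>t. t \<in> {a<..<b} \<Longrightarrow> w t = c"
proof -
  let ?M = "lebesgue_on {a<..<b}"
  \<comment> \<open>The bump sits over the middle third, so its closed box stays inside the open
    interval.\<close>
  define a' where "a' = a + (b - a) / 3"
  define b' where "b' = a + (b - a) / 3 * 2"
  have a'b': "a < a'" "a' < b'" "b' < b" using ab by (auto simp: a'_def b'_def field_simps)
  define \<rho> where "\<rho> = box_bump a' b' 1"
  have \<rho>: "\<rho> \<in> test_functions {a<..<b}" unfolding \<rho>_def by (rule box_bump_test) (use a'b' in auto)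
  have int: "integrable ?M (\<lambda>t. f t * k t)" if "f \<in> test_functions {a<..<b}" "continuous_on {a..b} k" for f k :: "real \<Rightarrow> real"
    using that test_function_continuous by (intro continuous_integrable_Ioo continuous_intros) (auto intro: continuous_on_subset)
  have int1: "integrable ?M f" if "f \<in> test_functions {a<..<b}" for f :: "real \<Rightarrow> real"
    using int[OF that, of "\<lambda>_. 1"] by simp
  have \<rho>_pos: "(LINT t|?M. \<rho> t) \<noteq> 0"
  proof
    assume "(LINT t|?M. \<rho> t) = 0"
    then have "AE t in ?M. \<rho> t = 0"
      using int1[OF \<rho>] box_bump_bounds(1) by (subst (asm) integral_nonneg_eq_0_iff_AE) (auto simp: \<rho>_def intro!: AE_I2)
    \<comment> \<open>At the centre of its box the bump is positive, whereas a continuous function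
      that vanishes almost everywhere vanishes there too.\<close>
    then have "\<rho> ((a' + b') / 2) = 0"
      by (intro continuous_AE_eq_0[of "{a<..<b}"]) (use a'b' test_function_continuous[OF \<rho>] in \<open>auto intro: continuous_on_subset\<close>)
    then show False using a'b' by (auto simp: \<rho>_def box_bump_def flat_def field_simps)
  qed
  define c where "c = (LINT t|?M. \<rho> t * w t) / (LINT t|?M. \<rho> t)"
  have "AE t in ?M. w t - c = 0"
  proof (rule fundamental_lemma_variations)
    show "integrable ?M (\<lambda>t. w t - c)" by (intro continuous_integrable_Ioo continuous_intros cw)
    fix \<psi> :: "real \<Rightarrow> real" assume \<psi>: "\<psi> \<in> test_functions {a<..<b}"
    define m where "m = (LINT t|?M. \<psi> t) / (LINT t|?M. \<rho> t)"
    define h where "h = (\<lambda>t. \<psi> t - m * \<rho> t)"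
    have h: "h \<in> test_functions {a<..<b}"
      unfolding h_def by (intro test_functions_linear(3)[OF \<psi>] test_functions_linear(2)[OF \<rho> \<rho>])
    have "(LINT t|?M. h t) = 0"
      unfolding h_def using int1[OF \<psi>] int1[OF \<rho>] \<rho>_pos by (simp add: m_def)
    from antiderivative_test_function[OF h this] obtain \<phi> where \<phi>: "\<phi> \<in> test_functions {a<..<b}" "deriv \<phi> = h" .
    have "0 = (LINT t|?M. h t * w t)" using 0[OF \<phi>(1)] \<phi>(2) by simp
    also have "\<dots> = (LINT t|?M. \<psi> t * w t - m * (\<rho> t * w t))"
      unfolding h_def by (simp add: algebra_simps)
    also have "\<dots> = (LINT t|?M. \<psi> t * w t) - m * (LINT t|?M. \<rho> t * w t)"
      using int[OF \<psi> cw] int[OF \<rho> cw] by simp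
    also have "m * (LINT t|?M. \<rho> t * w t) = c * (LINT t|?M. \<psi> t)"
      by (simp add: m_def c_def)
    also have "(LINT t|?M. \<psi> t * w t) - c * (LINT t|?M. \<psi> t) = (LINT t|?M. \<psi> t * w t - c * \<psi> t)"
      using int[OF \<psi> cw] int1[OF \<psi>] by simp
    also have "\<dots> = (LINT t|?M. (w t - c) * \<psi> t)" by (simp add: algebra_simps)
    finally show "(LINT t|?M. (w t - c) * \<psi> t) = 0" by simp
  qed auto
  then have "w t - c = 0" if "t \<in> {a<..<b}" for t
    by (rule continuous_AE_eq_0[rotated 2]) (use that cw in \<open>auto intro!: continuous_intros intro: continuous_on_subset\<close>)
  then show ?thesis using that[of c] by simp
qed

text \<open>Subtracting a primitive of \<open>f'\<close> leaves a continuous function with vanishing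
  weak derivative, hence a constant; in this way continuity upgrades a weak derivative to a
  classical one.\<close>

lemma weak_derivative_continuous:
  fixes f f' :: "real \<Rightarrow> real"
  assumes cf: "continuous_on {a..b} f" and cf': "continuous_on {a..b} f'"
    and w: "\<And>\<phi>. \<phi> \<in> test_functions {a<..<b} \<Longrightarrow>
       (LINT t|lebesgue_on {a<..<b}. deriv \<phi> t * f t) = - (LINT t|lebesgue_on {a<..<b}. \<phi> t * f' t)"
    and t: "a < t" "t < b"
  shows "(f has_real_derivative f' t) (at t)"
proof -
  let ?M = "lebesgue_on {a<..<b}"
  \<comment> \<open>Clamping the argument extends \<open>f'\<close> continuously to the whole line,
    so that the primitive is differentiable at the end points as well.\<close>
  define k where "k = (\<lambda>x. f' (max a (min b x)))"
  have ab: "a < b" using t by simp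
  have ck: "continuous_on S k" for S
    unfolding k_def by (rule continuous_on_compose2[OF cf']) (use ab in \<open>auto intro!: continuous_intros\<close>)
  have kf': "k x = f' x" if "x \<in> {a<..<b}" for x using that by (simp add: k_def)
  define F where "F = (\<lambda>x. integral {a-1..x} k)"
  have F: "(F has_real_derivative k x) (at x)" if "a - 1 < x" for x
    unfolding F_def by (rule integral_upper_has_real_derivative[OF ck[of "{a-2<..}"]]) (use that in auto)
  have cF: "continuous_on {a..b} F"
    by (rule DERIV_continuous_on[of _ _ k]) (use F in \<open>auto intro: has_field_derivative_at_within\<close>)
  have cd: "continuous_on {a..b} (\<lambda>t. f t - F t)" by (intro continuous_intros cf cF)
  have "(LINT t|?M. deriv \<phi> t * (f t - F t)) = 0" if \<phi>: "\<phi> \<in> test_functions {a<..<b}" for \<phi>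
  proof -
    note D = test_function_DERIV[OF \<phi>]
    have cd: "continuous_on {a..b} (deriv \<phi>)" "continuous_on {a..b} \<phi>"
      using D(3) test_function_continuous[OF \<phi>] continuous_on_subset by blast+
    have "\<phi> a = 0" "\<phi> b = 0" using test_function_outside(1)[OF \<phi>] by auto
    have "((\<lambda>t. deriv \<phi> t * F t + \<phi> t * k t) has_integral (\<phi> b * F b - \<phi> a * F a)) {a..b}"
    proof (rule fundamental_theorem_of_calculus)
      show "((\<lambda>t. \<phi> t * F t) has_vector_derivative deriv \<phi> x * F x + \<phi> x * k x) (at x within {a..b})"
        if "x \<in> {a..b}" for x
        using that D(1)[of x] F[of x] unfolding has_real_derivative_iff_has_vector_derivative[symmetric]
        by (auto intro!: derivative_eq_intros intro: has_field_derivative_at_within)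
    qed (use ab in simp)
    then have I0: "integral {a..b} (\<lambda>t. deriv \<phi> t * F t + \<phi> t * k t) = 0"
      using \<open>\<phi> a = 0\<close> \<open>\<phi> b = 0\<close> by (simp add: integral_unique)
    have c: "continuous_on {a..b} (\<lambda>t. deriv \<phi> t * F t + \<phi> t * k t)"
      by (intro continuous_intros cd cF ck)
    have "(LINT t|?M. deriv \<phi> t * F t + \<phi> t * k t) = (LINT t|lebesgue_on {a..b}. deriv \<phi> t * F t + \<phi> t * k t)"
      by (rule LINT_support_cong) (use test_function_outside[OF \<phi>] in auto)
    also have "\<dots> = 0"
      unfolding I0[symmetric] by (rule lebesgue_integral_eq_integral) (auto intro: continuous_imp_integrable_real c)
    finally have "(LINT t|?M. deriv \<phi> t * F t) + (LINT t|?M. \<phi> t * k t) = 0"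
      using cd cF ck by (subst (asm) Bochner_Integration.integral_add) (auto intro!: continuous_integrable_Ioo continuous_intros)
    moreover have "(LINT t|?M. \<phi> t * k t) = (LINT t|?M. \<phi> t * f' t)"
      by (intro Bochner_Integration.integral_cong) (auto simp: kf')
    moreover have "(LINT t|?M. deriv \<phi> t * (f t - F t)) = (LINT t|?M. deriv \<phi> t * f t) - (LINT t|?M. deriv \<phi> t * F t)"
      unfolding right_diff_distrib using cd cF cf
      by (intro Bochner_Integration.integral_diff) (auto intro!: continuous_integrable_Ioo continuous_intros)
    ultimately show ?thesis using w[OF \<phi>] by simp
  qed
  from weak_derivative_zero_imp_constant[OF ab cd this] obtain c where c: "\<And>t. t \<in> {a<..<b} \<Longrightarrow> f t - F t = c"
    by blast
  have "((\<lambda>t. F t + c) has_real_derivative k t) (at t)"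
    using F[of t] t by (auto intro!: derivative_eq_intros)
  then have "(f has_real_derivative k t) (at t)"
    by (rule has_field_derivative_transform_within_open[of _ _ _ "{a<..<b}"]) (use t c in \<open>auto simp: algebra_simps\<close>)
  then show ?thesis using kf' t by simp
qed

subsection \<open>From weak solutions to the abstract evolution\<close>

lemma L2_inner_cmult: "L2_inner \<Omega> (\<lambda>x. c * f x) h = c * L2_inner \<Omega> f h"
  "L2_inner \<Omega> f (\<lambda>x. c * h x) = c * L2_inner \<Omega> f h" for f h :: "'a::euclidean_space \<Rightarrow> real"
  by (simp_all add: L2_inner_def mult.assoc mult.left_commute)

lemma L2_norm_cmult: "L2_norm \<Omega> (\<lambda>x. c * f x) = \<bar>c\<bar> * L2_norm \<Omega> f" for f :: "'a::euclidean_space \<Rightarrow> real"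
  by (simp add: L2_norm_def power_mult_distrib real_sqrt_mult)

text \<open>Scalar simple functions approximating \<phi>, multiplied by the fixed \<open>w\<close>,
  are simple with values in \<open>X\<close>; by homogeneity of \<open>N\<close> the error is a
  scalar times \<open>N w\<close>.\<close>

lemma L2_time_product:
  fixes \<phi> :: "real \<Rightarrow> real" and w :: "'a \<Rightarrow> real"
  assumes X: "\<And>c. (\<lambda>x. c * w x) \<in> X" and N: "\<And>c. N (\<lambda>x. c * w x) = \<bar>c\<bar> * N w"
    and \<phi>: "continuous_on UNIV \<phi>"
  shows "(\<lambda>t x. \<phi> t * w x) \<in> L2_time {a<..<b} X N"
proof -
  have "\<phi> \<in> borel_measurable (lebesgue_on {a<..<b})" by (rule continuous_borel_measurable_lebesgue_on[OF \<phi>])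
  from borel_measurable_implies_sequence_metric[OF this, of 0] obtain F where F: "\<And>i. simple_function (lebesgue_on {a<..<b}) (F i)"
    "\<And>t. t \<in> space (lebesgue_on {a<..<b}) \<Longrightarrow> (\<lambda>i. F i t) \<longlonglongrightarrow> \<phi> t" by blast
  have sm: "strongly_measurable {a<..<b} X N (\<lambda>t x. \<phi> t * w x)"
    unfolding strongly_measurable_def
  proof (intro exI[of _ "\<lambda>k t x. F k t * w x"] conjI allI AE_I2)
    show "simple_function (lebesgue_on {a<..<b}) (\<lambda>t x. F k t * w x)" for k
      by (rule simple_function_compose1[OF F(1), where g="\<lambda>c x. c * w x"])
    show "(\<lambda>t x. F k t * w x) ` {a<..<b} \<subseteq> X" for k using X by auto
    fix t assume t: "t \<in> space (lebesgue_on {a<..<b})"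
    have "(\<lambda>k. \<bar>F k t - \<phi> t\<bar> * N w) \<longlonglongrightarrow> \<bar>\<phi> t - \<phi> t\<bar> * N w"
      by (intro tendsto_intros F t)
    then show "(\<lambda>k. N (\<lambda>x. F k t * w x - \<phi> t * w x)) \<longlonglongrightarrow> 0"
      by (simp add: N flip: left_diff_distrib)
  qed
  have "integrable (lebesgue_on {a<..<b}) (\<lambda>t. (\<bar>\<phi> t\<bar> * N w)\<^sup>2)"
    by (intro continuous_integrable_Ioo continuous_intros continuous_on_subset[OF \<phi>]) auto
  then show ?thesis using X sm by (simp add: L2_time_def N)
qed

context
  fixes \<Omega> :: "'a::euclidean_space set"
  assumes open_\<Omega>: "open \<Omega>" and bounded_\<Omega>: "bounded \<Omega>"
begin

text \<open>Since \<phi> has compact support in the open interval, the product vanishes at both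
  ends. Tested with such products, the equation becomes a scalar identity in time.\<close>

lemma admissible_test_product:
  assumes \<phi>: "\<phi> \<in> test_functions {0<..<T}" and w: "w \<in> H1_0 \<Omega>" and T: "0 < T"
  shows "admissible_test \<Omega> T (\<lambda>t x. \<phi> t * w x) (\<lambda>t x. deriv \<phi> t * w x)"
  unfolding admissible_test_def
proof (intro conjI)
  note hw = H1_0_H1[OF open_\<Omega> bounded_\<Omega> w]
  note lw = H1_L2[OF open_\<Omega> bounded_\<Omega> hw]
  have lc: "(\<lambda>x. c * w x) \<in> L2 \<Omega>" for c using L2_scaleR[OF lw, of c] by simp
  show "(\<lambda>t x. \<phi> t * w x) \<in> L2_time {0<..<T} (H1_0 \<Omega>) (H1_norm \<Omega>)"
    by (intro L2_time_product H1_0_cmult[OF open_\<Omega> bounded_\<Omega> w] H1_norm_cmult[OF open_\<Omega> bounded_\<Omega> hw] test_function_continuous[OF \<phi>])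
  show "(\<lambda>t x. deriv \<phi> t * w x) \<in> L2_time {0<..<T} (L2 \<Omega>) (L2_norm \<Omega>)"
    by (intro L2_time_product lc L2_norm_cmult test_function_DERIV(3)[OF \<phi>])
  show "has_weak_time_derivative \<Omega> T (\<lambda>t x. \<phi> t * w x) (\<lambda>t x. deriv \<phi> t * w x)"
    unfolding has_weak_time_derivative_def
  proof (intro ballI)
    fix \<psi> and z :: "'a \<Rightarrow> real" assume \<psi>: "\<psi> \<in> test_functions {0<..<T}" and z: "z \<in> L2 \<Omega>"
    have "(LINT t|lebesgue_on {0..T}. deriv \<psi> t * L2_inner \<Omega> (\<lambda>x. \<phi> t * w x) z)
      = L2_inner \<Omega> w z * (LINT t|lebesgue_on {0..T}. \<phi> t * deriv \<psi> t)"
      by (simp add: L2_inner_cmult ac_simps flip: integral_mult_right_zero)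
    also have "(LINT t|lebesgue_on {0..T}. \<phi> t * deriv \<psi> t) = (LINT t|lebesgue_on {0<..<T}. \<phi> t * deriv \<psi> t)"
      by (rule LINT_support_cong) (use test_function_outside[OF \<phi>] in auto)
    also have "\<dots> = - (LINT t|lebesgue_on {0<..<T}. deriv \<phi> t * \<psi> t)"
      by (rule test_function_parts[OF \<phi> \<psi>])
    also have "(LINT t|lebesgue_on {0<..<T}. deriv \<phi> t * \<psi> t) = (LINT t|lebesgue_on {0..T}. deriv \<phi> t * \<psi> t)"
      by (rule LINT_support_cong) (use test_function_outside[OF \<phi>] in auto)
    also have "\<dots> = (LINT t|lebesgue_on {0..T}. \<psi> t * deriv \<phi> t)"
      by (simp add: mult.commute)
    also have "L2_inner \<Omega> w z * - \<dots> = - (LINT t|lebesgue_on {0..T}. \<psi> t * L2_inner \<Omega> (\<lambda>x. deriv \<phi> t * w x) z)"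
      by (simp add: L2_inner_cmult flip: mult.assoc)
    finally show "(LINT t|lebesgue_on {0..T}. deriv \<psi> t * L2_inner \<Omega> (\<lambda>x. \<phi> t * w x) z)
      = - (LINT t|lebesgue_on {0..T}. \<psi> t * L2_inner \<Omega> (\<lambda>x. deriv \<phi> t * w x) z)" .
  qed
  show "(\<lambda>t x. \<phi> t * w x) \<in> C_time {0..T} (L2 \<Omega>) (L2_norm \<Omega>)"
    unfolding C_time_def
  proof (intro CollectI conjI ballI)
    fix t assume t: "t \<in> {0..T}"
    show "(\<lambda>x. \<phi> t * w x) \<in> L2 \<Omega>" by (rule lc)
    have "(\<phi> \<longlongrightarrow> \<phi> t) (at t within {0..T})"
      using test_function_continuous[OF \<phi>] t continuous_on_subset[of UNIV \<phi> "{0..T}"] by (auto simp: continuous_on)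
    then have "((\<lambda>s. \<bar>\<phi> s - \<phi> t\<bar> * L2_norm \<Omega> w) \<longlongrightarrow> \<bar>\<phi> t - \<phi> t\<bar> * L2_norm \<Omega> w) (at t within {0..T})"
      by (intro tendsto_intros)
    then show "((\<lambda>s. L2_norm \<Omega> (\<lambda>x. \<phi> s * w x - \<phi> t * w x)) \<longlongrightarrow> 0) (at t within {0..T})"
      by (simp add: L2_norm_cmult flip: left_diff_distrib)
  qed
  show "AE x in lebesgue_on \<Omega>. \<phi> T * w x = 0"
    using test_function_outside(1)[OF \<phi>, of T] by simp
qed

lemma continuous_on_l2_fun:
  assumes "v \<in> C_time I (L2 \<Omega>) (L2_norm \<Omega>)"
  shows "continuous_on I (\<lambda>t. l2_fun \<Omega> (v t))"
  unfolding continuous_on_def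
proof
  fix t assume t: "t \<in> I"
  have v: "\<And>s. s \<in> I \<Longrightarrow> v s \<in> L2 \<Omega>" using assms by (auto simp: C_time_def)
  have "((\<lambda>s. L2_norm \<Omega> (\<lambda>x. v s x - v t x)) \<longlongrightarrow> 0) (at t within I)"
    using assms t by (auto simp: C_time_def)
  then have "((\<lambda>s. norm (l2_fun \<Omega> (v s) - l2_fun \<Omega> (v t))) \<longlongrightarrow> 0) (at t within I)"
  proof (rule Lim_transform_eventually)
    show "\<forall>\<^sub>F s in at t within I. L2_norm \<Omega> (\<lambda>x. v s x - v t x) = norm (l2_fun \<Omega> (v s) - l2_fun \<Omega> (v t))"
      unfolding eventually_at_filter
      by (intro always_eventually allI impI)
        (simp add: l2_fun_def[OF open_\<Omega> bounded_\<Omega>] v t L2_diff \<Omega>_lebesgue[OF open_\<Omega> bounded_\<Omega>] flip: to_l2_norm to_l2_diff)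
  qed
  then show "((\<lambda>t. l2_fun \<Omega> (v t)) \<longlongrightarrow> l2_fun \<Omega> (v t)) (at t within I)"
    using Lim_null tendsto_norm_zero_iff by blast
qed

lemma C_time_H1_0:
  assumes u: "u \<in> C_time I (H1_0 \<Omega>) (H1_norm \<Omega>)"
  shows "\<And>t. t \<in> I \<Longrightarrow> u t \<in> H1_0 \<Omega>" "continuous_on I (\<lambda>t. l2_fun \<Omega> (u t))" "continuous_on I (\<lambda>t. l2_grad \<Omega> (u t))"
proof -
  show u0: "u t \<in> H1_0 \<Omega>" if "t \<in> I" for t using u that by (auto simp: C_time_def)
  note u1 = H1_0_H1[OF open_\<Omega> bounded_\<Omega> u0]
  have *: "((\<lambda>s. X (u s)) \<longlongrightarrow> X (u t)) (at t within I)"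
    if t: "t \<in> I" and X: "\<And>s. s \<in> I \<Longrightarrow> norm (X (u s) - X (u t)) \<le> H1_norm \<Omega> (\<lambda>x. u s x - u t x)" 
    for t and X :: "_ \<Rightarrow> 'c::real_normed_vector"
  proof -
    have "((\<lambda>s. H1_norm \<Omega> (\<lambda>x. u s x - u t x)) \<longlongrightarrow> 0) (at t within I)"
      using u t by (auto simp: C_time_def)
    then have "((\<lambda>s. X (u s) - X (u t)) \<longlongrightarrow> 0) (at t within I)"
      by (rule Lim_null_comparison[rotated]) (auto simp: eventually_at_filter intro!: always_eventually X)
    then show ?thesis using Lim_null by blast
  qed
  note d = H1_diff[OF open_\<Omega> bounded_\<Omega> u1 u1]
  show "continuous_on I (\<lambda>t. l2_fun \<Omega> (u t))" unfolding continuous_on_def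
    using norm_l2_fun_le[OF open_\<Omega> bounded_\<Omega> d(1)] by (intro ballI * ) (auto simp: d(3))
  show "continuous_on I (\<lambda>t. l2_grad \<Omega> (u t))" unfolding continuous_on_def
    using norm_l2_grad_le[OF open_\<Omega> bounded_\<Omega> d(1)] by (intro ballI * ) (auto simp: d(2))
qed

text \<open>\<open>G\<close> extends \<open>g\<close> to the line. The equation evaluates the kernel
  at \<open>t - s\<close> with \<open>0 \<le> s \<le> t\<close> only, so it does not see the
  extension.\<close>

lemma solution_evolution:
  assumes sol: "is_solution \<Omega> g \<mu> \<tau> u0 u1 f0 u ut" and \<tau>: "0 < \<tau>"
    and gG: "\<And>t. 0 \<le> t \<Longrightarrow> g t = G t"
    and G: "\<And>t. (G has_real_derivative G' t) (at t)" and G': "continuous_on UNIV G'"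
  shows "viscoelastic_evolution (\<lambda>t. l2_fun \<Omega> (u t)) (\<lambda>t. l2_fun \<Omega> (ut t)) (\<lambda>t. l2_grad \<Omega> (u t)) G G' \<mu> \<tau>"
proof -
  note ob = open_\<Omega> bounded_\<Omega>
  define U where "U = (\<lambda>t. l2_fun \<Omega> (u t))"
  define V where "V = (\<lambda>t. l2_fun \<Omega> (ut t))"
  define W where "W = (\<lambda>t. l2_grad \<Omega> (u t))"
  have uC: "u \<in> C_time {0..} (H1_0 \<Omega>) (H1_norm \<Omega>)" and utC: "ut \<in> C_time {0..} (L2 \<Omega>) (L2_norm \<Omega>)"
    and ws: "\<And>T. 0 < T \<Longrightarrow> weak_solution \<Omega> g \<mu> \<tau> T u1 f0 u ut"
    using sol by (auto simp: is_solution_def)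
  have u0: "u t \<in> H1_0 \<Omega>" if "0 \<le> t" for t using C_time_H1_0(1)[OF uC] that by simp
  note uH = H1_0_H1[OF ob u0]
  note uL = H1_L2[OF ob uH]
  note uG = grad_weak_gradient[OF ob uH, THEN conjunct1]
  have utL: "ut t \<in> L2 \<Omega>" if "0 \<le> t" for t using utC that by (auto simp: C_time_def)
  have cU: "continuous_on {0..} U" and cW: "continuous_on {0..} W"
    using C_time_H1_0[OF uC] by (auto simp: U_def W_def)
  have cV: "continuous_on {0..} V" using continuous_on_l2_fun[OF utC] by (simp add: V_def)
  note inner = to_l2_inner[OF \<Omega>_lebesgue[OF ob], symmetric, folded l2_fun_def[OF ob] l2_grad_def[OF ob]]
  have U_deriv: "((\<lambda>t. V s \<bullet> U t) has_real_derivative V s \<bullet> V t) (at t)" if s: "0 \<le> s" and t: "0 < t" for s t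
  \<comment> \<open>The weak time derivative is tested with the element \<open>ut s\<close> of
    \<open>L2\<close>, on an interval that has \<open>t\<close> in its interior.\<close>
  proof (rule weak_derivative_continuous[of 0 "t + 1"])
    show "continuous_on {0..t+1} (\<lambda>t. V s \<bullet> U t)" "continuous_on {0..t+1} (\<lambda>t. V s \<bullet> V t)"
      using cU cV by (auto intro!: continuous_intros intro: continuous_on_subset)
    fix \<phi> assume \<phi>: "\<phi> \<in> test_functions {0<..<t+1}"
    have "has_weak_time_derivative \<Omega> (t+1) u ut" using ws[of "t+1"] t by (simp add: weak_solution_def)
    from this[unfolded has_weak_time_derivative_def, rule_format, OF \<phi> utL[OF s]]
    have eq: "(LINT r|lebesgue_on {0..t+1}. deriv \<phi> r * L2_inner \<Omega> (u r) (ut s))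
      = - (LINT r|lebesgue_on {0..t+1}. \<phi> r * L2_inner \<Omega> (ut r) (ut s))" .
    have "(LINT r|lebesgue_on {0<..<t+1}. deriv \<phi> r * (V s \<bullet> U r)) = (LINT r|lebesgue_on {0..t+1}. deriv \<phi> r * (V s \<bullet> U r))"
      by (rule LINT_support_cong) (use test_function_outside[OF \<phi>] in auto)
    also have "\<dots> = (LINT r|lebesgue_on {0..t+1}. deriv \<phi> r * L2_inner \<Omega> (u r) (ut s))"
      by (intro Bochner_Integration.integral_cong)
        (auto simp: U_def V_def l2_fun_def[OF ob] to_l2_inner[OF \<Omega>_lebesgue[OF ob], symmetric] uL utL s inner_commute)
    also note eq
    also have "(LINT r|lebesgue_on {0..t+1}. \<phi> r * L2_inner \<Omega> (ut r) (ut s)) = (LINT r|lebesgue_on {0..t+1}. \<phi> r * (V s \<bullet> V r))"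
      by (intro Bochner_Integration.integral_cong)
        (auto simp: U_def V_def l2_fun_def[OF ob] to_l2_inner[OF \<Omega>_lebesgue[OF ob], symmetric] uL utL s inner_commute)
    also have "\<dots> = (LINT r|lebesgue_on {0<..<t+1}. \<phi> r * (V s \<bullet> V r))"
      by (rule LINT_support_cong) (use test_function_outside[OF \<phi>] in auto)
    finally show "(LINT r|lebesgue_on {0<..<t+1}. deriv \<phi> r * (V s \<bullet> U r)) = - (LINT r|lebesgue_on {0<..<t+1}. \<phi> r * (V s \<bullet> V r))" .
  qed (use t in auto)
  have cG: "continuous_on UNIV G" by (auto intro!: continuous_at_imp_continuous_on DERIV_isCont[OF G])
  have cGc: "continuous_on X b \<Longrightarrow> continuous_on X (\<lambda>x. G (b x))" for X :: "'c::topological_space set" and b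
    by (rule continuous_on_compose2[OF cG]) auto
  have cWc: "continuous_on X b \<Longrightarrow> (\<And>x. x \<in> X \<Longrightarrow> 0 \<le> b x) \<Longrightarrow> continuous_on X (\<lambda>x. W (b x))" for X :: "'c::topological_space set" and b
    by (rule continuous_on_compose2[OF cW]) auto
  have cVc: "continuous_on X b \<Longrightarrow> (\<And>x. x \<in> X \<Longrightarrow> 0 \<le> b x) \<Longrightarrow> continuous_on X (\<lambda>x. V (b x))" for X :: "'c::topological_space set" and b
    by (rule continuous_on_compose2[OF cV]) auto
  have V_deriv: "((\<lambda>t. V t \<bullet> U r) has_real_derivative
        - (W t \<bullet> W r) + integral {0..t} (\<lambda>s. G (t - s) * (W s \<bullet> W r)) - \<mu> * (V (t - \<tau>) \<bullet> U r)) (at t)"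
    if t: "\<tau> < t" and r: "0 \<le> r" for t r
  proof -
    define T where "T = t + 1"
    have T: "\<tau> < T" "0 < T" using t \<tau> by (auto simp: T_def)
    let ?M = "lebesgue_on {\<tau><..<T}"
    define m where "m = (\<lambda>t. integral {0..t} (\<lambda>s. G (t - s) * (W s \<bullet> W r)))"
    have cm: "continuous_on {\<tau>..T} m" unfolding m_def
      by (rule continuous_on_integral_upper) (use \<tau> r in \<open>auto simp: split_beta intro!: continuous_intros cGc cWc\<close>)
    have cf: "continuous_on {\<tau>..T} (\<lambda>t. V t \<bullet> U r)" "continuous_on {\<tau>..T} (\<lambda>t. W t \<bullet> W r)" "continuous_on {\<tau>..T} (\<lambda>t. V (t - \<tau>) \<bullet> U r)"
      using \<tau> by (auto intro!: continuous_intros cWc cVc)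
    show ?thesis
    proof (rule weak_derivative_continuous[of \<tau> T "\<lambda>t. V t \<bullet> U r" 
          "\<lambda>t. - (W t \<bullet> W r) + integral {0..t} (\<lambda>s. G (t - s) * (W s \<bullet> W r)) - \<mu> * (V (t - \<tau>) \<bullet> U r)"])
      show "continuous_on {\<tau>..T} (\<lambda>t. - (W t \<bullet> W r) + integral {0..t} (\<lambda>s. G (t - s) * (W s \<bullet> W r)) - \<mu> * (V (t - \<tau>) \<bullet> U r))"
        by (intro continuous_on_diff continuous_on_add continuous_on_minus continuous_on_mult_left cm[unfolded m_def] cf)
      fix \<phi> assume \<phi>: "\<phi> \<in> test_functions {\<tau><..<T}"
      note out = test_function_outside[OF \<phi>]
      \<comment> \<open>Test functions supported after \<tau> are admissible on the whole of
        \<open>{0<..<T}\<close>, and they switch off both the history \<open>f0\<close> and the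
        initial velocity.\<close>
      have \<phi>0: "\<phi> \<in> test_functions {0<..<T}" 
        by (rule subsetD[OF test_functions_mono \<phi>]) (use \<tau> in auto)
      have gradc: "L2_inner \<Omega> (grad \<Omega> (u s)) (grad \<Omega> (\<lambda>x. c * u r x)) = c * (W s \<bullet> W r)" if "0 \<le> s" for c s
      proof -
        have "L2_inner \<Omega> (grad \<Omega> (u s)) (grad \<Omega> (\<lambda>x. c * u r x)) = l2_grad \<Omega> (u s) \<bullet> l2_grad \<Omega> (\<lambda>x. c * u r x)"
          unfolding l2_grad_def[OF ob]
          by (rule to_l2_inner[OF \<Omega>_lebesgue[OF ob], symmetric])
            (use that r uG grad_weak_gradient[OF ob H1_cmult(1)[OF ob uH[OF r]]] in auto)
        then show ?thesis using H1_cmult(2)[OF ob uH[OF r], of c] by (simp add: W_def)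
      qed
      have func: "L2_inner \<Omega> (ut s) (\<lambda>x. c * u r x) = c * (V s \<bullet> U r)" if "0 \<le> s" for c s
        unfolding L2_inner_cmult V_def U_def l2_fun_def[OF ob] using that r
        by (simp add: to_l2_inner[OF \<Omega>_lebesgue[OF ob]] utL uL)
      from ws[OF T(2)] admissible_test_product[OF \<phi>0 u0[OF r] T(2)]
      have "- (LINT t|lebesgue_on {0..T}. L2_inner \<Omega> (ut t) (\<lambda>x. deriv \<phi> t * u r x))
        + (LINT t|lebesgue_on {0..T}. L2_inner \<Omega> (grad \<Omega> (u t)) (grad \<Omega> (\<lambda>x. \<phi> t * u r x)))
        - (LINT t|lebesgue_on {0..T}. LINT s|lebesgue_on {0..t}.
             g (t - s) * L2_inner \<Omega> (grad \<Omega> (u s)) (grad \<Omega> (\<lambda>x. \<phi> t * u r x)))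
        + \<mu> * (LINT t|lebesgue_on {0..T}. L2_inner \<Omega> (with_history f0 ut (t - \<tau>)) (\<lambda>x. \<phi> t * u r x))
        - L2_inner \<Omega> u1 (\<lambda>x. \<phi> 0 * u r x) = 0"
        unfolding weak_solution_def by blast
      moreover have "(LINT t|lebesgue_on {0..T}. L2_inner \<Omega> (ut t) (\<lambda>x. deriv \<phi> t * u r x)) = (LINT t|?M. deriv \<phi> t * (V t \<bullet> U r))"
      proof -
        have "(LINT t|lebesgue_on {0..T}. L2_inner \<Omega> (ut t) (\<lambda>x. deriv \<phi> t * u r x)) = (LINT t|lebesgue_on {0..T}. deriv \<phi> t * (V t \<bullet> U r))"
          by (intro Bochner_Integration.integral_cong) (auto simp: func)
        also have "\<dots> = (LINT t|?M. deriv \<phi> t * (V t \<bullet> U r))"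
          by (rule LINT_support_cong) (use out \<tau> in auto)
        finally show ?thesis .
      qed
      moreover have "(LINT t|lebesgue_on {0..T}. L2_inner \<Omega> (grad \<Omega> (u t)) (grad \<Omega> (\<lambda>x. \<phi> t * u r x))) = (LINT t|?M. \<phi> t * (W t \<bullet> W r))"
      proof -
        have "(LINT t|lebesgue_on {0..T}. L2_inner \<Omega> (grad \<Omega> (u t)) (grad \<Omega> (\<lambda>x. \<phi> t * u r x))) = (LINT t|lebesgue_on {0..T}. \<phi> t * (W t \<bullet> W r))"
          by (intro Bochner_Integration.integral_cong) (auto simp: gradc)
        also have "\<dots> = (LINT t|?M. \<phi> t * (W t \<bullet> W r))"
          by (rule LINT_support_cong) (use out \<tau> in auto)
        finally show ?thesis .
      qed
      moreover have "(LINT t|lebesgue_on {0..T}. LINT s|lebesgue_on {0..t}.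
             g (t - s) * L2_inner \<Omega> (grad \<Omega> (u s)) (grad \<Omega> (\<lambda>x. \<phi> t * u r x))) = (LINT t|?M. \<phi> t * m t)"
      proof -
        \<comment> \<open>This holds for every real \<open>t\<close>: for negative ones the domain
          of integration is empty.\<close>
        have "(LINT s|lebesgue_on {0..t}. g (t - s) * L2_inner \<Omega> (grad \<Omega> (u s)) (grad \<Omega> (\<lambda>x. \<phi> t * u r x))) = \<phi> t * m t" for t
        proof -
          have "(LINT s|lebesgue_on {0..t}. g (t - s) * L2_inner \<Omega> (grad \<Omega> (u s)) (grad \<Omega> (\<lambda>x. \<phi> t * u r x)))
            = (LINT s|lebesgue_on {0..t}. \<phi> t * (G (t - s) * (W s \<bullet> W r)))"
            by (intro Bochner_Integration.integral_cong) (auto simp: gradc gG)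
          also have "\<dots> = \<phi> t * (LINT s|lebesgue_on {0..t}. G (t - s) * (W s \<bullet> W r))" by simp
          also have "(LINT s|lebesgue_on {0..t}. G (t - s) * (W s \<bullet> W r)) = m t"
            unfolding m_def by (rule lebesgue_integral_eq_integral)
              (use r in \<open>auto intro!: continuous_imp_integrable_real continuous_intros cGc cWc\<close>)
          finally show ?thesis .
        qed
        then have "(LINT t|lebesgue_on {0..T}. LINT s|lebesgue_on {0..t}.
             g (t - s) * L2_inner \<Omega> (grad \<Omega> (u s)) (grad \<Omega> (\<lambda>x. \<phi> t * u r x))) = (LINT t|lebesgue_on {0..T}. \<phi> t * m t)"
          by simp
        also have "\<dots> = (LINT t|?M. \<phi> t * m t)"
          by (rule LINT_support_cong) (use out \<tau> in auto)
        finally show ?thesis .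
      qed
      moreover have "(LINT t|lebesgue_on {0..T}. L2_inner \<Omega> (with_history f0 ut (t - \<tau>)) (\<lambda>x. \<phi> t * u r x)) = (LINT t|?M. \<phi> t * (V (t - \<tau>) \<bullet> U r))"
      proof -
        \<comment> \<open>Before \<tau> the factor \<open>\<phi> t\<close> is 0, whatever
          \<open>f0\<close> is; from \<tau> on the delayed velocity is a value of
          \<open>ut\<close>.\<close>
        have "L2_inner \<Omega> (with_history f0 ut (t - \<tau>)) (\<lambda>x. \<phi> t * u r x) = \<phi> t * (V (t - \<tau>) \<bullet> U r)" for t
          using out(1)[of t] func[of "t - \<tau>" "\<phi> t"] by (cases "t < \<tau>") (auto simp: with_history_def L2_inner_def)
        then have "(LINT t|lebesgue_on {0..T}. L2_inner \<Omega> (with_history f0 ut (t - \<tau>)) (\<lambda>x. \<phi> t * u r x)) = (LINT t|lebesgue_on {0..T}. \<phi> t * (V (t - \<tau>) \<bullet> U r))"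
          by simp
        also have "\<dots> = (LINT t|?M. \<phi> t * (V (t - \<tau>) \<bullet> U r))"
          by (rule LINT_support_cong) (use out \<tau> in auto)
        finally show ?thesis .
      qed
      moreover have "L2_inner \<Omega> u1 (\<lambda>x. \<phi> 0 * u r x) = 0"
        using out(1)[of 0] \<tau> by (simp add: L2_inner_def)
      ultimately have E: "(LINT t|?M. deriv \<phi> t * (V t \<bullet> U r)) = (LINT t|?M. \<phi> t * (W t \<bullet> W r)) - (LINT t|?M. \<phi> t * m t) + \<mu> * (LINT t|?M. \<phi> t * (V (t - \<tau>) \<bullet> U r))"
        by simp
      have int: "integrable ?M (\<lambda>t. \<phi> t * k t)" if "continuous_on {\<tau>..T} k" for k
        using that test_function_continuous[OF \<phi>]
        by (intro continuous_integrable_Ioo continuous_intros) (auto intro: continuous_on_subset)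
      have "(LINT t|?M. \<phi> t * (- (W t \<bullet> W r) + m t - \<mu> * (V (t - \<tau>) \<bullet> U r)))
        = (LINT t|?M. - (\<phi> t * (W t \<bullet> W r)) + \<phi> t * m t - \<mu> * (\<phi> t * (V (t - \<tau>) \<bullet> U r)))"
        by (simp add: algebra_simps)
      also have "\<dots> = - (LINT t|?M. \<phi> t * (W t \<bullet> W r)) + (LINT t|?M. \<phi> t * m t) - \<mu> * (LINT t|?M. \<phi> t * (V (t - \<tau>) \<bullet> U r))"
        using int[OF cm] int[OF cf(2)] int[OF cf(3)] by simp
      finally show "(LINT t|?M. deriv \<phi> t * (V t \<bullet> U r)) = - (LINT t|?M. \<phi> t *
           (- (W t \<bullet> W r) + integral {0..t} (\<lambda>s. G (t - s) * (W s \<bullet> W r)) - \<mu> * (V (t - \<tau>) \<bullet> U r)))"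
        using E unfolding m_def by simp
    qed (use t cf in \<open>auto simp: T_def\<close>)
  qed
  have "viscoelastic_evolution U V W G G' \<mu> \<tau>"
    by (unfold_locales) (use \<tau> cU cV cW G G' U_deriv V_deriv in auto)
  then show ?thesis by (simp add: U_def V_def W_def)
qed

end

subsection \<open>Choice of the constants\<close>

text \<open>\<open>C7\<close> only enters through an upper bound for \<open>\<epsilon>2\<close>, so \<open>C7 = 1\<close> will do, and \<open>\<epsilon>2\<close> is chosen last.\<close>

lemma constants_exist:
  fixes l g0 C \<zeta> G0 \<tau> :: real
  assumes l: "0 < l" and g0: "0 < g0" "g0 < 1" and C: "0 < C" and \<zeta>: "0 < \<zeta>" and G0: "0 < G0" and \<tau>: "0 < \<tau>"
  obtains C1 \<delta> \<epsilon>1 \<epsilon>2 \<sigma> \<xi> k1 k2 where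
    "0 < C1" "0 < \<delta>" "0 < \<epsilon>1" "0 < \<epsilon>2" "0 < \<sigma>" "0 < \<xi>"
    "k1 = \<epsilon>2 * (g0 - \<delta>) - \<epsilon>1 * C1" "k2 = \<epsilon>1 * C1 + \<epsilon>2 * \<delta>"
    "\<delta> < g0 / 4" "\<delta> < l * g0 / (16 * C1)" "\<epsilon>2 < \<delta> / 2"
    "\<epsilon>2 * (g0 / (8 * C1)) < \<epsilon>1" "\<epsilon>1 < \<epsilon>2 * ((g0 - 2 * \<delta>) / (2 * C1))"
    "2 * k2 * exp (\<sigma> * \<tau>) < \<xi>" "\<xi> < 2 * k1"
    "1 + C\<^sup>2 / l \<le> C1" "2 * k1 \<le> 1"
    "(\<epsilon>1 / l + \<epsilon>2 * (1 + (1 + C\<^sup>2) / (4 * \<delta>))) / \<zeta> + \<epsilon>2 * (G0 * C\<^sup>2 / (4 * \<delta>)) \<le> 1/4"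
    "\<epsilon>1 + \<epsilon>2 \<le> 1/2" "\<epsilon>1 * C\<^sup>2 \<le> l / 2" "\<epsilon>2 * C\<^sup>2 \<le> 1/2"
proof -
  define C1 where "C1 = 1 + C\<^sup>2 / l"
  have C1: "1 \<le> C1" using l by (simp add: C1_def)
  define b where "b = min (g0 / 4) (l * g0 / (16 * C1))"
  define \<delta> where "\<delta> = b / 2"
  have "0 < b" using g0 l C1 by (simp add: b_def)
  then have "0 < \<delta>" "\<delta> < b" by (simp_all add: \<delta>_def)
  then have \<delta>: "0 < \<delta>" "\<delta> < g0 / 4" "\<delta> < l * g0 / (16 * C1)" by (simp_all add: b_def)
  \<comment> \<open>The ratio of \<open>\<epsilon>1\<close> to \<open>\<epsilon>2\<close>. It is
    twice the lower bound \<open>g0 / (8 * C1)\<close> and stays below the upper bound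
    \<open>(g0 - 2 * \<delta>) / (2 * C1)\<close> because \<open>\<delta> < g0 / 4\<close>.\<close>
  define q where "q = g0 / (4 * C1)"
  have q: "0 < q" using g0 C1 by (simp add: q_def)
  \<comment> \<open>With the ratio fixed, every smallness condition is linear in
    \<open>\<epsilon>2\<close> and holds for \<open>\<epsilon>2\<close> near 0; \<open>X\<close> is
    the coefficient in the condition on the memory terms.\<close>
  define X where "X = (q / l + (1 + (1 + C\<^sup>2) / (4 * \<delta>))) / \<zeta> + G0 * C\<^sup>2 / (4 * \<delta>)"
  have small: "\<forall>\<^sub>F e in at_right 0. e * Y < b" if "0 < b" for Y b :: real
  proof -
    have "((\<lambda>e. e * Y) \<longlongrightarrow> 0 * Y) (at_right 0)" by (intro tendsto_intros)
    then show ?thesis using that by (intro order_tendstoD(2)) auto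
  qed
  have "\<forall>\<^sub>F e in at_right 0. 0 < e \<and> e * X < 1/4 \<and> e * (q + 1) < 1/2 \<and> e * (q * C\<^sup>2) < l / 2 \<and> e * C\<^sup>2 < 1/2
     \<and> e * 1 < \<delta> / 2 \<and> e * 1 < 1/2"
    using \<delta>(1) l by (intro eventually_conj small eventually_at_right_less) auto
  then obtain \<epsilon>2 where \<epsilon>2: "0 < \<epsilon>2" "\<epsilon>2 * X < 1/4" "\<epsilon>2 * (q + 1) < 1/2" "\<epsilon>2 * (q * C\<^sup>2) < l / 2" "\<epsilon>2 * C\<^sup>2 < 1/2"
     "\<epsilon>2 < \<delta> / 2" "\<epsilon>2 < 1/2"
    using eventually_happens'[OF trivial_limit_at_right_real] by (metis (no_types, lifting) mult_1_right)
  define \<epsilon>1 where "\<epsilon>1 = \<epsilon>2 * q"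
  have \<epsilon>1C1: "\<epsilon>1 * C1 = \<epsilon>2 * (g0 / 4)" using C1 by (simp add: \<epsilon>1_def q_def)
  define k1 where "k1 = \<epsilon>2 * (g0 - \<delta>) - \<epsilon>1 * C1"
  define k2 where "k2 = \<epsilon>1 * C1 + \<epsilon>2 * \<delta>"
  have k1: "k1 = \<epsilon>2 * (3 * g0 / 4 - \<delta>)" and k2: "k2 = \<epsilon>2 * (g0 / 4 + \<delta>)"
    unfolding k1_def k2_def \<epsilon>1C1 by (simp_all add: algebra_simps)
  have k12: "0 < k2" "k2 < k1" unfolding k1 k2
    using \<epsilon>2(1) \<delta> g0 by (auto intro!: mult_pos_pos mult_strict_left_mono)
  \<comment> \<open>Through this bound \<open>\<bar>\<mu>\<bar> < 2 * k1 - \<xi>\<close> yields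
    \<open>\<bar>\<mu>\<bar> \<le> 1\<close>, so the constants need not refer to \<mu>.\<close>
  have k1_le: "2 * k1 \<le> 1"
  proof -
    have "\<epsilon>2 * (3 * g0 / 4 - \<delta>) \<le> (1/2) * 1"
      using \<epsilon>2 \<delta> g0 by (intro mult_mono) auto
    then show ?thesis unfolding k1 by simp
  qed
  have "((\<lambda>\<sigma>. k2 * exp (\<sigma> * \<tau>)) \<longlongrightarrow> k2 * exp (0 * \<tau>)) (at_right 0)" by (intro tendsto_intros)
  \<comment> \<open>As \<open>\<sigma>\<close> tends to 0 the requirement becomes
    \<open>k2 < k1\<close>, hence it holds for small \<open>\<sigma>\<close>.\<close>
  then have "\<forall>\<^sub>F \<sigma> in at_right 0. k2 * exp (\<sigma> * \<tau>) < k1" using k12 by (intro order_tendstoD(2)) auto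
  then have "\<forall>\<^sub>F \<sigma> in at_right 0. 0 < \<sigma> \<and> k2 * exp (\<sigma> * \<tau>) < k1"
    by (intro eventually_conj eventually_at_right_less)
  then obtain \<sigma> where \<sigma>: "0 < \<sigma>" "k2 * exp (\<sigma> * \<tau>) < k1"
    using eventually_happens'[OF trivial_limit_at_right_real] by blast
  \<comment> \<open>The midpoint of the prescribed bounds
    \<open>2 * k2 * exp (\<sigma> * \<tau>)\<close> and \<open>2 * k1\<close>.\<close>
  define \<xi> where "\<xi> = k1 + k2 * exp (\<sigma> * \<tau>)"
  have "0 < k2 * exp (\<sigma> * \<tau>)" using k12 by simp
  show ?thesis
  proof (rule that[of C1 \<delta> \<epsilon>1 \<epsilon>2 \<sigma> \<xi> k1 k2])
    show "0 < \<epsilon>1" using \<epsilon>2 q by (simp add: \<epsilon>1_def)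
    show "0 < \<xi>" using k12 by (simp add: \<xi>_def add_pos_pos)
    show "2 * k2 * exp (\<sigma> * \<tau>) < \<xi>" "\<xi> < 2 * k1" using \<sigma> by (simp_all add: \<xi>_def)
    show "\<epsilon>2 * (g0 / (8 * C1)) < \<epsilon>1" unfolding \<epsilon>1_def q_def
      using \<epsilon>2(1) g0 C1 by (intro mult_strict_left_mono divide_strict_left_mono) auto
    have "g0 / (4 * C1) = (g0 / 2) / (2 * C1)" by simp
    also have "\<dots> < (g0 - 2 * \<delta>) / (2 * C1)" using \<delta> C1 by (intro divide_strict_right_mono) auto
    finally show "\<epsilon>1 < \<epsilon>2 * ((g0 - 2 * \<delta>) / (2 * C1))" unfolding \<epsilon>1_def q_def
      using \<epsilon>2(1) by (intro mult_strict_left_mono) auto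
    have "(\<epsilon>1 / l + \<epsilon>2 * (1 + (1 + C\<^sup>2) / (4 * \<delta>))) / \<zeta> + \<epsilon>2 * (G0 * C\<^sup>2 / (4 * \<delta>)) = \<epsilon>2 * X"
      unfolding X_def \<epsilon>1_def by (simp add: distrib_left add_divide_distrib)
    then show "(\<epsilon>1 / l + \<epsilon>2 * (1 + (1 + C\<^sup>2) / (4 * \<delta>))) / \<zeta> + \<epsilon>2 * (G0 * C\<^sup>2 / (4 * \<delta>)) \<le> 1/4"
      using \<epsilon>2 by simp
    show "\<epsilon>1 + \<epsilon>2 \<le> 1/2" using \<epsilon>2 by (simp add: \<epsilon>1_def distrib_left)
    show "\<epsilon>1 * C\<^sup>2 \<le> l / 2" using \<epsilon>2 by (simp add: \<epsilon>1_def mult.assoc)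
  qed (use C1 \<delta> \<epsilon>2 k12 k1_le \<sigma> in \<open>auto simp: C1_def k1_def k2_def\<close>)
qed

subsection \<open>Decay of the energy\<close>

lemma L2_norm_sq: "(L2_norm \<Omega> f)\<^sup>2 = (LINT x|lebesgue_on \<Omega>. (norm (f x))\<^sup>2)"
  by (simp add: L2_norm_def)

lemma L2_norm_diff:
  assumes "\<Omega> \<in> sets lebesgue" "f \<in> L2 \<Omega>" "h \<in> L2 \<Omega>"
  shows "(LINT x|lebesgue_on \<Omega>. (norm (f x - h x))\<^sup>2) = (norm (to_l2 \<Omega> f - to_l2 \<Omega> h))\<^sup>2"
  using to_l2_norm[OF assms(1) L2_diff[OF assms(2,3)]] to_l2_diff[OF assms]
  by (simp add: L2_norm_sq)

text \<open>For times in \<open>[t0, T1]\<close> the window may still contain values of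
  \<open>f0\<close>, so there the history term is bounded by a fixed integral, while the elastic
  part is bounded by continuity.\<close>

lemma energy_decay_solution:
  fixes \<Omega> :: "'a::euclidean_space set"
  assumes open_\<Omega>: "open \<Omega>" and bounded_\<Omega>: "bounded \<Omega>"
    and C: "0 < C" "\<And>w. w \<in> H1_0 \<Omega> \<Longrightarrow> norm (l2_fun \<Omega> w) \<le> C * norm (l2_grad \<Omega> w)"
    and \<tau>: "0 < \<tau>" and \<zeta>: "0 < \<zeta>" and l: "0 < l" and t0: "0 < t0" and g0: "0 < g0" and G0: "0 < G 0"
    and gG: "\<And>t. 0 \<le> t \<Longrightarrow> g t = G t"
    and G: "\<And>t. (G has_real_derivative G' t) (at t)" "continuous_on UNIV G'"
    and G_nonneg: "\<And>t. 0 \<le> t \<Longrightarrow> 0 \<le> G t"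
    and G_decay: "\<And>t. 0 \<le> t \<Longrightarrow> G' t \<le> - \<zeta> * G t"
    and mass_le: "\<And>t. 0 \<le> t \<Longrightarrow> integral {0..t} G \<le> 1 - l"
    and mass_ge: "\<And>t. t0 \<le> t \<Longrightarrow> g0 \<le> integral {0..t} G"
    and pos: "0 < \<delta>" "0 < \<epsilon>1" "0 < \<epsilon>2" "0 < \<xi>" "0 < \<sigma>"
    and C1: "1 + C\<^sup>2 / l \<le> C1"
    and \<delta>: "\<delta> < l * g0 / (16 * C1)" and \<epsilon>1: "\<epsilon>2 * (g0 / (8 * C1)) < \<epsilon>1"
    and mu: "\<bar>\<mu>\<bar> \<le> 1" "\<bar>\<mu>\<bar> < 2 * (\<epsilon>2 * (g0 - \<delta>) - \<epsilon>1 * C1) - \<xi>"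
      "\<bar>\<mu>\<bar> < \<xi> * exp (- \<sigma> * \<tau>) - 2 * (\<epsilon>1 * C1 + \<epsilon>2 * \<delta>)"
    and small: "(\<epsilon>1 / l + \<epsilon>2 * (1 + (1 + C\<^sup>2) / (4 * \<delta>))) / \<zeta> + \<epsilon>2 * (G 0 * C\<^sup>2 / (4 * \<delta>)) \<le> 1/4"
      "\<epsilon>1 + \<epsilon>2 \<le> 1/2" "\<epsilon>1 * C\<^sup>2 \<le> l / 2" "\<epsilon>2 * C\<^sup>2 \<le> 1/2"
    and f0: "f0 \<in> L2_time {-\<tau><..<0} (L2 \<Omega>) (L2_norm \<Omega>)"
    and sol: "is_solution \<Omega> g \<mu> \<tau> u0 u1 f0 u ut"
  shows "\<exists>K>0. \<exists>lam>0. \<forall>t\<ge>t0. energy \<Omega> g \<tau> \<xi> \<sigma> f0 u ut t \<le> K * exp (- lam * \<zeta> * (t - t0))"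
proof -
  note ob = open_\<Omega> bounded_\<Omega>
  note \<Omega>_leb = \<Omega>_lebesgue[OF ob]
  have uC: "u \<in> C_time {0..} (H1_0 \<Omega>) (H1_norm \<Omega>)" and utC: "ut \<in> C_time {0..} (L2 \<Omega>) (L2_norm \<Omega>)"
    using sol by (auto simp: is_solution_def)
  have u0: "u t \<in> H1_0 \<Omega>" if "0 \<le> t" for t using C_time_H1_0(1)[OF ob uC] that by simp
  note uH = H1_0_H1[OF ob u0]
  have uG: "grad \<Omega> (u t) \<in> L2 \<Omega>" if "0 \<le> t" for t using grad_weak_gradient[OF ob uH[OF that]] by simp
  have utL: "ut t \<in> L2 \<Omega>" if "0 \<le> t" for t using utC that by (auto simp: C_time_def)
  interpret ev: viscoelastic_evolution "\<lambda>t. l2_fun \<Omega> (u t)" "\<lambda>t. l2_fun \<Omega> (ut t)" "\<lambda>t. l2_grad \<Omega> (u t)" G G' \<mu> \<tau>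
    by (rule solution_evolution[OF ob sol \<tau> gG G])
  interpret viscoelastic_decay "\<lambda>t. l2_fun \<Omega> (u t)" "\<lambda>t. l2_fun \<Omega> (ut t)" "\<lambda>t. l2_grad \<Omega> (u t)" G G' \<mu> \<tau> \<zeta> l t0 g0 C
  proof unfold_locales
    show "norm (l2_fun \<Omega> (u t)) \<le> C * norm (l2_grad \<Omega> (u t))" if "0 \<le> t" for t by (rule C(2)[OF u0[OF that]])
    show "norm (l2_fun \<Omega> (u t) - l2_fun \<Omega> (u s)) \<le> C * norm (l2_grad \<Omega> (u t) - l2_grad \<Omega> (u s))" if "0 \<le> s" "0 \<le> t" for s t
      using C(2)[OF H1_0_diff[OF ob u0[OF that(2)] u0[OF that(1)]]] H1_diff[OF ob uH[OF that(2)] uH[OF that(1)]] by simp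
  qed (use G_nonneg G_decay \<zeta> G0 l mass_le mass_ge t0 g0 C in \<open>auto simp: ev.mass_def\<close>)
  have LINT_eq: "(LINT s|lebesgue_on {a..b}. f s) = integral {a..b} f" if "continuous_on {a..b} f" for a b and f :: "real \<Rightarrow> real"
    by (rule lebesgue_integral_eq_integral) (auto intro: continuous_imp_integrable_real that)
  have ut_norm: "(L2_norm \<Omega> (ut t))\<^sup>2 = (norm (l2_fun \<Omega> (ut t)))\<^sup>2" if "0 \<le> t" for t
    using to_l2_norm[OF \<Omega>_leb utL[OF that]] by (simp add: l2_fun_def[OF ob])
  define A where "A = (\<lambda>t. 1/2 * ((norm (l2_fun \<Omega> (ut t)))\<^sup>2 + (1 - ev.mass t) * (norm (l2_grad \<Omega> (u t)))\<^sup>2 + ev.mem G t))"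
  define N where "N = (\<lambda>s. (L2_norm \<Omega> (with_history f0 ut s))\<^sup>2)"
  define H where "H = (\<lambda>t. LINT s|lebesgue_on {t-\<tau>..t}. exp (\<sigma> * (s - t)) * N s)"
  have energy_eq: "energy \<Omega> g \<tau> \<xi> \<sigma> f0 u ut t = A t + \<xi>/2 * H t" if t: "0 \<le> t" for t
  proof -
    have "(LINT s|lebesgue_on {0..t}. g s) = (LINT s|lebesgue_on {0..t}. G s)"
      by (intro Bochner_Integration.integral_cong) (auto simp: gG)
    also have "\<dots> = ev.mass t"
      unfolding ev.mass_def by (intro LINT_eq continuous_intros)
    finally have 1: "(LINT s|lebesgue_on {0..t}. g s) = ev.mass t" .
    have "memory_term \<Omega> g (\<lambda>s. grad \<Omega> (u s)) t = (LINT s|lebesgue_on {0..t}. G (t - s) * (norm (l2_grad \<Omega> (u t) - l2_grad \<Omega> (u s)))\<^sup>2)"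
      unfolding memory_term_def
      by (intro Bochner_Integration.integral_cong)
        (auto simp: gG t L2_norm_diff[OF \<Omega>_leb uG uG] l2_grad_def[OF ob])
    also have "\<dots> = ev.mem G t"
      unfolding ev.mem_def by (intro LINT_eq continuous_intros) (use t in auto)
    finally have 2: "memory_term \<Omega> g (\<lambda>s. grad \<Omega> (u s)) t = ev.mem G t" .
    have 3: "(L2_norm \<Omega> (grad \<Omega> (u t)))\<^sup>2 = (norm (l2_grad \<Omega> (u t)))\<^sup>2"
      using to_l2_norm[OF \<Omega>_leb uG[OF t]] by (simp add: l2_grad_def[OF ob])
    have 4: "(LINT x|lebesgue_on \<Omega>. exp (\<sigma> * (s - t)) * (with_history f0 ut s x)\<^sup>2) = exp (\<sigma> * (s - t)) * N s" for s
      by (simp add: N_def L2_norm_sq)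
    show ?thesis unfolding energy_def 1 2 3 4 ut_norm[OF t] A_def H_def by simp
  qed
  \<comment> \<open>Beyond \<tau> the window \<open>{t-\<tau>..t}\<close> contains nonnegative times
    only, so that the energy coincides with \<open>ev.En\<close>.\<close>
  define T1 where "T1 = max t0 \<tau> + 1"
  have T1: "\<tau> < T1" "t0 < T1" by (auto simp: T1_def)
  have energy_En: "energy \<Omega> g \<tau> \<xi> \<sigma> f0 u ut t = ev.En \<xi> \<sigma> t" if t: "T1 \<le> t" for t
  proof -
    have "H t = (LINT s|lebesgue_on {t-\<tau>..t}. exp (\<sigma> * (s - t)) * (norm (l2_fun \<Omega> (ut s)))\<^sup>2)"
      unfolding H_def N_def using t T1
      by (intro Bochner_Integration.integral_cong) (auto simp: with_history_def ut_norm)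
    also have "\<dots> = ev.hist \<sigma> t"
      unfolding ev.hist_def using t T1 \<tau> by (intro LINT_eq continuous_intros) auto
    finally show ?thesis using energy_eq[of t] t T1 \<tau> by (simp add: ev.En_def A_def)
  qed
  obtain lam where lam: "0 < lam" "\<And>t. T1 \<le> t \<Longrightarrow> ev.En \<xi> \<sigma> t \<le> 3 * ev.En \<xi> \<sigma> T1 * exp (- lam * (t - T1))"
    using energy_decay[OF T1(1) less_imp_le[OF T1(2)] pos C1 \<delta> \<epsilon>1 mu small] by blast
  obtain B1 where B1: "\<And>t. t \<in> {0..T1} \<Longrightarrow> A t \<le> B1"
  proof -
    have "continuous_on {0..T1} (\<lambda>t. ev.mem G t)"
      unfolding ev.mem_def
      by (rule continuous_on_integral_upper) (auto simp: split_beta intro!: continuous_intros)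
    moreover have "continuous_on {0..T1} (\<lambda>t. ev.mass t)"
      unfolding ev.mass_def
      by (rule continuous_on_integral_upper) (auto simp: split_beta intro!: continuous_intros)
    ultimately have "continuous_on {0..T1} A"
      unfolding A_def by (intro continuous_intros) auto
    from compact_imp_bounded[OF compact_continuous_image[OF this]] have "\<exists>b. \<forall>t\<in>{0..T1}. \<bar>A t\<bar> \<le> b"
      by (auto simp: bounded_iff)
    then show ?thesis using that by (meson abs_le_D1)
  qed
  \<comment> \<open>A common integrable majorant for all windows ending in \<open>[t0, T1]\<close>:
    square integrability of \<open>f0\<close> takes care of the negative times, continuity of
    \<open>ut\<close> of the others.\<close>
  define D where "D = (\<lambda>s. indicator {-\<tau><..<0} s *\<^sub>R N s + indicator {0..T1} s *\<^sub>R N s)"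
  have N0: "0 \<le> N s" for s by (simp add: N_def)
  have intD: "integrable lebesgue D"
  proof -
    have "integrable (lebesgue_on {-\<tau><..<0}) (\<lambda>s. (L2_norm \<Omega> (f0 s))\<^sup>2)" using f0 by (simp add: L2_time_def)
    also have "?this \<longleftrightarrow> integrable (lebesgue_on {-\<tau><..<0}) N"
      by (intro Bochner_Integration.integrable_cong) (auto simp: N_def with_history_def)
    finally have 1: "integrable lebesgue (\<lambda>s. indicator {-\<tau><..<0} s *\<^sub>R N s)"
      by (simp add: integrable_restrict_space)
    have "integrable (lebesgue_on {0..T1}) (\<lambda>s. (norm (l2_fun \<Omega> (ut s)))\<^sup>2)"
      by (intro continuous_imp_integrable_real continuous_intros) auto
    also have "?this \<longleftrightarrow> integrable (lebesgue_on {0..T1}) N"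
      by (intro Bochner_Integration.integrable_cong) (auto simp: N_def with_history_def ut_norm)
    finally have 2: "integrable lebesgue (\<lambda>s. indicator {0..T1} s *\<^sub>R N s)"
      by (simp add: integrable_restrict_space)
    show ?thesis unfolding D_def by (rule Bochner_Integration.integrable_add[OF 1 2])
  qed
  define B2 where "B2 = (LINT s|lebesgue. D s)"
  have B2: "H t \<le> B2" if t: "t0 \<le> t" "t \<le> T1" for t
  proof -
    have "H t = (LINT s|lebesgue. indicator {t-\<tau>..t} s *\<^sub>R (exp (\<sigma> * (s - t)) * N s))"
      unfolding H_def by (subst integral_restrict_space) auto
    also have "\<dots> \<le> B2" unfolding B2_def
    proof (rule integral_mono'[OF intD])
      fix s
      show "indicator {t-\<tau>..t} s *\<^sub>R (exp (\<sigma> * (s - t)) * N s) \<le> D s"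
      proof (cases "s \<in> {t-\<tau>..t}")
        case True
        then have "exp (\<sigma> * (s - t)) * N s \<le> N s"
          using pos by (intro mult_left_le_one_le N0) (auto simp: mult_le_0_iff)
        \<comment> \<open>Because \<open>t \<ge> t0 > 0\<close>, the window starts strictly after
          \<open>- \<tau>\<close> and avoids the end point that the open interval leaves
          out.\<close>
        moreover have "D s = N s" using True t t0 T1 by (auto simp: D_def indicator_def)
        ultimately show ?thesis using True by simp
      qed (use N0 in \<open>simp add: D_def\<close>)
      show "0 \<le> D s" using N0 by (simp add: D_def)
    qed
    finally show ?thesis .
  qed
  define M where "M = \<bar>B1 + \<xi>/2 * B2\<bar> + \<bar>3 * ev.En \<xi> \<sigma> T1\<bar> + 1"
  have M: "B1 + \<xi>/2 * B2 \<le> M" "3 * ev.En \<xi> \<sigma> T1 \<le> M" "0 < M"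
    unfolding M_def by (auto intro: add_nonneg_pos)
  \<comment> \<open>The abstract rate is divided by \<zeta> to fit the form of the claim, and
    \<open>exp (lam * (T1 - t0))\<close> moves the origin of the decay from \<open>T1\<close> to
    \<open>t0\<close>.\<close>
  have decay: "energy \<Omega> g \<tau> \<xi> \<sigma> f0 u ut t \<le> M * exp (lam * (T1 - t0)) * exp (- (lam / \<zeta>) * \<zeta> * (t - t0))" if t: "t0 \<le> t" for t
  proof -
    have e: "M * exp (lam * (T1 - t0)) * exp (- (lam / \<zeta>) * \<zeta> * (t - t0)) = M * exp (- lam * (t - T1))"
      using \<zeta> by (simp add: algebra_simps flip: exp_add)
    show ?thesis
    proof (cases "T1 \<le> t")
      case True
      have "energy \<Omega> g \<tau> \<xi> \<sigma> f0 u ut t \<le> 3 * ev.En \<xi> \<sigma> T1 * exp (- lam * (t - T1))"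
        using energy_En[OF True] lam(2)[OF True] by simp
      also have "\<dots> \<le> M * exp (- lam * (t - T1))" using M by (intro mult_right_mono) auto
      finally show ?thesis unfolding e .
    next
      case False
      have "energy \<Omega> g \<tau> \<xi> \<sigma> f0 u ut t \<le> B1 + \<xi>/2 * B2"
        using energy_eq[of t] B1[of t] B2[of t] t t0 False pos by (auto intro!: add_mono mult_left_mono)
      also have "\<dots> \<le> M * 1" using M by simp
      also have "\<dots> \<le> M * exp (- lam * (t - T1))"
        using M False lam by (intro mult_left_mono) (auto simp: mult_le_0_iff mult_nonneg_nonpos)
      finally show ?thesis unfolding e .
    qed
  qed
  show ?thesis
    using M lam \<zeta> decay by (intro exI[of _ "M * exp (lam * (T1 - t0))"] conjI exI[of _ "lam / \<zeta>"]) auto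
qed

text \<open>Continuing \<open>g\<close> by its tangent at 0 turns the one-sided derivative there
  into a two-sided one and keeps the derivative continuous.\<close>

lemma C1_extension:
  fixes g g' :: "real \<Rightarrow> real"
  assumes g: "\<And>t. 0 \<le> t \<Longrightarrow> (g has_real_derivative g' t) (at t within {0..})" and g': "continuous_on {0..} g'"
  obtains G G' where "\<And>t. 0 \<le> t \<Longrightarrow> G t = g t" "\<And>t. 0 \<le> t \<Longrightarrow> G' t = g' t"
    "\<And>t. (G has_real_derivative G' t) (at t)" "continuous_on UNIV G'"
proof -
  define G where "G = (\<lambda>t. if t \<in> {0..} then g t else g 0 + g' 0 * t)"
  define G' where "G' = (\<lambda>t. g' (max 0 t))"
  have "(G has_real_derivative G' t) (at t)" for t
  proof -
    have cl: "closure {0..} = {0::real..}" "closure {..<0} = {..0::real}" "{0..} \<union> {0::real..} \<inter> {..0} = {0..}"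
      "{..<0} \<union> {0::real..} \<inter> {..0} = {..0}"
      by auto
    have "((\<lambda>x. if x \<in> {0..} then g x else g 0 + g' 0 * x) has_vector_derivative
      (if t \<in> {0..} then g' t else g' 0)) (at t within UNIV)"
      by (rule has_vector_derivative_If_within_closures[where T="{..<0}"], unfold cl)
        (auto simp flip: has_real_derivative_iff_has_vector_derivative intro!: g derivative_eq_intros)
    moreover have "(if t \<in> {0..} then g' t else g' 0) = G' t" by (auto simp: G'_def)
    ultimately show ?thesis by (simp add: G_def has_real_derivative_iff_has_vector_derivative)
  qed
  moreover have "continuous_on UNIV G'"
    unfolding G'_def by (rule continuous_on_compose2[OF g']) (auto intro!: continuous_intros)
  ultimately show ?thesis using that[of G G'] by (auto simp: G_def G'_def)
qed

theorem theorem4p1: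
  fixes \<Omega> :: "(real ^ 'n) set"
    and g g' :: "real \<Rightarrow> real"
    and \<tau> \<zeta> l t0 g0 :: real
  assumes domain: "open \<Omega>" "connected \<Omega>" "\<Omega> \<noteq> {}" "bounded \<Omega>" "C2_boundary \<Omega>"
    and "0 < \<tau>"
    and g_nonneg: "\<And>t. 0 \<le> t \<Longrightarrow> 0 \<le> g t"
    and g_deriv: "\<And>t. 0 \<le> t \<Longrightarrow> (g has_real_derivative g' t) (at t within {0..})"
    and g'_cont: "continuous_on {0..} g'"
    and "0 < g 0"
    and g_integrable: "integrable (lebesgue_on {0..}) g"
    and l: "1 - (LINT s|lebesgue_on {0..}. g s) = l" "0 < l"
    and "0 < \<zeta>"
    and g_decay: "\<And>t. 0 < t \<Longrightarrow> g' t \<le> - \<zeta> * g t"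
    and "0 < t0"
    and g0: "g0 = (LINT s|lebesgue_on {0..t0}. g s)"
  shows "\<exists>C1>0. \<exists>C7>0. \<exists>\<delta>2>0. \<exists>\<epsilon>1>0. \<exists>\<epsilon>2>0. \<exists>\<sigma>>0. \<exists>\<xi>>0.
    let k1 = \<epsilon>2 * (g0 - \<delta>2) - \<epsilon>1 * C1;
        k2 = \<epsilon>1 * C1 + \<epsilon>2 * \<delta>2;
        a = min (2 * k1 - \<xi>) (\<xi> * exp (- \<sigma> * \<tau>) - 2 * k2)
    in
      \<delta>2 < min (g0 / 4) (l * g0 / (16 * C1)) \<and>
      \<epsilon>2 < \<delta>2 / (2 * C7) \<and>
      \<epsilon>2 * (g0 / (8 * C1)) < \<epsilon>1 \<and>
      \<epsilon>1 < \<epsilon>2 * ((g0 - 2 * \<delta>2) / (2 * C1)) \<and>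
      2 * k2 * exp (\<sigma> * \<tau>) < \<xi> \<and>
      \<xi> < 2 * k1 \<and>
      0 < a \<and>
      (\<forall>\<mu> u0 u1 f0 u ut.
         \<bar>\<mu>\<bar> < a \<longrightarrow>
         u0 \<in> H1_0 \<Omega> \<longrightarrow>
         u1 \<in> L2 \<Omega> \<longrightarrow>
         f0 \<in> L2_time {-\<tau><..<0} (L2 \<Omega>) (L2_norm \<Omega>) \<longrightarrow>
         is_solution \<Omega> g \<mu> \<tau> u0 u1 f0 u ut \<longrightarrow>
         (\<exists>K>0. \<exists>lam>0. \<forall>t\<ge>t0. energy \<Omega> g \<tau> \<xi> \<sigma> f0 u ut t \<le> K * exp (- lam * \<zeta> * (t - t0))))"
proof -
  have \<Omega>: "open \<Omega>" "bounded \<Omega>" by (rule domain)+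
  obtain C where C: "0 < C" "\<And>w. w \<in> H1_0 \<Omega> \<Longrightarrow> norm (l2_fun \<Omega> w) \<le> C * norm (l2_grad \<Omega> w)"
    using poincare_inequality[OF \<Omega>] by blast
  obtain G G' where G: "\<And>t. 0 \<le> t \<Longrightarrow> G t = g t" "\<And>t. 0 \<le> t \<Longrightarrow> G' t = g' t"
    "\<And>t. (G has_real_derivative G' t) (at t)" "continuous_on UNIV G'"
    using C1_extension[OF g_deriv g'_cont] by blast
  have cG: "continuous_on S G" for S
    by (auto intro!: continuous_at_imp_continuous_on DERIV_isCont[OF G(3)])
  have G_nonneg: "0 \<le> G t" if "0 \<le> t" for t using G(1) g_nonneg that by simp
  \<comment> \<open>At 0 the inequality is the limit from the right of those at positive
    times.\<close>
  have G_decay: "G' t \<le> - \<zeta> * G t" if t: "0 \<le> t" for t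
  proof (cases "t = 0")
    case True
    have "isCont (\<lambda>t. G' t + \<zeta> * G t) 0"
      using G(4) cG[of UNIV] by (auto intro!: continuous_intros simp: continuous_on_eq_continuous_at)
    then have "((\<lambda>t. G' t + \<zeta> * G t) \<longlongrightarrow> G' 0 + \<zeta> * G 0) (at_right 0)"
      by (auto simp: isCont_def intro: filterlim_at_split[THEN iffD1, THEN conjunct2])
    moreover have "\<forall>\<^sub>F t in at_right 0. G' t + \<zeta> * G t \<le> 0"
      using eventually_at_right_less
    proof (rule eventually_mono)
      show "G' t + \<zeta> * G t \<le> 0" if "0 < t" for t :: real using g_decay[OF that] G(1,2) that by simp
    qed
    ultimately have "G' 0 + \<zeta> * G 0 \<le> 0" by (rule tendsto_upperbound) simp
    then show ?thesis using True by simp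
  next
    case False
    then show ?thesis using g_decay[of t] G(1,2) t by simp
  qed
  have LINT_G: "(LINT s|lebesgue_on {0..t}. g s) = integral {0..t} G" for t
  proof -
    have "(LINT s|lebesgue_on {0..t}. g s) = (LINT s|lebesgue_on {0..t}. G s)"
      by (intro Bochner_Integration.integral_cong) (auto simp: G(1))
    also have "\<dots> = integral {0..t} G"
      by (rule lebesgue_integral_eq_integral) (auto intro: continuous_imp_integrable_real cG)
    finally show ?thesis .
  qed
  have mass_le: "integral {0..t} G \<le> 1 - l" for t
  proof -
    have i: "integrable lebesgue (\<lambda>s. indicator {0..} s *\<^sub>R g s)"
      using g_integrable by (simp add: integrable_restrict_space)
    have "(LINT s|lebesgue_on {0..t}. g s) = (LINT s|lebesgue. indicator {0..t} s *\<^sub>R g s)"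
      by (subst integral_restrict_space) auto
    also have "\<dots> \<le> (LINT s|lebesgue. indicator {0..} s *\<^sub>R g s)"
      by (rule integral_mono'[OF i]) (auto simp: indicator_def g_nonneg)
    also have "\<dots> = (LINT s|lebesgue_on {0..}. g s)"
      by (subst integral_restrict_space) auto
    finally show ?thesis using LINT_G[of t] l(1) by simp
  qed
  have g0_eq: "g0 = integral {0..t0} G" unfolding g0 by (rule LINT_G)
  have mass_ge: "g0 \<le> integral {0..t} G" if "t0 \<le> t" for t
    unfolding g0_eq
    by (rule integral_subset_le) (use that in \<open>auto intro: integrable_continuous_real cG G_nonneg\<close>)
  \<comment> \<open>A nonnegative continuous function with integral 0 would vanish at 0, against
    \<open>0 < g 0\<close>.\<close>
  have g0_pos: "0 < g0"
  proof -
    have "0 \<le> g0" unfolding g0_eq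
      by (rule integral_nonneg) (auto intro: integrable_continuous_real cG G_nonneg)
    moreover have "g0 \<noteq> 0"
    proof
      assume "g0 = 0"
      then have "G 0 = 0"
        using integral_eq_0_iff[of 0 t0 G] cG \<open>0 < t0\<close> G_nonneg unfolding g0_eq by auto
      then show False using \<open>0 < g 0\<close> G(1)[of 0] by simp
    qed
    ultimately show ?thesis by simp
  qed
  have "g0 < 1" using mass_le[of t0] l(2) unfolding g0_eq by simp
  from constants_exist[OF l(2) g0_pos this C(1) \<open>0 < \<zeta>\<close> \<open>0 < g 0\<close> \<open>0 < \<tau>\<close>]
  obtain C1 \<delta> \<epsilon>1 \<epsilon>2 \<sigma> \<xi> k1 k2 where c: "0 < C1" "0 < \<delta>" "0 < \<epsilon>1" "0 < \<epsilon>2" "0 < \<sigma>" "0 < \<xi>"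
    "k1 = \<epsilon>2 * (g0 - \<delta>) - \<epsilon>1 * C1" "k2 = \<epsilon>1 * C1 + \<epsilon>2 * \<delta>"
    "\<delta> < g0 / 4" "\<delta> < l * g0 / (16 * C1)" "\<epsilon>2 < \<delta> / 2"
    "\<epsilon>2 * (g0 / (8 * C1)) < \<epsilon>1" "\<epsilon>1 < \<epsilon>2 * ((g0 - 2 * \<delta>) / (2 * C1))"
    "2 * k2 * exp (\<sigma> * \<tau>) < \<xi>" "\<xi> < 2 * k1" "1 + C\<^sup>2 / l \<le> C1" "2 * k1 \<le> 1"
    and small: "(\<epsilon>1 / l + \<epsilon>2 * (1 + (1 + C\<^sup>2) / (4 * \<delta>))) / \<zeta> + \<epsilon>2 * (g 0 * C\<^sup>2 / (4 * \<delta>)) \<le> 1/4"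
    "\<epsilon>1 + \<epsilon>2 \<le> 1/2" "\<epsilon>1 * C\<^sup>2 \<le> l / 2" "\<epsilon>2 * C\<^sup>2 \<le> 1/2" .
  \<comment> \<open>Dividing the lower bound of \<xi> by \<open>exp (\<sigma> * \<tau>)\<close>
    makes the second entry of the minimum positive; the first is positive by
    \<open>\<xi> < 2 * k1\<close>.\<close>
  have "2 * k2 * exp (\<sigma> * \<tau>) * exp (- \<sigma> * \<tau>) < \<xi> * exp (- \<sigma> * \<tau>)"
    using c(14) by (rule mult_strict_right_mono) simp
  then have a2: "0 < \<xi> * exp (- \<sigma> * \<tau>) - 2 * k2"
    by (simp add: mult.assoc flip: exp_add)
  have main: "\<exists>K>0. \<exists>lam>0. \<forall>t\<ge>t0. energy \<Omega> g \<tau> \<xi> \<sigma> f0 u ut t \<le> K * exp (- lam * \<zeta> * (t - t0))"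
    if mu: "\<bar>\<mu>\<bar> < min (2 * k1 - \<xi>) (\<xi> * exp (- \<sigma> * \<tau>) - 2 * k2)"
      and f0: "f0 \<in> L2_time {-\<tau><..<0} (L2 \<Omega>) (L2_norm \<Omega>)" and sol: "is_solution \<Omega> g \<mu> \<tau> u0 u1 f0 u ut"
    for \<mu> u0 u1 f0 u ut
  proof (rule energy_decay_solution[OF \<Omega> C \<open>0 < \<tau>\<close> \<open>0 < \<zeta>\<close> l(2) \<open>0 < t0\<close> g0_pos _ _ G(3,4) G_nonneg G_decay
        mass_le mass_ge c(2,3,4,6,5,16,10,12) _ _ _ _ small(2,3,4) f0 sol])
    show "\<bar>\<mu>\<bar> \<le> 1" "\<bar>\<mu>\<bar> < 2 * (\<epsilon>2 * (g0 - \<delta>) - \<epsilon>1 * C1) - \<xi>"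
      "\<bar>\<mu>\<bar> < \<xi> * exp (- \<sigma> * \<tau>) - 2 * (\<epsilon>1 * C1 + \<epsilon>2 * \<delta>)"
      using mu c by auto
    show "(\<epsilon>1 / l + \<epsilon>2 * (1 + (1 + C\<^sup>2) / (4 * \<delta>))) / \<zeta> + \<epsilon>2 * (G 0 * C\<^sup>2 / (4 * \<delta>)) \<le> 1/4"
      using small(1) G(1)[of 0] by simp
  qed (use G(1) \<open>0 < g 0\<close> in auto)
  show ?thesis
    unfolding Let_def
    apply (rule exI[of _ C1], rule conjI[OF c(1)], rule exI[of _ 1], rule conjI[OF zero_less_one])
    apply (rule exI[of _ \<delta>], rule conjI[OF c(2)], rule exI[of _ \<epsilon>1], rule conjI[OF c(3)])
    apply (rule exI[of _ \<epsilon>2], rule conjI[OF c(4)], rule exI[of _ \<sigma>], rule conjI[OF c(5)])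
    apply (rule exI[of _ \<xi>], rule conjI[OF c(6)])
    unfolding c(7,8)[symmetric]
    using c(9-15) a2 main by (intro conjI allI impI) auto
qed

end
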